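(* Let $W$ be a $d\times d$ matrix weight on $\mathbb{R}$ satisfying the matrix $A_2$ condition and let $\sigma=\{\sigma_I\}_{I\in\mathcal{D}}$ be a sequence of complex $d\times d$ matrices indexed by the dyadic intervals. Then the Haar multiplier $T_\sigma$ is bounded on $L^2(W)$ if and only if $\|\sigma\|_\infty<\infty$. Moreover, there is a constant $C(d)$ depending only on $d$ (not on $W$, $\sigma$ or $f$) such that $$\|T_\sigma f\|_{L^2(W)} \le C(d)\,[W]_{A_2}^{3/2}\left(1+\log [W]_{A_2}\right)\|\sigma\|_\infty\,\|f\|_{L^2(W)}\qquad\text{for all } f\in L^2(W).$$
   Context: A $d\times d$ matrix weight is a function $W$ on $\mathbb{R}$ with values in the complex $d\times d$ matrices, with locally integrable entries, such that $W(x)$ is positive semidefinite for a.e. $x$. $L^2(W)$ is the space of measurable $f:\mathbb{R}\to\mathbb{C}^d$ with $\|f\|_{L^2(W)}^2 = \int_{\mathbb{R}} \langle W(x)f(x),f(x)\rangle_{\mathbb{C}^d}\,dx<\infty$. For an interval $I$, $\langle W\rangle_I = \frac{1}{|I|}\int_I W(x)\,dx$. $W$ satisfies the matrix $A_2$ condition ($W \in A_2$) if $$[W]_{A_2} = \sup_I \left\| \langle W \rangle_I^{1/2}\langle W^{-1}\rangle_I^{1/2}\right\|^2<\infty,$$ the supremum being over all bounded intervals $I\subset\mathbb{R}$, where $\|\cdot\|$ is the operator norm on $\mathbb{C}^d$ (in particular $W$ is invertible a.e. and $W^{-1}$ is locally integrable). $\mathcal{D}$ is any fixed grid $\mathcal{D}^{\alpha,r}=\{\alpha+rI: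 I \text{ a standard dyadic interval}\}$ with $\alpha\in\mathbb{R}$, $r>0$ (for instance the standard dyadic grid); the constant does not depend on $\alpha, r$. For $I\in\mathcal{D}$ with left half $I_-$ and right half $I_+$, the Haar function is $h_I = |I|^{-1/2}(\mathbf{1}_{I_+}-\mathbf{1}_{I_-})$, and $\widehat{f}(I) = \int_I f(x)h_I(x)\,dx \in \mathbb{C}^d$. The Haar multiplier associated to $\sigma$ is $T_\sigma f = \sum_{I\in\mathcal{D}} \sigma_I \widehat{f}(I) h_I$. It is defined initially on finite linear combinations of the functions $h_I e$ ($I\in\mathcal{D}$, $e\in\mathbb{C}^d$), which are dense in $L^2(W)$; "bounded on $L^2(W)$" means that it extends to a bounded operator on $L^2(W)$, again denoted $T_\sigma$. The quantity $\|\sigma\|_\infty$ (which depends on $W$) is $$\|\sigma\|_\infty = \inf\left\{C : \langle W\rangle_I^{-1/2}\sigma_I^*\langle W\rangle_I\sigma_I\langle W\rangle_I^{-1/2}\le C^2 I_{d\times d}\ \ \forall I\in\mathcal{D}\right\} = \sup_{I\in\mathcal{D}}\left\|\langle W\rangle_I^{1/2}\sigma_I\langle W\rangle_I^{-1/2}\right\|,$$ the infimum being over $C \ge 0$, with value $+\infty$ if no such $C$ exists. *)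

theory Defs
  imports "HOL-Analysis.Analysis"
begin

section \<open>Complex matrices\<close>

definition cinner :: "complex^'n \<Rightarrow> complex^'n \<Rightarrow> complex" where
  "cinner x y = (\<Sum>i\<in>UNIV. x $ i * cnj (y $ i))"

definition mat_adjoint :: "complex^'n^'n \<Rightarrow> complex^'n^'n" where
  "mat_adjoint A = (\<chi> i j. cnj (A $ j $ i))"

definition psd :: "complex^'n^'n \<Rightarrow> bool" where
  "psd A \<longleftrightarrow> mat_adjoint A = A \<and> (\<forall>x. 0 \<le> Re (cinner (A *v x) x))"

definition loewner_le :: "complex^'n^'n \<Rightarrow> complex^'n^'n \<Rightarrow> bool" where
  "loewner_le A B \<longleftrightarrow> psd (B - A)"

definition mat_sqrt :: "complex^'n^'n \<Rightarrow> complex^'n^'n" where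
  "mat_sqrt A = (THE B. psd B \<and> B ** B = A)"

text \<open>The norm of \<^typ>\<open>complex^'n\<close> is the Euclidean one, so this is the operator norm on
  the complex Hilbert space.\<close>

definition mat_norm :: "complex^'n^'n \<Rightarrow> real" where
  "mat_norm A = onorm ((*v) A)"


section \<open>Matrix weights\<close>

definition locally_integrable :: "(real \<Rightarrow> complex) \<Rightarrow> bool" where
  "locally_integrable f \<longleftrightarrow> (\<forall>a b. set_integrable lebesgue {a..b} f)"

definition matrix_weight :: "(real \<Rightarrow> complex^'n^'n) \<Rightarrow> bool" where
  "matrix_weight W \<longleftrightarrow>
     (\<forall>i j. locally_integrable (\<lambda>x. W x $ i $ j)) \<and> (AE x in lebesgue. psd (W x))"

definition average :: "(real \<Rightarrow> complex^'n^'n) \<Rightarrow> real set \<Rightarrow> complex^'n^'n" where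
  "average W I = (1 / measure lebesgue I) *\<^sub>R (LINT x:I|lebesgue. W x)"

definition bounded_interval :: "real set \<Rightarrow> bool" where
  "bounded_interval I \<longleftrightarrow> is_interval I \<and> bounded I \<and> 0 < measure lebesgue I"

definition A2_char :: "(real \<Rightarrow> complex^'n^'n) \<Rightarrow> ereal" where
  "A2_char W = (SUP I\<in>{I. bounded_interval I}.
     ereal ((mat_norm (mat_sqrt (average W I) **
                       mat_sqrt (average (\<lambda>x. matrix_inv (W x)) I)))\<^sup>2))"

definition matrix_A2 :: "(real \<Rightarrow> complex^'n^'n) \<Rightarrow> bool" where
  "matrix_A2 W \<longleftrightarrow> matrix_weight W \<and>
     (AE x in lebesgue. invertible (W x)) \<and>
     (\<forall>i j. locally_integrable (\<lambda>x. matrix_inv (W x) $ i $ j)) \<and>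
     A2_char W < \<infinity>"

text \<open>The elements of \<open>L\<^sup>2(W)\<close> are represented by functions rather than by classes of functions
  modulo equality almost everywhere. As \<open>W\<close> is positive semidefinite almost everywhere, the
  integrand is real and nonnegative almost everywhere, and integrability expresses that the
  integral is finite.\<close>

definition L2W :: "(real \<Rightarrow> complex^'n^'n) \<Rightarrow> (real \<Rightarrow> complex^'n) set" where
  "L2W W = {f. f \<in> borel_measurable lebesgue \<and>
               integrable lebesgue (\<lambda>x. Re (cinner (W x *v f x) (f x)))}"

definition L2W_norm :: "(real \<Rightarrow> complex^'n^'n) \<Rightarrow> (real \<Rightarrow> complex^'n) \<Rightarrow> real" where
  "L2W_norm W f = sqrt (LINT x|lebesgue. Re (cinner (W x *v f x) (f x)))"


section \<open>Dyadic grids and Haar functions\<close>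

definition standard_dyadic :: "real set set" where
  "standard_dyadic = {{of_int k * 2 powi j ..< (of_int k + 1) * 2 powi j} | j k. True}"

definition dyadic_grid :: "real \<Rightarrow> real \<Rightarrow> real set set" where
  "dyadic_grid \<alpha> r = (\<lambda>I. (\<lambda>x. \<alpha> + r * x) ` I) ` standard_dyadic"

definition left_half :: "real set \<Rightarrow> real set" where
  "left_half I = {x \<in> I. x < (Inf I + Sup I) / 2}"

definition right_half :: "real set \<Rightarrow> real set" where
  "right_half I = {x \<in> I. (Inf I + Sup I) / 2 \<le> x}"

definition haar :: "real set \<Rightarrow> real \<Rightarrow> real" where
  "haar I x = (indicat_real (right_half I) x - indicat_real (left_half I) x)
              / sqrt (measure lebesgue I)"

definition haar_coeff :: "(real \<Rightarrow> complex^'n) \<Rightarrow> real set \<Rightarrow> complex^'n" where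
  "haar_coeff f I = (LINT x:I|lebesgue. haar I x *\<^sub>R f x)"

definition haar_span :: "real set set \<Rightarrow> (real \<Rightarrow> complex^'n) set" where
  "haar_span D = {f. \<exists>F e. finite F \<and> F \<subseteq> D \<and> f = (\<lambda>x. \<Sum>I\<in>F. haar I x *\<^sub>R e I)}"


section \<open>Haar multipliers\<close>

text \<open>For \<open>f\<close> in the linear span of the Haar functions only finitely many coefficients are
  nonzero, so that the following sum is finite; the definition is only used for such \<open>f\<close>.\<close>

definition haar_multiplier ::
  "real set set \<Rightarrow> (real set \<Rightarrow> complex^'n^'n) \<Rightarrow> (real \<Rightarrow> complex^'n) \<Rightarrow> real \<Rightarrow> complex^'n" where
  "haar_multiplier D \<sigma> f =
     (\<lambda>x. \<Sum>I\<in>{I \<in> D. haar_coeff f I \<noteq> 0}. haar I x *\<^sub>R (\<sigma> I *v haar_coeff f I))"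

text \<open>Since \<open>L2W W\<close> consists of functions, linearity is required up to null sets. Together with
  boundedness it implies that \<open>T\<close> respects equality almost everywhere (for invertible weights),
  so \<open>T\<close> is a bounded linear operator on the space of classes. By density of the
  span, it is unique up to null sets.\<close>

definition bounded_extension ::
  "(real \<Rightarrow> complex^'n^'n) \<Rightarrow> real set set \<Rightarrow> (real set \<Rightarrow> complex^'n^'n)
    \<Rightarrow> ((real \<Rightarrow> complex^'n) \<Rightarrow> real \<Rightarrow> complex^'n) \<Rightarrow> bool" where
  "bounded_extension W D \<sigma> T \<longleftrightarrow>
     (\<forall>f\<in>L2W W. T f \<in> L2W W) \<and>
     (\<forall>f\<in>L2W W. \<forall>g\<in>L2W W. AE x in lebesgue. T (\<lambda>y. f y + g y) x = T f x + T g x) \<and>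
     (\<forall>c. \<forall>f\<in>L2W W. AE x in lebesgue. T (\<lambda>y. c *s f y) x = c *s T f x) \<and>
     (\<exists>K. \<forall>f\<in>L2W W. L2W_norm W (T f) \<le> K * L2W_norm W f) \<and>
     (\<forall>f\<in>haar_span D. AE x in lebesgue. T f x = haar_multiplier D \<sigma> f x)"

definition bounded_on_L2W ::
  "(real \<Rightarrow> complex^'n^'n) \<Rightarrow> real set set \<Rightarrow> (real set \<Rightarrow> complex^'n^'n) \<Rightarrow> bool" where
  "bounded_on_L2W W D \<sigma> \<longleftrightarrow> (\<exists>T. bounded_extension W D \<sigma> T)"

text \<open>The infimum of the empty set is \<open>\<infinity>\<close>.\<close>

definition sigma_norm ::
  "(real \<Rightarrow> complex^'n^'n) \<Rightarrow> real set set \<Rightarrow> (real set \<Rightarrow> complex^'n^'n) \<Rightarrow> ereal" where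
  "sigma_norm W D \<sigma> = Inf {ereal C | C. 0 \<le> C \<and>
     (\<forall>I\<in>D. loewner_le
        (matrix_inv (mat_sqrt (average W I)) ** mat_adjoint (\<sigma> I) ** average W I
          ** \<sigma> I ** matrix_inv (mat_sqrt (average W I)))
        (mat (of_real (C\<^sup>2))))}"

end

theory Submission
  imports Defs
begin

text \<open>
  Everything reduces to a square function estimate: for \<open>f \<in> L\<^sup>2(W\<^sup>-\<^sup>1)\<close> the sum over the grid of
  \<open>|\<langle>W\<rangle>\<^sub>I\<^sup>-\<^sup>1\<^sup>/\<^sup>2 f\<^sub>I|\<^sup>2\<close>, where \<open>f\<^sub>I\<close> is the Haar coefficient, is at most \<open>K \<parallel>f\<parallel>\<^sup>2\<close> with
  \<open>K = C(d) Q (1 + ln Q)\<close> and \<open>Q = [W]\<close>. Exchanging \<open>W\<close> with \<open>W\<^sup>-\<^sup>1\<close> and using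
  \<open>\<langle>W\<rangle>\<^sub>I \<le> Q \<langle>W\<^sup>-\<^sup>1\<rangle>\<^sub>I\<^sup>-\<^sup>1\<close>, the sum of \<open>|\<langle>W\<rangle>\<^sub>I\<^sup>1\<^sup>/\<^sup>2 f\<^sub>I|\<^sup>2\<close> is at most \<open>Q K \<parallel>f\<parallel>\<^sup>2\<close> in \<open>L\<^sup>2(W)\<close>; dually, a finite
  Haar sum \<open>g\<close> satisfies \<open>\<parallel>g\<parallel>\<^sup>2 \<le> K \<Sum> |\<langle>W\<rangle>\<^sub>I\<^sup>1\<^sup>/\<^sup>2 g\<^sub>I|\<^sup>2\<close>. Hence \<open>\<parallel>T f\<parallel> \<le> K Q\<^sup>1\<^sup>/\<^sup>2 \<parallel>\<sigma>\<parallel> \<parallel>f\<parallel>\<close> on Haar sums.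

  The square function estimate comes from a Bellman function of the averages \<open>f\<close>, \<open>W\<close> and
  \<open>V\<close> of \<open>f\<close>, \<open>W\<close> and \<open>W\<^sup>-\<^sup>1\<close>. Put \<open>m = (ln |det W| + ln |det V|) / (d (1 + ln Q))\<close>, a number between 0 and 1
  whose concavity defect controls the relative increments of \<open>W\<close>, and \<open>X = 2 W - V\<^sup>-\<^sup>1 / (1 + m)\<close>. Since
  \<open>(f, W) \<mapsto> \<langle>W\<^sup>-\<^sup>1 f, f\<rangle>\<close> is jointly convex, the function \<open>2 \<langle>W\<^sup>-\<^sup>1 f, f\<rangle> + 96 d Q (1 + ln Q) \<langle>X\<^sup>-\<^sup>1 f, f\<rangle>\<close>
  gains at least \<open>\<langle>W\<^sup>-\<^sup>1 \<Delta>f, \<Delta>f\<rangle>\<close> in each dyadic step; one term accounts for \<open>\<Delta>f - \<Delta>W W\<^sup>-\<^sup>1 f\<close>, the other one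
  for \<open>\<Delta>W W\<^sup>-\<^sup>1 f\<close>.
\<close>

section \<open>Hermitian forms\<close>

text \<open>The increment of a matrix weight commutes with nothing in general, so its action on W^-1
  f cannot be compared with W as for scalars. The concavity defect of ln |det W| is a scalar that
  dominates it, but this scalar has to be turned into a matrix inequality by a concave function
  comparable to W. Multiplying W by m fails: already for d = 1 the product w ln w is convex.
  Subtracting V^-1 / (1 + m) works, because this quotient is jointly convex in V and m and decreases
  in m, so that the concavity of m only helps. The gain is then a multiple of V^-1, which dominates
  W / Q. This is the source of the factor Q in K, while 1 + ln Q comes from scaling m into [0, 1].

  The theorem concerns every f in L^2(W) and every bounded extension, whose given bound is unrelated
  to K. The estimate on Haar sums therefore needs their density in L^2(W), and the existence of an
  extension needs completeness.\<close>

definition qform :: "complex^'n^'n \<Rightarrow> complex^'n \<Rightarrow> real" where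
  "qform A x = (A *v x) \<bullet> x"

definition posdef :: "complex^'n^'n \<Rightarrow> bool" where
  "posdef A \<longleftrightarrow> mat_adjoint A = A \<and> (\<forall>x. x \<noteq> 0 \<longrightarrow> 0 < qform A x)"

text \<open>Hermitian forms are real, so this identity allows positivity to be tested with the real
  inner product throughout.\<close>

lemma Re_cinner: "Re (cinner x y) = x \<bullet> y"
  by (simp add: cinner_def inner_vec_def inner_complex_def)

lemma psd_iff_qform: "psd A \<longleftrightarrow> mat_adjoint A = A \<and> (\<forall>x. 0 \<le> qform A x)"
  by (simp add: psd_def qform_def Re_cinner)

lemma posdef_imp_psd: "posdef A \<Longrightarrow> psd A"
  unfolding posdef_def psd_iff_qform
  by (metis inner_zero_right less_eq_real_def qform_def)

lemma mat_adjoint_adjoint [simp]: "mat_adjoint (mat_adjoint A) = A"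
  by (simp add: mat_adjoint_def vec_eq_iff)

lemma mat_adjoint_mult: "mat_adjoint (A ** B) = mat_adjoint B ** mat_adjoint A"
  by (simp add: mat_adjoint_def matrix_matrix_mult_def vec_eq_iff mult.commute)

lemma mat_adjoint_add: "mat_adjoint (A + B) = mat_adjoint A + mat_adjoint B"
  by (simp add: mat_adjoint_def vec_eq_iff)

lemma mat_adjoint_diff: "mat_adjoint (A - B) = mat_adjoint A - mat_adjoint B"
  by (simp add: mat_adjoint_def vec_eq_iff)

lemma mat_adjoint_scaleR: "mat_adjoint (c *\<^sub>R A) = c *\<^sub>R mat_adjoint A"
  by (simp add: mat_adjoint_def vec_eq_iff)

lemma mat_adjoint_of_real [simp]: "mat_adjoint (mat (of_real c)) = mat (of_real c)"
  by (simp add: mat_adjoint_def mat_def vec_eq_iff)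

lemma mat_adjoint_1 [simp]: "mat_adjoint (mat 1) = mat 1"
  using mat_adjoint_of_real[of 1] by simp

lemma inner_mat_adjoint:
  fixes A :: "complex^'n^'n"
  shows "(A *v x) \<bullet> y = x \<bullet> (mat_adjoint A *v y)"
proof -
  have "cinner (A *v x) y = cinner x (mat_adjoint A *v y)"
    unfolding cinner_def matrix_vector_mult_def mat_adjoint_def
    by (simp add: sum_distrib_left sum_distrib_right) (subst sum.swap, simp add: mult_ac)
  then show ?thesis
    by (metis Re_cinner)
qed

lemma inner_hermitian:
  "mat_adjoint A = A \<Longrightarrow> (A *v x) \<bullet> y = x \<bullet> (A *v y)"
  by (metis inner_mat_adjoint)

lemma mv_scaleR:
  fixes A :: "complex^'n^'n"
  shows "A *v (c *\<^sub>R x) = c *\<^sub>R (A *v x)"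
  by (simp add: matrix_vector_mult_def vec_eq_iff scaleR_sum_right)

lemma scaleR_mv:
  fixes A :: "complex^'n^'n"
  shows "(c *\<^sub>R A) *v x = c *\<^sub>R (A *v x)"
  by (simp add: matrix_vector_mult_def vec_eq_iff scaleR_sum_right)

lemma mv_uminus:
  fixes A :: "complex^'n^'n"
  shows "A *v (- x) = - (A *v x)"
  using mv_scaleR[of A "-1" x] by simp

lemma mat_of_real_mv: "mat (of_real c) *v (x :: complex^'n) = c *\<^sub>R x"
proof -
  have "mat (of_real c) *v x = (c *\<^sub>R mat 1) *v x"
    by (rule arg_cong[where f="\<lambda>M. M *v x"]) (simp add: mat_def vec_eq_iff of_real_def)
  then show ?thesis
    by (simp add: scaleR_mv)
qed

lemma qform_0 [simp]: "qform A 0 = 0"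
  by (simp add: qform_def)

lemma qform_plus: "qform (A + B) x = qform A x + qform B x"
  by (simp add: qform_def matrix_vector_mult_add_rdistrib inner_add_left)

lemma qform_minus: "qform (A - B) x = qform A x - qform B x"
  by (simp add: qform_def matrix_vector_mult_diff_rdistrib inner_diff_left)

lemma qform_scaleR: "qform (c *\<^sub>R A) x = c * qform A x"
  by (simp add: qform_def scaleR_mv)

lemma qform_scaleR_right: "qform A (c *\<^sub>R x) = c\<^sup>2 * qform A x"
  by (simp add: qform_def mv_scaleR power2_eq_square)

lemma qform_uminus_right: "qform A (- x) = qform A x"
  by (simp add: qform_def mv_uminus)

lemma qform_of_real: "qform (mat (of_real c)) x = c * (norm x)\<^sup>2"
  by (simp add: qform_def mat_of_real_mv power2_norm_eq_inner)

lemma qform_1: "qform (mat 1) x = (norm x)\<^sup>2"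
  using qform_of_real[of 1 x] by simp

lemma qform_congruence: "qform (mat_adjoint B ** A ** B) x = qform A (B *v x)"
  by (metis (no_types, lifting) inner_mat_adjoint matrix_vector_mul_assoc mat_adjoint_adjoint qform_def)

lemma qform_add:
  assumes "mat_adjoint A = A"
  shows "qform A (x + y) = qform A x + 2 * ((A *v x) \<bullet> y) + qform A y"
  unfolding qform_def using inner_hermitian[OF assms, of y x]
  by (simp add: matrix_vector_right_distrib inner_add_left inner_add_right inner_commute)

lemma qform_diff:
  assumes "mat_adjoint A = A"
  shows "qform A (x - y) = qform A x - 2 * ((A *v x) \<bullet> y) + qform A y"
  using qform_add[OF assms, of x "- y"] by (simp add: qform_uminus_right)

lemma qform_add_le:
  assumes "psd A"
  shows "qform A (x + y) \<le> 2 * qform A x + 2 * qform A y"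
  using assms qform_add[of A x y] qform_diff[of A x y] unfolding psd_iff_qform
  by (smt (verit))

lemma qform_smult_right: "qform A (c *s x) = (cmod c)\<^sup>2 * qform A x"
proof -
  have "cinner (A *v (c *s x)) (c *s x) = (c * cnj c) * cinner (A *v x) x"
    by (simp add: cinner_def vector_scalar_commute sum_distrib_left mult_ac)
  then have "cinner (A *v (c *s x)) (c *s x) = of_real ((cmod c)\<^sup>2) * cinner (A *v x) x"
    by (simp only: complex_norm_square)
  then show ?thesis
    unfolding qform_def Re_cinner[symmetric] by simp
qed

text \<open>A zero of a nonnegative form is a minimum, so the gradient \<open>A *v x\<close> has to
  vanish there: a short step against it would make the form negative.\<close>

lemma psd_qform_eq_0:
  assumes "psd A" "qform A x = 0"
  shows "A *v x = 0"
proof (rule ccontr)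
  assume nz: "A *v x \<noteq> 0"
  have herm: "mat_adjoint A = A" and nonneg: "\<And>y. 0 \<le> qform A y"
    using assms(1) by (auto simp: psd_iff_qform)
  define b where "b = (A *v x) \<bullet> (A *v x)"
  define c where "c = qform A (A *v x)"
  have b: "b > 0" and c: "c \<ge> 0"
    using nz nonneg by (auto simp: b_def c_def)
  \<comment> \<open>Short enough for the linear term \<open>2 * t * b\<close> to beat
    \<open>t\<^sup>2 * c\<close>; the summand 1 covers \<open>c = 0\<close>.\<close>
  define t where "t = b / (c + 1)"
  have "t > 0"
    using b c by (simp add: t_def)
  have "qform A (x - t *\<^sub>R (A *v x)) = t\<^sup>2 * c - 2 * t * b"
    by (simp add: qform_diff[OF herm] assms(2) qform_scaleR_right b_def c_def)
  also have "\<dots> = t * (t * c - 2 * b)"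
    by (simp add: power2_eq_square algebra_simps)
  finally have *: "qform A (x - t *\<^sub>R (A *v x)) = t * (t * c - 2 * b)" .
  have "t * c - 2 * b < 0"
  proof -
    have "t * c \<le> t * (c + 1)"
      using \<open>t > 0\<close> by (intro mult_left_mono) auto
    also have "\<dots> = b"
      using c by (simp add: t_def)
    finally show ?thesis
      using b by linarith
  qed
  with \<open>t > 0\<close> have "t * (t * c - 2 * b) < 0"
    by (rule mult_pos_neg)
  then show False
    using nonneg[of "x - t *\<^sub>R (A *v x)"] * by simp
qed

section \<open>Inverses of positive definite matrices and their convexity\<close>

lemma invertible_matrix_inv:
  assumes "invertible A"
  shows "A ** matrix_inv A = mat 1" "matrix_inv A ** A = mat 1"
  using someI_ex[OF assms[unfolded invertible_def]] by (auto simp: matrix_inv_def)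

lemma psd_invertible_posdef: "psd A \<Longrightarrow> invertible A \<Longrightarrow> posdef A"
  by (metis invertible_def less_eq_real_def matrix_left_invertible_ker posdef_def psd_iff_qform psd_qform_eq_0)

lemma posdef_invertible:
  assumes "posdef A"
  shows "invertible A"
  unfolding invertible_left_inverse matrix_left_invertible_ker
  using assms by (metis inner_zero_left less_irrefl posdef_def qform_def)

lemma mv_matrix_inv:
  assumes "invertible (A :: complex^'n^'n)"
  shows "A *v (matrix_inv A *v x) = x" "matrix_inv A *v (A *v x) = x"
  by (simp_all add: matrix_vector_mul_assoc invertible_matrix_inv[OF assms])

lemma matrix_inv_unique:
  fixes A :: "complex^'n^'n"
  assumes "A ** B = mat 1"
  shows "matrix_inv A = B"
  by (metis assms invertible_def invertible_matrix_inv(2) matrix_left_right_inverse matrix_mul_assoc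
      matrix_mul_lid matrix_mul_rid)

lemma matrix_inv_matrix_inv:
  fixes A :: "complex^'n^'n"
  shows "invertible A \<Longrightarrow> matrix_inv (matrix_inv A) = A"
  by (simp add: invertible_matrix_inv matrix_inv_unique)

lemma mat_adjoint_matrix_inv:
  assumes "invertible A" "mat_adjoint A = A"
  shows "mat_adjoint (matrix_inv A) = matrix_inv A"
  by (metis assms invertible_matrix_inv(2) mat_adjoint_1 mat_adjoint_mult matrix_inv_unique)

lemma posdef_matrix_inv:
  assumes "posdef A"
  shows "posdef (matrix_inv A)"
proof -
  have inv: "invertible A"
    by (rule posdef_invertible[OF assms])
  have "qform (matrix_inv A) x = qform A (matrix_inv A *v x)" for x
    by (simp add: qform_def mv_matrix_inv[OF inv] inner_commute)
  moreover have "matrix_inv A *v x \<noteq> 0" if "x \<noteq> 0" for x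
    using that mv_matrix_inv(1)[OF inv, of x] by auto
  ultimately show ?thesis
    using assms by (simp add: posdef_def mat_adjoint_matrix_inv[OF inv])
qed

text \<open>The Legendre-type inequality below is an equality for \<open>y = A\<^sup>-\<^sup>1 f\<close>; all convexity properties
  of the inverse are drawn from it.\<close>

lemma qform_inv_eq:
  assumes "posdef A"
  shows "qform (matrix_inv A) f = 2 * (f \<bullet> (matrix_inv A *v f)) - qform A (matrix_inv A *v f)"
  using posdef_invertible[OF assms] by (simp add: qform_def mv_matrix_inv inner_commute)

lemma qform_inv_ge:
  assumes "posdef A"
  shows "2 * (f \<bullet> y) - qform A y \<le> qform (matrix_inv A) f"
proof -
  define a where "a = matrix_inv A *v f"
  have f: "f = A *v a"
    using posdef_invertible[OF assms] by (simp add: a_def mv_matrix_inv)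
  have "0 \<le> qform A (a - y)"
    using posdef_imp_psd[OF assms] by (simp add: psd_iff_qform)
  also have "\<dots> = qform A a - 2 * (f \<bullet> y) + qform A y"
    using assms by (simp add: qform_diff posdef_def f)
  finally show ?thesis
    unfolding qform_inv_eq[OF assms] a_def[symmetric] by (simp add: f qform_def)
qed

lemma qform_inv_antimono:
  assumes "posdef A" "posdef B" "\<And>x. qform A x \<le> qform B x"
  shows "qform (matrix_inv B) f \<le> qform (matrix_inv A) f"
  using qform_inv_eq[OF assms(2), of f] qform_inv_ge[OF assms(1), of f "matrix_inv B *v f"]
    assms(3)[of "matrix_inv B *v f"] by linarith

text \<open>The maximizer \<open>y\<close> belonging to the midpoint is a competitor on both sides,
  and the two Legendre bounds add up.\<close>

lemma qform_inv_midpoint_convex: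
  assumes "posdef A" "posdef A1" "posdef A2"
    and "\<And>x. qform A x = (qform A1 x + qform A2 x) / 2"
  shows "qform (matrix_inv A) ((1/2) *\<^sub>R (f1 + f2))
    \<le> (qform (matrix_inv A1) f1 + qform (matrix_inv A2) f2) / 2"
proof -
  define f where "f = (1/2) *\<^sub>R (f1 + f2)"
  define y where "y = matrix_inv A *v f"
  have "2 * (f \<bullet> y) = f1 \<bullet> y + f2 \<bullet> y"
    by (simp add: f_def inner_add_left)
  then show ?thesis
    using qform_inv_eq[OF assms(1), of f] qform_inv_ge[OF assms(2), of f1 y]
      qform_inv_ge[OF assms(3), of f2 y] assms(4)[of y]
    unfolding f_def[symmetric] y_def[symmetric] by argo
qed

lemma posdef_scaleR: "posdef A \<Longrightarrow> 0 < c \<Longrightarrow> posdef (c *\<^sub>R A)"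
  by (simp add: posdef_def mat_adjoint_scaleR qform_scaleR)

lemma posdef_add: "posdef A \<Longrightarrow> psd B \<Longrightarrow> posdef (A + B)"
  by (simp add: posdef_def psd_iff_qform mat_adjoint_add qform_plus add_pos_nonneg)

lemma matrix_inv_scaleR:
  fixes A :: "complex^'n^'n"
  assumes "invertible A" "c \<noteq> 0"
  shows "matrix_inv (c *\<^sub>R A) = (1 / c) *\<^sub>R matrix_inv A"
proof (rule matrix_inv_unique)
  show "(c *\<^sub>R A) ** ((1 / c) *\<^sub>R matrix_inv A) = mat 1"
    unfolding matrix_eq
    using assms by (auto simp: matrix_vector_mul_assoc[symmetric] scaleR_mv mv_scaleR mv_matrix_inv)
qed

text \<open>Perturbing the maximizer \<open>W\<^sup>-\<^sup>1 f\<close> by \<open>\<plusminus> b\<close> in the two halves gains the second-order term of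
  the midpoint convexity.\<close>

lemma qform_inv_midpoint_gap:
  assumes W: "posdef W" and W12: "posdef (W + D)" "posdef (W - D)"
  shows "qform (matrix_inv W) f + qform (matrix_inv W) (g - D *v (matrix_inv W *v f))
    \<le> (qform (matrix_inv (W + D)) (f + g) + qform (matrix_inv (W - D)) (f - g)) / 2"
proof -
  define a where "a = matrix_inv W *v f"
  define u where "u = g - D *v a"
  define b where "b = matrix_inv W *v u"
  have hW: "mat_adjoint W = W" and hWD: "mat_adjoint (W + D) = W + D"
    using W W12 by (auto simp: posdef_def)
  have hD: "mat_adjoint D = D"
    using hW hWD by (simp add: mat_adjoint_add)
  have ga: "u \<bullet> b = g \<bullet> b - (D *v a) \<bullet> b"
    by (simp add: u_def inner_diff_left)
  have 1: "2 * ((f + g) \<bullet> (a + b)) - qform (W + D) (a + b) \<le> qform (matrix_inv (W + D)) (f + g)"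
    and 2: "2 * ((f - g) \<bullet> (a - b)) - qform (W - D) (a - b) \<le> qform (matrix_inv (W - D)) (f - g)"
    by (intro qform_inv_ge W12)+
  have 3: "qform (W + D) (a + b) = qform W a + 2 * ((W *v a) \<bullet> b) + qform W b
      + qform D a + 2 * ((D *v a) \<bullet> b) + qform D b"
    "qform (W - D) (a - b) = qform W a - 2 * ((W *v a) \<bullet> b) + qform W b
      - (qform D a - 2 * ((D *v a) \<bullet> b) + qform D b)"
    by (simp_all add: qform_plus qform_minus qform_add[OF hW] qform_add[OF hD]
        qform_diff[OF hW] qform_diff[OF hD])
  have 4: "(f + g) \<bullet> (a + b) + (f - g) \<bullet> (a - b) = 2 * (f \<bullet> a) + 2 * (g \<bullet> b)"
    by (simp add: inner_add_left inner_add_right inner_diff_left inner_diff_right)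
  have 5: "qform (matrix_inv W) f = 2 * (f \<bullet> a) - qform W a"
    "qform (matrix_inv W) u = 2 * (u \<bullet> b) - qform W b"
    unfolding a_def b_def by (intro qform_inv_eq W)+
  show ?thesis
    using 1 2 3 4 5 ga unfolding a_def[symmetric] u_def[symmetric] by argo
qed

section \<open>Square roots and determinants of positive matrices\<close>

text \<open>Square roots are not yet available, so the bound is the sum of three nonnegative forms:
  \<open>Y\<close> at \<open>x - Y *v x\<close>, and \<open>mat 1 - Y\<close> at \<open>x\<close>
  and at \<open>Y *v x\<close>.\<close>

lemma norm_mv_le_of_psd_contraction:
  assumes "psd Y" "psd (mat 1 - Y)"
  shows "(norm (Y *v x))\<^sup>2 \<le> (norm x)\<^sup>2"
proof -
  define y where "y = Y *v x"
  have herm: "mat_adjoint Y = Y" and q: "\<And>z. 0 \<le> qform Y z" "\<And>z. 0 \<le> qform (mat 1 - Y) z"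
    using assms by (auto simp: psd_iff_qform)
  have "qform Y (x - y) = qform Y x - 2 * (norm y)\<^sup>2 + qform Y y"
    by (simp add: qform_diff[OF herm] y_def power2_norm_eq_inner)
  then have "(norm y)\<^sup>2 \<le> (norm x)\<^sup>2"
    using q(1)[of "x - y"] q(2)[of y] q(2)[of x] unfolding qform_minus qform_1 by linarith
  then show ?thesis
    by (simp add: y_def)
qed

lemma norm_matrix_le_sum:
  fixes A :: "complex^'n^'n"
  shows "norm A \<le> (\<Sum>i\<in>UNIV. \<Sum>j\<in>UNIV. cmod (A $ i $ j))"
proof -
  have "norm A \<le> (\<Sum>i\<in>UNIV. norm (A $ i))"
    by (simp add: norm_vec_def L2_set_le_sum)
  also have "\<dots> \<le> (\<Sum>i\<in>UNIV. \<Sum>j\<in>UNIV. cmod (A $ i $ j))"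
    by (intro sum_mono) (subst norm_vec_def, simp add: L2_set_le_sum)
  finally show ?thesis .
qed

lemma cinner_self: "cinner x x = of_real ((norm x)\<^sup>2)"
proof -
  have "cinner x x = of_real (\<Sum>i\<in>UNIV. (cmod (x $ i))\<^sup>2)"
    unfolding cinner_def of_real_sum by (intro sum.cong refl) (rule complex_norm_square[symmetric])
  then show ?thesis
    by (simp add: norm_vec_def L2_set_def sum_nonneg)
qed

lemma norm_axis_one: "norm (axis j 1 :: complex^'n) = 1"
  by (simp add: norm_eq_1 inner_axis_axis)

lemma norm_smult: "norm (c *s (x :: complex^'n)) = cmod c * norm x"
proof -
  have "(norm (c *s x))\<^sup>2 = (cmod c * norm x)\<^sup>2"
    using qform_smult_right[of "mat 1" c x] by (simp add: qform_1 power_mult_distrib)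
  then show ?thesis
    by (simp add: power2_eq_iff_nonneg)
qed

section \<open>Closed convex sets of matrices and the positive square root\<close>

lemma linear_continuous_on_euclidean:
  fixes f :: "'a::euclidean_space \<Rightarrow> 'b::real_normed_vector"
  assumes "linear f"
  shows "continuous_on S f"
  using assms linear_conv_bounded_linear linear_continuous_on by blast

lemma linear_qform: "linear (\<lambda>A. qform A x)"
  by (intro linearI) (simp_all add: qform_plus qform_scaleR)

lemma linear_mat_adjoint: "linear mat_adjoint"
  by (intro linearI) (simp_all add: mat_adjoint_add mat_adjoint_scaleR)

lemma linear_matrix_mult_left: "linear (\<lambda>A :: complex^'n^'n. Z ** A)"
  by (intro linearI) (simp_all add: matrix_add_ldistrib matrix_matrix_mult_def vec_eq_iff scaleR_sum_right
      sum.distrib algebra_simps)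

lemma linear_matrix_mult_right: "linear (\<lambda>A :: complex^'n^'n. A ** Z)"
  by (intro linearI)
    (simp_all add: matrix_matrix_mult_def vec_eq_iff scaleR_sum_right sum.distrib algebra_simps)

lemma linear_mv_right: "linear (\<lambda>x. (A :: complex^'n^'n) *v x)"
  by (intro linearI) (simp_all add: matrix_vector_right_distrib mv_scaleR)

lemma closed_psd: "closed {A :: complex^'n^'n. psd A}"
proof -
  have "{A :: complex^'n^'n. psd A} = {A. mat_adjoint A = A} \<inter> (\<Inter>x. {A. 0 \<le> qform A x})"
    by (auto simp: psd_iff_qform)
  moreover have "closed {A :: complex^'n^'n. mat_adjoint A = A}"
    by (intro closed_Collect_eq linear_continuous_on_euclidean linear_mat_adjoint continuous_on_id)
  moreover have "closed {A. 0 \<le> qform A x}" for x :: "complex^'n"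
    by (intro closed_Collect_le linear_continuous_on_euclidean linear_qform continuous_on_const)
  ultimately show ?thesis
    by (metis (no_types, lifting) closed_INT closed_Int)
qed

lemma psd_nonneg_comb:
  assumes "psd A" "psd B" "0 \<le> u" "0 \<le> v"
  shows "psd (u *\<^sub>R A + v *\<^sub>R B)"
  using assms by (simp add: psd_iff_qform mat_adjoint_add mat_adjoint_scaleR qform_plus qform_scaleR)

text \<open>With \<open>X = 1 - A\<close>, a fixed point of \<open>Y \<mapsto> (X + Y\<^sup>2) / 2\<close> satisfies \<open>(1 - Y)\<^sup>2 = A\<close>. Brouwer's theorem
  is applied on the convex set of contractions commuting with everything that commutes with \<open>A\<close>.\<close>

lemma psd_contraction_sqrt_exists:
  fixes A :: "complex^'n^'n"
  assumes A: "psd A" "psd (mat 1 - A)"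
  shows "\<exists>B. psd B \<and> B ** B = A \<and> (\<forall>Z. Z ** A = A ** Z \<longrightarrow> Z ** B = B ** Z)"
proof -
  define X where "X = mat 1 - A"
  define S where "S = {Y. psd Y} \<inter> {Y. psd (mat 1 - Y)} \<inter> (\<Inter>Z\<in>{Z. Z ** A = A ** Z}. {Y. Z ** Y = Y ** Z})"
  define \<phi> where "\<phi> Y = (1/2) *\<^sub>R (X + Y ** Y)" for Y :: "complex^'n^'n"
  have "closed {Y :: complex^'n^'n. psd (mat 1 - Y)}"
    using closed_vimage[OF closed_psd, of "\<lambda>Y. mat 1 - Y"]
    by (simp add: vimage_def continuous_on_diff)
  moreover have "closed {Y :: complex^'n^'n. Z ** Y = Y ** Z}" for Z
    by (intro closed_Collect_eq linear_continuous_on_euclidean linear_matrix_mult_left linear_matrix_mult_right)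
  ultimately have "closed S"
    unfolding S_def by (intro closed_Int closed_psd closed_INT) auto
  moreover have "norm Y \<le> (\<Sum>i\<in>(UNIV::'n set). \<Sum>j\<in>(UNIV::'n set). 1)" if "Y \<in> S" for Y
  proof -
    have "cmod (Y $ i $ j) \<le> 1" for i j
    proof -
      have "(norm (Y *v axis j 1))\<^sup>2 \<le> (norm (axis j 1 :: complex^'n))\<^sup>2"
        using that by (intro norm_mv_le_of_psd_contraction) (auto simp: S_def)
      then have "norm (Y *v axis j 1) \<le> 1"
        by (simp add: norm_axis_one abs_square_le_1)
      moreover have "(Y *v axis j 1) $ i = Y $ i $ j"
        by (simp add: matrix_vector_mult_def axis_def if_distrib[of "(*) _"] cong: if_cong)
      ultimately show ?thesis
        using Finite_Cartesian_Product.norm_nth_le[of "Y *v axis j 1" i] by simp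
    qed
    then show ?thesis
      by (intro order_trans[OF norm_matrix_le_sum] sum_mono)
  qed
  ultimately have "compact S"
    unfolding compact_eq_bounded_closed bounded_iff by blast
  moreover have "convex S"
  proof (rule convexI)
    fix Y1 Y2 :: "complex^'n^'n" and u v :: real
    assume *: "Y1 \<in> S" "Y2 \<in> S" "0 \<le> u" "0 \<le> v" "u + v = 1"
    have "mat 1 - (u *\<^sub>R Y1 + v *\<^sub>R Y2) = u *\<^sub>R (mat 1 - Y1) + v *\<^sub>R (mat 1 - Y2)"
      using *(5) by (simp add: algebra_simps flip: scaleR_add_left)
    moreover have "Z ** (u *\<^sub>R Y1 + v *\<^sub>R Y2) = (u *\<^sub>R Y1 + v *\<^sub>R Y2) ** Z"
      if "Z ** A = A ** Z" for Z
      using * that linear_add[OF linear_matrix_mult_left[of Z]] linear_scale[OF linear_matrix_mult_left[of Z]]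
        linear_add[OF linear_matrix_mult_right[of Z]] linear_scale[OF linear_matrix_mult_right[of Z]]
      by (simp add: S_def)
    ultimately show "u *\<^sub>R Y1 + v *\<^sub>R Y2 \<in> S"
      using * by (auto simp: S_def intro!: psd_nonneg_comb)
  qed
  moreover have "mat 1 \<in> S"
    by (auto simp: S_def psd_iff_qform mat_adjoint_diff qform_1 qform_minus)
  moreover have "continuous_on S \<phi>"
    unfolding \<phi>_def matrix_matrix_mult_def by (intro continuous_intros)
  moreover have "\<phi> Y \<in> S" if Y: "Y \<in> S" for Y
  proof -
    have hX: "mat_adjoint X = X" and hY: "mat_adjoint Y = Y"
      using A Y by (auto simp: psd_iff_qform X_def S_def)
    have q: "qform (\<phi> Y) x = (qform X x + (norm (Y *v x))\<^sup>2) / 2" for x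
    proof -
      have "qform (Y ** Y) x = (norm (Y *v x))\<^sup>2"
        using qform_congruence[of Y "mat 1" x] by (simp add: hY qform_1)
      then show ?thesis
        by (simp add: \<phi>_def qform_plus qform_scaleR)
    qed
    have h: "mat_adjoint (\<phi> Y) = \<phi> Y"
      by (simp add: \<phi>_def mat_adjoint_scaleR mat_adjoint_add mat_adjoint_mult hX hY)
    have b: "0 \<le> qform X x" "qform X x \<le> (norm x)\<^sup>2" "(norm (Y *v x))\<^sup>2 \<le> (norm x)\<^sup>2" for x
      using A Y norm_mv_le_of_psd_contraction[of Y x]
      by (simp_all add: X_def S_def psd_iff_qform qform_minus qform_1)
    have "0 \<le> qform (\<phi> Y) x \<and> qform (\<phi> Y) x \<le> (norm x)\<^sup>2" for x
      using b[of x] zero_le_power2[of "norm (Y *v x)"] unfolding q by argo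
    then have "psd (\<phi> Y)" "psd (mat 1 - \<phi> Y)"
      by (simp_all add: psd_iff_qform h mat_adjoint_diff qform_minus qform_1)
    moreover have "Z ** \<phi> Y = \<phi> Y ** Z" if Z: "Z ** A = A ** Z" for Z
    proof -
      have ZY: "Z *v (Y *v x) = Y *v (Z *v x)" for x
        using Y Z by (auto simp: S_def matrix_vector_mul_assoc)
      have ZA: "Z *v (A *v x) = A *v (Z *v x)" for x
        using Z by (simp add: matrix_vector_mul_assoc)
      show ?thesis
        unfolding matrix_eq \<phi>_def X_def
        by (simp add: matrix_vector_mul_assoc[symmetric] scaleR_mv mv_scaleR matrix_vector_mult_add_rdistrib
            matrix_vector_mult_diff_rdistrib matrix_vector_right_distrib matrix_vector_mult_diff_distrib ZY ZA)
    qed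
    ultimately show ?thesis
      by (auto simp: S_def)
  qed
  ultimately obtain Y where Y: "Y \<in> S" "\<phi> Y = Y"
    using brouwer[of S \<phi>] by blast
  define B where "B = mat 1 - Y"
  have YY: "Y *v (Y *v x) = 2 *\<^sub>R (Y *v x) - x + A *v x" for x
  proof -
    have "2 *\<^sub>R (Y *v x) = 2 *\<^sub>R (\<phi> Y *v x)"
      by (simp add: Y)
    also have "\<dots> = x - A *v x + Y *v (Y *v x)"
      by (simp add: \<phi>_def X_def scaleR_mv matrix_vector_mult_add_rdistrib
          matrix_vector_mult_diff_rdistrib matrix_vector_mul_assoc)
    finally show ?thesis
      by simp
  qed
  have "B ** B = A"
    unfolding matrix_eq B_def
    by (simp add: matrix_vector_mul_assoc[symmetric] matrix_vector_mult_diff_rdistrib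
        matrix_vector_mult_diff_distrib YY scaleR_2)
  moreover have "Z ** B = B ** Z" if "Z ** A = A ** Z" for Z
  proof -
    have "Z ** Y = Y ** Z"
      using Y that by (auto simp: S_def)
    then have "Z *v (Y *v x) = Y *v (Z *v x)" for x
      by (simp add: matrix_vector_mul_assoc)
    then show ?thesis
      unfolding matrix_eq B_def
      by (simp add: matrix_vector_mul_assoc[symmetric] matrix_vector_mult_diff_rdistrib
          matrix_vector_mult_diff_distrib)
  qed
  moreover have "psd B"
    using Y(1) by (simp add: S_def B_def)
  ultimately show ?thesis
    by blast
qed

lemma psd_sqrt_exists:
  fixes A :: "complex^'n^'n"
  assumes A: "psd A"
  shows "\<exists>B. psd B \<and> B ** B = A \<and> (\<forall>Z. Z ** A = A ** Z \<longrightarrow> Z ** B = B ** Z)"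
proof -
  obtain M where M: "M > 0" "\<And>x. norm (A *v x) \<le> norm x * M"
    using bounded_linear.pos_bounded[OF linear_conv_bounded_linear[THEN iffD1, OF linear_mv_right[of A]]]
    by auto
  have "qform A x \<le> M * (norm x)\<^sup>2" for x
    unfolding qform_def using order_trans[OF norm_cauchy_schwarz[of "A *v x" x]
        mult_right_mono[OF M(2)[of x] norm_ge_zero[of x]]]
    by (simp add: power2_eq_square mult_ac)
  then have "psd (mat 1 - (1 / M) *\<^sub>R A)"
    using A M(1) by (auto simp: psd_iff_qform mat_adjoint_diff mat_adjoint_scaleR qform_minus qform_1
        qform_scaleR field_simps)
  moreover have "psd ((1 / M) *\<^sub>R A)"
    using A M(1) by (simp add: psd_iff_qform mat_adjoint_scaleR qform_scaleR)
  ultimately obtain B where B: "psd B" "B ** B = (1 / M) *\<^sub>R A"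
    "\<And>Z. Z ** ((1 / M) *\<^sub>R A) = ((1 / M) *\<^sub>R A) ** Z \<Longrightarrow> Z ** B = B ** Z"
    using psd_contraction_sqrt_exists by blast
  note scl = linear_scale[OF linear_matrix_mult_left] linear_scale[OF linear_matrix_mult_right]
  show ?thesis
  proof (intro exI[of _ "sqrt M *\<^sub>R B"] conjI allI impI)
    show "psd (sqrt M *\<^sub>R B)"
      using B(1) M(1) by (simp add: psd_iff_qform mat_adjoint_scaleR qform_scaleR)
    show "(sqrt M *\<^sub>R B) ** (sqrt M *\<^sub>R B) = A"
      using M(1) by (simp add: scl B(2))
    show "Z ** (sqrt M *\<^sub>R B) = (sqrt M *\<^sub>R B) ** Z" if "Z ** A = A ** Z" for Z
      using B(3)[of Z] that by (simp add: scl)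
  qed
qed

text \<open>For commuting roots, \<open>B + C\<close> annihilates \<open>y\<close>, the difference
  of \<open>B *v x\<close> and \<open>C *v x\<close>. Both forms are nonnegative, so they vanish at
  \<open>y\<close>; then \<open>B\<close> and \<open>C\<close> annihilate \<open>y\<close>
  separately, and moving them across the inner product gives
  \<open>y \<bullet> y = 0\<close>.\<close>

lemma psd_sqrt_unique:
  assumes B: "psd B" "B ** B = A" and C: "psd C" "C ** C = A" and BC: "C ** B = B ** C"
  shows "B = C"
  unfolding matrix_eq
proof
  fix x
  define y where "y = B *v x - C *v x"
  have hB: "mat_adjoint B = B" and hC: "mat_adjoint C = C"
    and q: "0 \<le> qform B y" "0 \<le> qform C y"
    using B C by (auto simp: psd_iff_qform)
  have "B *v (B *v x) = C *v (C *v x)" "C *v (B *v x) = B *v (C *v x)"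
    using B C BC by (simp_all add: matrix_vector_mul_assoc)
  then have "B *v y + C *v y = 0"
    by (simp add: y_def matrix_vector_mult_diff_distrib)
  then have "qform B y + qform C y = 0"
    unfolding qform_def by (metis inner_add_left inner_zero_left)
  then have "B *v y = 0" "C *v y = 0"
    using q B(1) C(1) by (auto intro!: psd_qform_eq_0)
  then have "y \<bullet> y = 0"
    unfolding inner_diff_right
    by (metis hB hC inner_hermitian inner_zero_left diff_self y_def inner_diff_right)
  then show "B *v x = C *v x"
    by (simp add: y_def)
qed

lemma mat_sqrt:
  assumes "psd A"
  shows "psd (mat_sqrt A)" "mat_sqrt A ** mat_sqrt A = A"
proof -
  obtain B where B: "psd B" "B ** B = A" "\<And>Z. Z ** A = A ** Z \<Longrightarrow> Z ** B = B ** Z"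
    using psd_sqrt_exists[OF assms] by blast
  have "\<exists>!C. psd C \<and> C ** C = A"
  proof (rule ex1I)
    show "psd B \<and> B ** B = A"
      using B(1,2) by blast
    fix C
    assume C: "psd C \<and> C ** C = A"
    \<comment> \<open>Any root commutes with its own square \<open>A\<close>, hence with the
      distinguished root \<open>B\<close>, which commutes with everything that commutes with
      \<open>A\<close>.\<close>
    then have "C ** A = A ** C"
      by (metis matrix_mul_assoc)
    then have "C ** B = B ** C"
      by (rule B(3))
    from psd_sqrt_unique[OF B(1,2) conjunct1[OF C] conjunct2[OF C] this] have "B = C" .
    then show "C = B" ..
  qed
  from theI'[OF this] have "psd (mat_sqrt A) \<and> mat_sqrt A ** mat_sqrt A = A"
    unfolding mat_sqrt_def .
  then show "psd (mat_sqrt A)" "mat_sqrt A ** mat_sqrt A = A"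
    by auto
qed

lemma mat_sqrt_herm: "psd A \<Longrightarrow> mat_adjoint (mat_sqrt A) = mat_sqrt A"
  using mat_sqrt(1) psd_iff_qform by blast

lemma mat_sqrt_sqrt_mv: "psd A \<Longrightarrow> mat_sqrt A *v (mat_sqrt A *v x) = A *v x"
  by (simp add: matrix_vector_mul_assoc mat_sqrt)

lemma qform_mat_sqrt: "psd A \<Longrightarrow> qform A x = (norm (mat_sqrt A *v x))\<^sup>2"
  using qform_congruence[of "mat_sqrt A" "mat 1" x] by (simp add: mat_sqrt mat_sqrt_herm qform_1)

lemma invertible_mat_sqrt:
  assumes "posdef A"
  shows "invertible (mat_sqrt A)"
  unfolding invertible_left_inverse matrix_left_invertible_ker
  using assms mat_sqrt_sqrt_mv[OF posdef_imp_psd[OF assms]]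
  by (metis inner_zero_left matrix_vector_mult_0_right order_less_irrefl posdef_def qform_def)

text \<open>Hadamard's inequality: a maximizer of \<open>|det|\<close> among matrices with unit rows has orthogonal rows,
  since otherwise removing from one row its component along another one and renormalizing would
  increase \<open>|det|\<close>.\<close>

lemma det_le_1_of_unit_rows:
  fixes A :: "complex^'n^'n"
  assumes "\<And>i. norm (A $ i) = 1"
  shows "cmod (det A) \<le> 1"
proof -
  define S where "S = {A :: complex^'n^'n. \<forall>i. norm (A $ i) = 1}"
  have "S = (\<Inter>i. {A. norm (A $ i) = 1})"
    by (auto simp: S_def)
  moreover have "closed {A :: complex^'n^'n. norm (A $ i) = 1}" for i
    by (intro closed_Collect_eq continuous_intros)
  ultimately have "closed S"
    by auto
  moreover have "norm A \<le> (\<Sum>i\<in>(UNIV::'n set). 1)" if "A \<in> S" for A :: "complex^'n^'n"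
  proof -
    have "norm A \<le> (\<Sum>i\<in>UNIV. norm (A $ i))"
      by (simp add: norm_vec_def L2_set_le_sum)
    then show ?thesis
      using that by (simp add: S_def)
  qed
  ultimately have "compact S"
    unfolding compact_eq_bounded_closed bounded_iff by blast
  moreover have "A \<in> S"
    using assms by (simp add: S_def)
  moreover have "continuous_on S (\<lambda>A. cmod (det A))"
    unfolding det_def by (intro continuous_intros)
  ultimately obtain U where U: "U \<in> S" "\<And>A. A \<in> S \<Longrightarrow> cmod (det A) \<le> cmod (det U)"
    using continuous_attains_sup[of S "\<lambda>A. cmod (det A)"] by blast
  have "cmod (det U) \<le> 1"
  proof (rule ccontr)
    assume gt: "\<not> cmod (det U) \<le> 1"
    have orth: "cinner (U $ i) (U $ j) = 0" if ij: "i \<noteq> j" for i j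
    proof (rule ccontr)
      define z where "z = cinner (U $ i) (U $ j)"
      define v where "v = U $ i - z *s (U $ j)"
      assume "cinner (U $ i) (U $ j) \<noteq> 0"
      then have z: "z \<noteq> 0"
        by (simp add: z_def)
      have n1: "cinner (U $ k) (U $ k) = 1" for k
        using U(1) by (simp add: S_def cinner_self)
      have "cinner v v = cinner (U $ i) (U $ i) - cnj z * cinner (U $ i) (U $ j)
          - z * cnj (cinner (U $ i) (U $ j)) + z * cnj z * cinner (U $ j) (U $ j)"
        by (simp add: cinner_def v_def algebra_simps sum.distrib sum_subtractf sum_distrib_left)
      also have "\<dots> = 1 - z * cnj z"
        by (simp add: n1 flip: z_def)
      finally have "cinner v v = 1 - of_real ((cmod z)\<^sup>2)"
        unfolding complex_norm_square .
      then have "of_real ((norm v)\<^sup>2) = complex_of_real (1 - (cmod z)\<^sup>2)"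
        unfolding cinner_self by (simp only: of_real_diff of_real_1)
      then have nv: "(norm v)\<^sup>2 = 1 - (cmod z)\<^sup>2"
        by (simp only: of_real_eq_iff)
      define V where "V = (\<chi> k. if k = i then v else U $ k)"
      have "V = (\<chi> k. if k = i then row i U + (- z) *s row j U else row k U)"
        by (simp add: V_def v_def row_def vec_eq_iff)
      then have dV: "det V = det U"
        using det_row_operation[OF ij, of U "- z"] by simp
      have "norm v \<noteq> 0"
      proof
        assume "norm v = 0"
        then have "row i V = 0"
          by (simp add: V_def row_def vec_eq_iff)
        then have "det V = 0"
          by (rule det_zero_row)
        with dV gt show False
          by simp
      qed
      then have vpos: "norm v > 0"
        by simp
      have vlt: "norm v < 1"
        using nv z by (simp add: power2_less_imp_less[of _ 1])
      define c where "c k = (if k = i then complex_of_real (1 / norm v) else 1)" for k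
      define V' where "V' = (\<chi> k. c k *s V $ k)"
      have "V' \<in> S"
        using U(1) vpos by (auto simp: S_def V'_def V_def c_def norm_smult norm_divide)
      then have "cmod (det V') \<le> cmod (det U)"
        by (rule U(2))
      moreover have "det V' = (\<Prod>k\<in>UNIV. c k) * det V"
        unfolding V'_def by (subst det_rows_mul) simp
      moreover have "(\<Prod>k\<in>UNIV. c k) = complex_of_real (1 / norm v)"
        unfolding c_def by simp
      ultimately have "(1 / norm v) * cmod (det U) \<le> 1 * cmod (det U)"
        by (simp add: dV norm_mult norm_divide)
      then have "1 / norm v \<le> 1"
        by (rule mult_right_le_imp_le) (use gt in linarith)
      with vpos vlt show False
        by (simp add: field_simps)
    qed
    \<comment> \<open>Orthonormal rows make \<open>U\<close> unitary, so its determinant has modulus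
      1, against the assumption.\<close>
    have "U ** mat_adjoint U = mat 1"
    proof -
      have "(U ** mat_adjoint U) $ i $ j = cinner (U $ i) (U $ j)" for i j
        by (simp add: matrix_matrix_mult_def mat_adjoint_def cinner_def)
      moreover have "cinner (U $ i) (U $ i) = 1" for i
        using U(1) by (simp add: S_def cinner_self)
      ultimately show ?thesis
        using orth by (simp add: vec_eq_iff mat_def)
    qed
    then have "det U * det (mat_adjoint U) = 1"
      by (metis det_I det_mul)
    moreover have "det (mat_adjoint U) = cnj (det U)"
    proof -
      have "det (mat_adjoint U) = det (transpose (mat_adjoint U))"
        by simp
      also have "transpose (mat_adjoint U) = (\<chi> i j. cnj (U $ i $ j))"
        by (simp add: transpose_def mat_adjoint_def)
      also have "det \<dots> = cnj (det U)"
        by (simp add: det_def)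
      finally show ?thesis .
    qed
    ultimately have "of_real ((cmod (det U))\<^sup>2) = (1 :: complex)"
      by (simp only: complex_norm_square)
    then have "(cmod (det U))\<^sup>2 = 1"
      by (simp only: of_real_eq_1_iff)
    then have "cmod (det U) = 1"
      by (metis norm_ge_zero power2_eq_1_iff le_minus_one_simps(3))
    with gt show False
      by simp
  qed
  then show ?thesis
    using U(2)[OF \<open>A \<in> S\<close>] by linarith
qed

lemma hadamard_inequality:
  fixes A :: "complex^'n^'n"
  shows "cmod (det A) \<le> (\<Prod>i\<in>UNIV. norm (A $ i))"
proof (cases "\<exists>i. A $ i = 0")
  case True
  then obtain i where "row i A = 0"
    by (auto simp: row_def vec_eq_iff)
  then have "det A = 0"
    by (rule det_zero_row)
  then show ?thesis
    by (simp add: prod_nonneg)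
next
  case False
  define U where "U = (\<chi> i. (1 / norm (A $ i)) *\<^sub>R A $ i)"
  have "A = (\<chi> i. of_real (norm (A $ i)) *s U $ i)"
    using False by (simp add: U_def vec_eq_iff of_real_def)
  then have "det A = det (\<chi> i. of_real (norm (A $ i)) *s U $ i)"
    by (rule arg_cong)
  also have "\<dots> = (\<Prod>i\<in>UNIV. of_real (norm (A $ i))) * det U"
    by (subst det_rows_mul) simp
  finally have "det A = (\<Prod>i\<in>UNIV. of_real (norm (A $ i))) * det U" .
  moreover have "cmod (det U) \<le> 1"
    using False by (intro det_le_1_of_unit_rows) (simp add: U_def)
  ultimately show ?thesis
    by (simp add: norm_mult mult_left_le prod_nonneg flip: of_real_prod)
qed

text \<open>No eigenvalues are used: Hadamard's inequality is applied to the square root of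
  \<open>P\<close>, whose rows have the diagonal entries of \<open>P\<close> as squared norms, and
  each entry t satisfies t \<le> exp (t - 1).\<close>

lemma det_psd_le_exp_trace:
  fixes P :: "complex^'n^'n"
  assumes "psd P"
  shows "cmod (det P) \<le> exp (Re (trace P) - real CARD('n))"
proof -
  define S where "S = mat_sqrt P"
  have S: "S ** S = P" "mat_adjoint S = S"
    using assms by (simp_all add: S_def mat_sqrt mat_sqrt_herm)
  have P: "Re (P $ i $ i) = (norm (S $ i))\<^sup>2" for i
  proof -
    have "P $ i $ i = (\<Sum>j\<in>UNIV. S $ i $ j * S $ j $ i)"
      unfolding S(1)[symmetric] by (simp add: matrix_matrix_mult_def)
    also have "\<dots> = (\<Sum>j\<in>UNIV. S $ i $ j * cnj (S $ i $ j))"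
      by (subst (2) S(2)[symmetric]) (simp add: mat_adjoint_def)
    also have "\<dots> = cinner (S $ i) (S $ i)"
      by (simp add: cinner_def)
    finally show ?thesis
      by (simp add: cinner_self)
  qed
  have "cmod (det P) = (cmod (det S))\<^sup>2"
    unfolding S(1)[symmetric] by (simp add: det_mul norm_mult power2_eq_square)
  also have "\<dots> \<le> (\<Prod>i\<in>UNIV. norm (S $ i))\<^sup>2"
    by (intro power_mono hadamard_inequality) simp
  also have "\<dots> = (\<Prod>i\<in>UNIV. Re (P $ i $ i))"
    by (simp add: P prod_power_distrib)
  also have "\<dots> \<le> (\<Prod>i\<in>UNIV. exp (Re (P $ i $ i) - 1))"
    by (intro prod_mono) (use exp_ge_add_one_self[of "Re (P $ i $ i) - 1" for i] in \<open>auto simp: P\<close>)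
  also have "\<dots> = exp (Re (trace P) - real CARD('n))"
    by (simp add: exp_sum[symmetric] trace_def sum_subtractf)
  finally show ?thesis .
qed

section \<open>Comparison of determinants through traces\<close>

lemma det_scaleR:
  fixes A :: "complex^'n^'n"
  shows "det (c *\<^sub>R A) = of_real c ^ CARD('n) * det A"
proof -
  have "c *\<^sub>R A = (\<chi> i. of_real c *s A $ i)"
    by (simp add: vec_eq_iff of_real_def)
  then have "det (c *\<^sub>R A) = det (\<chi> i. of_real c *s A $ i)"
    by (rule arg_cong)
  also have "\<dots> = of_real c ^ CARD('n) * det A"
    by (subst det_rows_mul) simp
  finally show ?thesis .
qed

lemma Re_diag_eq_qform: "Re (P $ i $ i) = qform P (axis i 1)"
proof -
  have "qform P (axis i 1) = Re (cinner (P *v axis i 1) (axis i 1))"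
    by (simp add: qform_def Re_cinner)
  also have "cinner (P *v axis i 1) (axis i 1) = P $ i $ i"
    by (simp add: cinner_def matrix_vector_mult_def axis_def if_distrib[of "(*) _"]
        if_distrib[of cnj] cong: if_cong)
  finally show ?thesis ..
qed

lemma Re_trace_eq_sum_qform: "Re (trace P) = (\<Sum>i\<in>UNIV. qform P (axis i 1))"
  by (simp add: trace_def Re_diag_eq_qform)

lemma posdef_det_nz: "posdef A \<Longrightarrow> det A \<noteq> 0"
  using invertible_det_nz posdef_invertible by blast

lemma det_mat_sqrt: "psd A \<Longrightarrow> (cmod (det (mat_sqrt A)))\<^sup>2 = cmod (det A)"
  by (metis det_mul mat_sqrt(2) norm_mult power2_eq_square)

lemma qform_sqrt_inv_mv:
  assumes "posdef B"
  shows "qform B (matrix_inv (mat_sqrt B) *v x) = (norm x)\<^sup>2"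
  using assms by (simp add: qform_mat_sqrt posdef_imp_psd mv_matrix_inv invertible_mat_sqrt)

text \<open>Conjugation by the inverse root of \<open>B\<close> reduces to a positive semidefinite
  \<open>P\<close> below the identity. Its trace is at most the dimension, so
  \<open>det_psd_le_exp_trace\<close> gives a determinant of modulus at most 1.\<close>

lemma det_le_of_qform_le:
  fixes A B :: "complex^'n^'n"
  assumes A: "posdef A" and B: "posdef B" and c: "0 < c" and le: "\<And>x. qform A x \<le> c * qform B x"
  shows "cmod (det A) \<le> c ^ CARD('n) * cmod (det B)"
proof -
  define S where "S = mat_sqrt B"
  define R where "R = matrix_inv S"
  have inv: "invertible S" and hS: "mat_adjoint S = S"
    using B by (simp_all add: S_def invertible_mat_sqrt mat_sqrt_herm posdef_imp_psd)
  have hR: "mat_adjoint R = R"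
    by (simp add: R_def mat_adjoint_matrix_inv inv hS)
  define P where "P = (1 / c) *\<^sub>R (R ** A ** R)"
  have q: "qform P x = qform A (R *v x) / c" for x
    using qform_congruence[of R A x] by (simp add: P_def qform_scaleR hR)
  have hP: "mat_adjoint P = P"
    using A by (simp add: P_def mat_adjoint_scaleR mat_adjoint_mult hR posdef_def matrix_mul_assoc)
  have "psd P"
    using A c hP q posdef_imp_psd[OF A] by (simp add: psd_iff_qform)
  moreover have "Re (trace P) \<le> real CARD('n)"
  proof -
    have "qform P (axis i 1) \<le> 1" for i
      using le[of "R *v axis i 1"] qform_sqrt_inv_mv[OF B, of "axis i 1"] c
      by (simp add: q R_def S_def norm_axis_one field_simps)
    then have "Re (trace P) \<le> (\<Sum>i\<in>(UNIV::'n set). 1)"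
      unfolding Re_trace_eq_sum_qform by (intro sum_mono)
    then show ?thesis
      by simp
  qed
  ultimately have detP: "cmod (det P) \<le> 1"
    using det_psd_le_exp_trace[of P] by (smt (verit) exp_le_one_iff)
  have "S ** P ** S = (1 / c) *\<^sub>R A"
    unfolding matrix_eq P_def R_def
    by (simp add: matrix_vector_mul_assoc[symmetric] scaleR_mv mv_scaleR mv_matrix_inv[OF inv])
  then have "det S * det P * det S = of_real (1 / c) ^ CARD('n) * det A"
    by (metis det_mul det_scaleR)
  then have "cmod (det S * det P * det S) = cmod (of_real (1 / c) ^ CARD('n) * det A)"
    by (rule arg_cong)
  then have "(cmod (det S))\<^sup>2 * cmod (det P) = (1 / c) ^ CARD('n) * cmod (det A)"
    using c by (simp add: norm_mult norm_power norm_divide power2_eq_square mult_ac)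
  then have "cmod (det A) = c ^ CARD('n) * (cmod (det B) * cmod (det P))"
    using c det_mat_sqrt[OF posdef_imp_psd[OF B]] by (simp add: S_def power_one_over field_simps)
  also have "\<dots> \<le> c ^ CARD('n) * (cmod (det B) * 1)"
    using c detP by (intro mult_left_mono) auto
  finally show ?thesis
    by simp
qed

lemma norm_mv_le_hilbert_schmidt:
  fixes Y :: "complex^'n^'n"
  shows "(norm (Y *v x))\<^sup>2 \<le> (\<Sum>i\<in>UNIV. (norm (Y *v axis i 1))\<^sup>2) * (norm x)\<^sup>2"
proof -
  have col: "Y *v axis i 1 = column i Y" for i
    by (simp add: vec_eq_iff column_def matrix_vector_mult_def axis_def if_distrib[of "(*) _"] cong: if_cong)
  have "norm (Y *v x) \<le> (\<Sum>i\<in>UNIV. norm (Y *v axis i 1) * cmod (x $ i))"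
    unfolding matrix_mult_sum[of Y x] col
    by (rule order_trans[OF norm_sum]) (simp add: norm_smult mult.commute)
  then have "(norm (Y *v x))\<^sup>2 \<le> (\<Sum>i\<in>UNIV. norm (Y *v axis i 1) * cmod (x $ i))\<^sup>2"
    by (intro power_mono) auto
  also have "\<dots> \<le> (\<Sum>i\<in>UNIV. (norm (Y *v axis i 1))\<^sup>2) * (\<Sum>i\<in>UNIV. (cmod (x $ i))\<^sup>2)"
    by (rule Cauchy_Schwarz_ineq_sum)
  also have "(\<Sum>i\<in>UNIV. (cmod (x $ i))\<^sup>2) = (norm x)\<^sup>2"
    by (simp add: norm_vec_def L2_set_def sum_nonneg)
  finally show ?thesis .
qed

text \<open>The defect of concavity of \<open>ln |det|\<close> controls the relative size of the increment \<open>D\<close>.\<close>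

lemma log_det_gap:
  fixes W D :: "complex^'n^'n"
  assumes W: "posdef W" and W1: "posdef (W + D)" and W2: "posdef (W - D)"
  defines "gap \<equiv> 2 * ln (cmod (det W)) - ln (cmod (det (W + D))) - ln (cmod (det (W - D)))"
  shows "0 \<le> gap" "qform (matrix_inv W) (D *v x) \<le> gap * qform W x"
proof -
  define S where "S = mat_sqrt W"
  define R where "R = matrix_inv S"
  have inv: "invertible S" and hS: "mat_adjoint S = S" and SS: "S ** S = W"
    using W by (simp_all add: S_def invertible_mat_sqrt mat_sqrt mat_sqrt_herm posdef_imp_psd)
  have hR: "mat_adjoint R = R"
    by (simp add: R_def mat_adjoint_matrix_inv inv hS)
  have hD: "mat_adjoint D = D"
    using W W1 by (simp add: posdef_def mat_adjoint_add)
  define Y where "Y = R ** D ** R"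
  have hY: "mat_adjoint Y = Y"
    by (simp add: Y_def mat_adjoint_mult hR hD matrix_mul_assoc)
  \<comment> \<open>\<open>h\<close> is the squared Hilbert-Schmidt norm of the relative increment
    \<open>Y\<close>. As \<open>W + D\<close> and \<open>W - D\<close> are S (1 + Y) S and S (1 - Y)
    S, \<open>gap\<close> is the negative logarithm of |det P|, and the trace of \<open>P\<close> is
    the dimension minus \<open>h\<close>.\<close>
  define h where "h = (\<Sum>i\<in>UNIV. (norm (Y *v axis i 1))\<^sup>2)"
  define P where "P = mat 1 - Y ** Y"
  have qY: "qform Y z = qform D (R *v z)" for z
    using qform_congruence[of R D z] by (simp add: Y_def hR)
  have qW: "qform W (R *v z) = (norm z)\<^sup>2" for z
    using qform_sqrt_inv_mv[OF W] by (simp add: R_def S_def)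
  have Ybd: "- ((norm z)\<^sup>2) \<le> qform Y z" "qform Y z \<le> (norm z)\<^sup>2" for z
    using posdef_imp_psd[OF W1] posdef_imp_psd[OF W2] qW[of z]
    unfolding psd_iff_qform qform_plus qform_minus qY by (smt (verit))+
  have qP: "qform P z = (norm z)\<^sup>2 - (norm (Y *v z))\<^sup>2" for z
    using qform_congruence[of Y "mat 1" z] by (simp add: P_def qform_minus qform_1 hY)
  \<comment> \<open>The bounds -1 \<le> Y \<le> 1 are tested at z - Y z and z + Y z; the difference
    of the two inequalities is |Y z| \<le> |z| in squared form.\<close>
  have "0 \<le> qform P z" for z
  proof -
    define y where "y = Y *v z"
    have "(norm (z + y))\<^sup>2 = (norm z)\<^sup>2 + 2 * (z \<bullet> y) + (norm y)\<^sup>2"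
      "(norm (z - y))\<^sup>2 = (norm z)\<^sup>2 - 2 * (z \<bullet> y) + (norm y)\<^sup>2"
      by (simp_all add: power2_norm_eq_inner inner_add_left inner_add_right inner_diff_left
          inner_diff_right inner_commute)
    moreover have "qform Y (z + y) = qform Y z + 2 * (norm y)\<^sup>2 + qform Y y"
      "qform Y (z - y) = qform Y z - 2 * (norm y)\<^sup>2 + qform Y y"
      by (simp_all add: qform_add[OF hY] qform_diff[OF hY] y_def power2_norm_eq_inner)
    ultimately show ?thesis
      using Ybd(2)[of "z + y"] Ybd(1)[of "z - y"] unfolding qP y_def[symmetric] by linarith
  qed
  then have "psd P"
    by (simp add: psd_iff_qform P_def mat_adjoint_diff mat_adjoint_mult hY)
  then have "cmod (det P) \<le> exp (Re (trace P) - real CARD('n))"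
    by (rule det_psd_le_exp_trace)
  moreover have "Re (trace P) = real CARD('n) - h"
    by (simp add: Re_trace_eq_sum_qform qP norm_axis_one sum_subtractf h_def)
  ultimately have detP: "cmod (det P) \<le> exp (- h)"
    by simp
  have Y: "S *v (Y *v (S *v z)) = D *v z" for z
    by (simp add: Y_def R_def matrix_vector_mul_assoc[symmetric] mv_matrix_inv[OF inv])
  have 1: "S ** (mat 1 + Y) ** S = W + D"
    unfolding matrix_eq SS[symmetric]
    by (simp add: matrix_vector_mul_assoc[symmetric] matrix_vector_mult_add_rdistrib
        matrix_vector_right_distrib Y)
  have 2: "S ** (mat 1 - Y) ** S = W - D"
    unfolding matrix_eq SS[symmetric]
    by (simp add: matrix_vector_mul_assoc[symmetric] matrix_vector_mult_diff_rdistrib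
        matrix_vector_mult_diff_distrib Y)
  have 3: "P = (mat 1 + Y) ** (mat 1 - Y)"
    unfolding matrix_eq P_def
    by (simp add: matrix_vector_mul_assoc[symmetric] matrix_vector_mult_add_rdistrib
        matrix_vector_mult_diff_rdistrib matrix_vector_mult_diff_distrib)
  have "det (W + D) * det (W - D) = det W * det W * det P"
    unfolding 1[symmetric] 2[symmetric] 3 det_mul unfolding SS[symmetric] det_mul by (simp add: mult_ac)
  then have eq: "cmod (det (W + D)) * cmod (det (W - D)) = cmod (det W) * cmod (det W) * cmod (det P)"
    by (metis norm_mult)
  have pos: "0 < cmod (det W)" "0 < cmod (det (W + D))" "0 < cmod (det (W - D))"
    using posdef_det_nz[OF W] posdef_det_nz[OF W1] posdef_det_nz[OF W2] by simp_all
  then have posP: "0 < cmod (det P)"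
    using eq by (metis mult_eq_0_iff norm_ge_zero order_le_less order_less_irrefl)
  have "gap = - ln (cmod (det P))"
    using arg_cong[OF eq, of ln] pos posP by (simp add: gap_def ln_mult)
  moreover have "ln (cmod (det P)) \<le> - h"
    using detP posP by (metis exp_gt_zero ln_exp ln_le_cancel_iff)
  ultimately have gap: "h \<le> gap"
    by simp
  moreover have "0 \<le> h"
    by (simp add: h_def sum_nonneg)
  ultimately show "0 \<le> gap"
    by simp
  have "matrix_inv W = R ** R"
  proof (rule matrix_inv_unique)
    show "W ** (R ** R) = mat 1"
      unfolding matrix_eq SS[symmetric] R_def
      by (simp add: matrix_vector_mul_assoc[symmetric] mv_matrix_inv[OF inv])
  qed
  then have "qform (matrix_inv W) (D *v x) = (norm (R *v (D *v x)))\<^sup>2"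
    using qform_congruence[of R "mat 1" "D *v x"] by (simp add: hR qform_1)
  also have "R *v (D *v x) = Y *v (S *v x)"
    by (simp add: Y_def R_def matrix_vector_mul_assoc[symmetric] mv_matrix_inv[OF inv])
  also have "(norm (Y *v (S *v x)))\<^sup>2 \<le> h * (norm (S *v x))\<^sup>2"
    unfolding h_def by (rule norm_mv_le_hilbert_schmidt)
  also have "\<dots> \<le> gap * (norm (S *v x))\<^sup>2"
    using gap by (intro mult_right_mono) auto
  also have "(norm (S *v x))\<^sup>2 = qform W x"
    using W by (simp add: S_def qform_mat_sqrt posdef_imp_psd)
  finally show "qform (matrix_inv W) (D *v x) \<le> gap * qform W x" .
qed

section \<open>The Bellman function\<close>

text \<open>For the averages of a weight and of its inverse, the lower comparison is Jensen's
  inequality and the upper one is the A2 condition.\<close>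

definition a2_cond :: "real \<Rightarrow> complex^'n^'n \<Rightarrow> complex^'n^'n \<Rightarrow> bool" where
  "a2_cond Q W V \<longleftrightarrow> posdef W \<and> posdef V \<and>
    (\<forall>x. qform (matrix_inv V) x \<le> qform W x) \<and> (\<forall>x. qform W x \<le> Q * qform (matrix_inv V) x)"

text \<open>Under \<open>a2_cond\<close> the product of |det W| and |det V| lies between 1 and Q^d,
  which puts the quotient into [0, 1]. With \<open>1 + ln Q\<close> in place of \<open>ln Q\<close>
  the denominator stays positive at \<open>Q = 1\<close>.\<close>

definition bell_m :: "real \<Rightarrow> complex^'n^'n \<Rightarrow> complex^'n^'n \<Rightarrow> real" where
  "bell_m Q W V = (ln (cmod (det W)) + ln (cmod (det V))) / (real CARD('n) * (1 + ln Q))"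

definition bell_X :: "real \<Rightarrow> complex^'n^'n \<Rightarrow> complex^'n^'n \<Rightarrow> complex^'n^'n" where
  "bell_X Q W V = 2 *\<^sub>R W - (1 / (1 + bell_m Q W V)) *\<^sub>R matrix_inv V"

text \<open>The factor 96 makes \<open>bell_K\<close> times \<open>\<tau> / 3\<close> equal to
  \<open>4 * lam\<close> in \<open>bellman_step\<close>, which is what the first term of the Bellman
  function may lose. The type argument carries the dimension.\<close>

definition bell_K :: "'n itself \<Rightarrow> real \<Rightarrow> real" where
  "bell_K _ Q = 96 * real CARD('n) * Q * (1 + ln Q)"

definition bellman :: "real \<Rightarrow> complex^'n \<Rightarrow> complex^'n^'n \<Rightarrow> complex^'n^'n \<Rightarrow> real" where
  "bellman Q f W V = 2 * qform (matrix_inv W) f + bell_K TYPE('n) Q * qform (matrix_inv (bell_X Q W V)) f"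

lemma det_matrix_inv:
  assumes "invertible (A :: complex^'n^'n)"
  shows "cmod (det (matrix_inv A)) * cmod (det A) = 1"
  by (metis assms det_I det_mul invertible_matrix_inv(2) norm_mult norm_one)

lemma bell_m_bounds:
  fixes W V :: "complex^'n^'n"
  assumes "a2_cond Q W V" "1 \<le> Q"
  shows "0 \<le> bell_m Q W V" "bell_m Q W V \<le> 1"
proof -
  have W: "posdef W" and V: "posdef V"
    and le: "\<And>x. qform (matrix_inv V) x \<le> 1 * qform W x" "\<And>x. qform W x \<le> Q * qform (matrix_inv V) x"
    using assms(1) by (auto simp: a2_cond_def)
  define w where "w = cmod (det W)"
  define v where "v = cmod (det V)"
  have pos: "0 < w" "0 < v"
    using posdef_det_nz[OF W] posdef_det_nz[OF V] by (simp_all add: w_def v_def)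
  have i: "cmod (det (matrix_inv V)) = 1 / v"
    using det_matrix_inv[OF posdef_invertible[OF V]] pos by (simp add: v_def field_simps)
  have "1 / v \<le> w"
    using det_le_of_qform_le[OF posdef_matrix_inv[OF V] W _ le(1)] by (simp add: i w_def)
  then have 1: "1 \<le> w * v"
    using pos by (simp add: field_simps)
  have "w \<le> Q ^ CARD('n) * (1 / v)"
    using det_le_of_qform_le[OF W posdef_matrix_inv[OF V] _ le(2)] assms(2) by (simp add: i w_def)
  then have 2: "w * v \<le> Q ^ CARD('n)"
    using pos by (simp add: field_simps)
  have ln: "ln w + ln v = ln (w * v)"
    using pos by (simp add: ln_mult)
  have "0 \<le> ln (w * v)"
    using 1 by simp
  then show "0 \<le> bell_m Q W V"
    using assms(2) by (simp add: bell_m_def ln flip: w_def v_def)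
  have "ln (w * v) \<le> ln (Q ^ CARD('n))"
    using 1 2 assms(2) by (subst ln_le_cancel_iff) auto
  also have "\<dots> = real CARD('n) * ln Q"
    using assms(2) by (simp add: ln_realpow)
  also have "\<dots> \<le> real CARD('n) * (1 + ln Q)"
    by (intro mult_left_mono) auto
  finally have le: "ln (w * v) \<le> real CARD('n) * (1 + ln Q)" .
  have "0 < real CARD('n) * (1 + ln Q)"
    using assms(2) by (intro mult_pos_pos) (auto simp: add_pos_nonneg)
  then show "bell_m Q W V \<le> 1"
    using le by (simp add: bell_m_def ln divide_le_eq_1 flip: w_def v_def)
qed

text \<open>The matrix subtracted from \<open>2 *\<^sub>R W\<close> lies between 0 and
  \<open>matrix_inv V\<close>, hence between 0 and \<open>W\<close>. Comparability with
  \<open>W\<close> converts gains measured by \<open>W\<close> into gains relative to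
  \<open>bell_X\<close>.\<close>

lemma bell_X_bounds:
  fixes W V :: "complex^'n^'n"
  assumes a: "a2_cond Q W V" "1 \<le> Q"
  shows "qform W x \<le> qform (bell_X Q W V) x" "qform (bell_X Q W V) x \<le> 2 * qform W x"
    "posdef (bell_X Q W V)"
proof -
  have W: "posdef W" and V: "posdef V"
    and le: "\<And>x. qform (matrix_inv V) x \<le> qform W x"
    using assms(1) by (auto simp: a2_cond_def)
  have nn: "0 \<le> qform (matrix_inv V) x" for x
    using posdef_imp_psd[OF posdef_matrix_inv[OF V]] by (simp add: psd_iff_qform)
  have q: "qform (bell_X Q W V) x = 2 * qform W x - qform (matrix_inv V) x / (1 + bell_m Q W V)" for x
    by (simp add: bell_X_def qform_minus qform_scaleR)
  have d: "qform (matrix_inv V) x / (1 + bell_m Q W V) \<le> qform (matrix_inv V) x" for x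
    using divide_left_mono[of 1 "1 + bell_m Q W V" "qform (matrix_inv V) x"] bell_m_bounds[OF a] nn[of x]
    by simp
  have d0: "0 \<le> qform (matrix_inv V) x / (1 + bell_m Q W V)" for x
    using bell_m_bounds[OF a] nn[of x] by simp
  have 1: "qform W x \<le> qform (bell_X Q W V) x" for x
    using d[of x] le[of x] unfolding q by linarith
  then show "qform W x \<le> qform (bell_X Q W V) x" .
  show "qform (bell_X Q W V) x \<le> 2 * qform W x"
    using d0[of x] unfolding q by linarith
  have "mat_adjoint (bell_X Q W V) = bell_X Q W V"
    using W posdef_matrix_inv[OF V]
    by (simp add: bell_X_def mat_adjoint_diff mat_adjoint_scaleR posdef_def)
  then show "posdef (bell_X Q W V)"
    using 1 W unfolding posdef_def by (metis less_le_trans)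
qed

lemma bellman_nonneg:
  fixes W V :: "complex^'n^'n"
  assumes a: "a2_cond Q W V" "1 \<le> Q"
  shows "0 \<le> bellman Q f W V"
proof -
  have "0 \<le> qform (matrix_inv W) f" "0 \<le> qform (matrix_inv (bell_X Q W V)) f"
    using a bell_X_bounds(3)[OF a] posdef_matrix_inv posdef_imp_psd
    by (auto simp: psd_iff_qform a2_cond_def)
  then show ?thesis
    using a(2) by (simp add: bellman_def bell_K_def)
qed

lemma bellman_le:
  fixes W V :: "complex^'n^'n"
  assumes a: "a2_cond Q W V" "1 \<le> Q"
  shows "bellman Q f W V \<le> (2 + bell_K TYPE('n) Q) * qform (matrix_inv W) f"
proof -
  have "qform (matrix_inv (bell_X Q W V)) f \<le> qform (matrix_inv W) f"
    using a bell_X_bounds[OF a] by (intro qform_inv_antimono) (auto simp: a2_cond_def)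
  moreover have "0 \<le> bell_K TYPE('n) Q"
    using a(2) by (simp add: bell_K_def)
  ultimately show ?thesis
    by (simp add: bellman_def algebra_simps mult_left_mono)
qed

text \<open>Midpoint convexity of 1 / (x y) on the positive quadrant. After clearing denominators
  the difference of the two sides is a sum of three squares with positive weights.\<close>

lemma reciprocal_product_convex:
  fixes a b c d :: real
  assumes "0 < a" "0 < b" "0 < c" "0 < d"
  shows "8 / ((a + c) * (b + d)) \<le> 1 / (a * b) + 1 / (c * d)"
proof -
  have "0 \<le> b * d * (a - c)\<^sup>2 + a * c * (b - d)\<^sup>2 + (a * b - c * d)\<^sup>2"
    using assms by (intro add_nonneg_nonneg mult_nonneg_nonneg) auto
  then have "8 * (a * b * (c * d)) \<le> (a * b + c * d) * ((a + c) * (b + d))"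
    by (simp add: power2_eq_square algebra_simps)
  then have "8 / ((a + c) * (b + d)) \<le> (a * b + c * d) / (a * b * (c * d))"
    using assms by (simp add: pos_divide_le_eq pos_le_divide_eq)
  also have "\<dots> = 1 / (a * b) + 1 / (c * d)"
    using assms by (simp add: add_divide_distrib)
  finally show ?thesis .
qed

text \<open>\<open>(V, m) \<mapsto> \<langle>V\<^sup>-\<^sup>1 e, e\<rangle> / m\<close> is convex, because \<open>1 / \<langle>V\<^sup>-\<^sup>1 e, e\<rangle>\<close> is concave in \<open>V\<close>.\<close>

lemma qform_inv_div_midpoint_convex:
  fixes V V1 V2 :: "complex^'n^'n"
  assumes V: "posdef V" and V1: "posdef V1" and V2: "posdef V2"
    and sum: "\<And>x. 2 * qform V x = qform V1 x + qform V2 x"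
    and m: "0 < m1" "0 < m2" "2 * m = m1 + m2"
  shows "2 * (qform (matrix_inv V) e / m) \<le> qform (matrix_inv V1) e / m1 + qform (matrix_inv V2) e / m2"
proof (cases "e = 0")
  case False
  define y where "y = matrix_inv V *v e"
  define g where "g = qform (matrix_inv V) e"
  have g: "0 < g"
    using posdef_matrix_inv[OF V] False by (simp add: g_def posdef_def)
  have ey: "e \<bullet> y = g" and qy: "qform V y = g"
    using mv_matrix_inv(1)[OF posdef_invertible[OF V], of e]
    by (simp_all add: g_def y_def qform_def inner_commute)
  have "y \<noteq> 0"
    using ey g by auto
  then have p: "0 < qform V1 y" "0 < qform V2 y"
    using V1 V2 by (auto simp: posdef_def)
  \<comment> \<open>The Legendre-type inequality at the optimal multiple of \<open>y\<close> is the
    Cauchy-Schwarz inequality for the dual forms of \<open>U\<close> and its inverse.\<close>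
  have *: "g\<^sup>2 / qform U y \<le> qform (matrix_inv U) e" if U: "posdef U" "0 < qform U y" for U
    using qform_inv_ge[OF U(1), of e "(g / qform U y) *\<^sub>R y"] U(2)
    by (simp add: ey qform_scaleR_right power2_eq_square)
  have "2 * (g / m) = g\<^sup>2 * (8 / ((qform V1 y + qform V2 y) * (m1 + m2)))"
    using g m(1,2) unfolding m(3)[symmetric] sum[of y, symmetric] qy
    by (simp add: power2_eq_square)
  also have "\<dots> \<le> g\<^sup>2 * (1 / (qform V1 y * m1) + 1 / (qform V2 y * m2))"
    by (intro mult_left_mono reciprocal_product_convex p m) auto
  also have "\<dots> = g\<^sup>2 / qform V1 y / m1 + g\<^sup>2 / qform V2 y / m2"
    by (simp add: algebra_simps)
  also have "\<dots> \<le> qform (matrix_inv V1) e / m1 + qform (matrix_inv V2) e / m2"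
    using m *[OF V1 p(1)] *[OF V2 p(2)] by (intro add_mono divide_right_mono) auto
  finally show ?thesis
    by (simp add: g_def)
qed auto

text \<open>The form of \<open>g\<close> is at most twice that of \<open>g - D *v u\<close> plus
  twice that of \<open>D *v u\<close>, where \<open>u\<close> is W^-1 f. The first term of
  \<open>bellman\<close> gains the former; the latter is at most \<open>lam * w\<close> by
  \<open>log_det_gap\<close>, and the term with \<open>bell_X\<close> gains enough to pay for
  it.\<close>

lemma bellman_step:
  fixes W V W1 V1 W2 V2 :: "complex^'n^'n"
  assumes a: "a2_cond Q W V" and a1: "a2_cond Q W1 V1" and a2: "a2_cond Q W2 V2" and Q: "1 \<le> Q"
    and WW: "W = (1/2) *\<^sub>R (W1 + W2)" and VV: "V = (1/2) *\<^sub>R (V1 + V2)" and ff: "f = (1/2) *\<^sub>R (f1 + f2)"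
  shows "2 * bellman Q f W V + 2 * qform (matrix_inv W) ((1/2) *\<^sub>R (f1 - f2))
    \<le> bellman Q f1 W1 V1 + bellman Q f2 W2 V2"
proof -
  have pW: "posdef W" "posdef W1" "posdef W2" and pV: "posdef V" "posdef V1" "posdef V2"
    and WV: "\<And>x. qform W x \<le> Q * qform (matrix_inv V) x"
    using a a1 a2 by (auto simp: a2_cond_def)
  define D where "D = (1/2) *\<^sub>R (W1 - W2)"
  define D' where "D' = (1/2) *\<^sub>R (V1 - V2)"
  define g where "g = (1/2) *\<^sub>R (f1 - f2)"
  have halves: "W1 = W + D" "W2 = W - D" "V1 = V + D'" "V2 = V - D'" "f1 = f + g" "f2 = f - g"
    by (simp_all add: WW VV ff D_def D'_def g_def algebra_simps flip: scaleR_add_left)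
  define n where "n = real CARD('n) * (1 + ln Q)"
  have n: "0 < n"
    using Q unfolding n_def by (intro mult_pos_pos) (auto simp: add_pos_nonneg)
  define lam where "lam = 2 * ln (cmod (det W)) - ln (cmod (det W1)) - ln (cmod (det W2))"
  define lam' where "lam' = 2 * ln (cmod (det V)) - ln (cmod (det V1)) - ln (cmod (det V2))"
  have lam: "0 \<le> lam" "\<And>x. qform (matrix_inv W) (D *v x) \<le> lam * qform W x"
    using log_det_gap[of W D] pW unfolding lam_def halves(1,2) by auto
  have lam': "0 \<le> lam'"
    using log_det_gap(1)[of V D'] pV unfolding lam'_def halves(3,4) by auto
  define m where "m = bell_m Q W V"
  define m1 where "m1 = bell_m Q W1 V1"
  define m2 where "m2 = bell_m Q W2 V2"
  define mb where "mb = (m1 + m2) / 2"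
  \<comment> \<open>The gain of \<open>X\<close> over the average \<open>Xb\<close>, measured by
    \<open>W\<close>: the excess of \<open>m\<close> over \<open>mb\<close> is at least
    \<open>lam / (2 * n)\<close>, the difference of the reciprocals keeps a quarter of it, and V^-1
    dominates W / Q.\<close>
  define \<tau> where "\<tau> = lam / (8 * n * Q)"
  have \<tau>0: "0 \<le> \<tau>"
    using lam(1) n Q by (simp add: \<tau>_def)
  have mbd: "0 \<le> m" "m \<le> 1" "0 \<le> m1" "m1 \<le> 1" "0 \<le> m2" "m2 \<le> 1"
    using bell_m_bounds[OF a Q] bell_m_bounds[OF a1 Q] bell_m_bounds[OF a2 Q]
    by (simp_all add: m_def m1_def m2_def)
  have "2 * m - (m1 + m2) = (lam + lam') / n"
    by (simp add: m_def m1_def m2_def bell_m_def lam_def lam'_def n_def[symmetric] diff_divide_distrib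
        add_divide_distrib)
  moreover have "(lam + lam') / n \<ge> lam / n"
    using lam' n by (intro divide_right_mono) auto
  ultimately have mgap: "lam / n \<le> 2 * (m - mb)"
    unfolding mb_def by argo
  have mb: "0 \<le> mb" "mb \<le> m"
    using mgap lam(1) n mbd by (auto simp: mb_def zero_le_divide_iff dest: order_trans[of 0 "lam / n", rotated])
  define X where "X = bell_X Q W V"
  define X1 where "X1 = bell_X Q W1 V1"
  define X2 where "X2 = bell_X Q W2 V2"
  define Xb where "Xb = (1/2) *\<^sub>R (X1 + X2)"
  have pX: "posdef X" "posdef X1" "posdef X2"
    using bell_X_bounds(3)[OF a Q] bell_X_bounds(3)[OF a1 Q] bell_X_bounds(3)[OF a2 Q]
    by (simp_all add: X_def X1_def X2_def)
  have pXb: "posdef Xb"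
    unfolding Xb_def by (intro posdef_scaleR posdef_add posdef_imp_psd pX) simp
  have qX: "qform X x = 2 * qform W x - qform (matrix_inv V) x / (1 + m)"
    "qform X1 x = 2 * qform W1 x - qform (matrix_inv V1) x / (1 + m1)"
    "qform X2 x = 2 * qform W2 x - qform (matrix_inv V2) x / (1 + m2)" for x
    by (simp_all add: X_def X1_def X2_def bell_X_def qform_minus qform_scaleR m_def m1_def m2_def)
  have qW: "2 * qform W x = qform W1 x + qform W2 x" and qV: "2 * qform V x = qform V1 x + qform V2 x"
    and qXb: "2 * qform Xb x = qform X1 x + qform X2 x" for x
    by (simp_all add: WW VV Xb_def qform_scaleR qform_plus)
  \<comment> \<open>Joint convexity first replaces the two quotients by the one with the averaged
    \<open>mb\<close>. Concavity of \<open>m\<close> then raises \<open>mb\<close> to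
    \<open>m\<close>, and this second improvement is the one that is quantified.\<close>
  have drop: "qform Xb x + \<tau> * qform W x \<le> qform X x" for x
  proof -
    define v where "v = qform (matrix_inv V) x"
    have v: "0 \<le> v"
      using posdef_imp_psd[OF posdef_matrix_inv[OF pV(1)]] by (simp add: psd_iff_qform v_def)
    have "2 * (v / (1 + mb)) \<le> qform (matrix_inv V1) x / (1 + m1) + qform (matrix_inv V2) x / (1 + m2)"
      unfolding v_def using mbd by (intro qform_inv_div_midpoint_convex pV qV) (auto simp: mb_def)
    then have 1: "qform Xb x \<le> 2 * qform W x - v / (1 + mb)"
      using qX(2)[of x] qX(3)[of x] qW[of x] qXb[of x] by linarith
    have "v / (1 + mb) - v / (1 + m) = v * (m - mb) / ((1 + mb) * (1 + m))"
      using mb mbd by (simp add: field_simps)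
    also have "\<dots> \<ge> v * (m - mb) / (2 * 2)"
      using mb mbd v by (intro divide_left_mono mult_mono mult_pos_pos mult_nonneg_nonneg) auto
    finally have 2: "v * (m - mb) / 4 \<le> v / (1 + mb) - v / (1 + m)"
      by simp
    have "\<tau> * qform W x \<le> \<tau> * (Q * v)"
      using WV[of x] \<tau>0 by (intro mult_left_mono) (auto simp: v_def)
    also have "\<dots> = v * (lam / n) / 8"
      using Q by (simp add: \<tau>_def mult.commute)
    also have "\<dots> \<le> v * (2 * (m - mb)) / 8"
      using mgap v by (intro divide_right_mono mult_left_mono) auto
    finally have "\<tau> * qform W x \<le> v * (m - mb) / 4"
      by (simp add: algebra_simps)
    with 1 2 show ?thesis
      unfolding qX(1) v_def[symmetric] by linarith
  qed
  have WX: "qform W x \<le> qform Xb x" "qform Xb x \<le> 2 * qform W x" "qform X x \<le> 2 * qform W x" for x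
    using bell_X_bounds(1,2)[OF a Q, of x] bell_X_bounds(1,2)[OF a1 Q, of x]
      bell_X_bounds(1,2)[OF a2 Q, of x] qW[of x] qXb[of x]
    unfolding X_def[symmetric] X1_def[symmetric] X2_def[symmetric] by linarith+
  \<comment> \<open>\<open>drop\<close> together with \<open>WX\<close> leaves room for at most one
    more copy of the positive form of \<open>W\<close>. The bound is what allows
    \<open>1 / (1 + \<tau> / 2)\<close> to be replaced by \<open>1 - \<tau> / 3\<close>
    below.\<close>
  have \<tau>1: "\<tau> \<le> 1"
  proof -
    define e :: "complex^'n" where "e = axis undefined 1"
    have "e \<noteq> 0"
      by (simp add: e_def axis_eq_0_iff)
    then have "0 < qform W e"
      using pW by (simp add: posdef_def)
    moreover have "\<tau> * qform W e \<le> 1 * qform W e"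
      using drop[of e] WX[of e] by linarith
    ultimately show ?thesis
      by (rule mult_right_le_imp_le[rotated])
  qed
  define B where "B = qform (matrix_inv Xb) f"
  define w where "w = qform (matrix_inv W) f"
  have wB: "w \<le> 2 * B"
  proof -
    have "qform (matrix_inv (2 *\<^sub>R W)) f \<le> B"
      unfolding B_def by (intro qform_inv_antimono pXb posdef_scaleR pW) (auto simp: qform_scaleR WX)
    then show ?thesis
      by (simp add: matrix_inv_scaleR posdef_invertible[OF pW(1)] qform_scaleR w_def)
  qed
  have w0: "0 \<le> w"
    using posdef_imp_psd[OF posdef_matrix_inv[OF pW(1)]] by (simp add: psd_iff_qform w_def)
  \<comment> \<open>As \<open>Xb\<close> is at most \<open>2 *\<^sub>R W\<close>, the additive gain
    \<open>\<tau>\<close> relative to \<open>W\<close> is a multiplicative gain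
    \<open>\<tau> / 2\<close> relative to \<open>Xb\<close>, and this passes to the inverse.\<close>
  have "qform (matrix_inv X) f \<le> qform (matrix_inv ((1 + \<tau> / 2) *\<^sub>R Xb)) f"
  proof (intro qform_inv_antimono posdef_scaleR pX pXb)
    fix x
    have "\<tau> / 2 * qform Xb x \<le> \<tau> / 2 * (2 * qform W x)"
      using \<tau>0 WX(2)[of x] by (intro mult_left_mono) auto
    then show "qform ((1 + \<tau> / 2) *\<^sub>R Xb) x \<le> qform X x"
      using drop[of x] unfolding qform_scaleR by (simp add: algebra_simps)
  qed (use \<tau>0 in auto)
  also have "\<dots> = 1 / (1 + \<tau> / 2) * B"
    using \<tau>0 by (subst matrix_inv_scaleR) (auto simp: posdef_invertible[OF pXb] qform_scaleR B_def)
  also have "\<dots> \<le> (1 - \<tau> / 3) * B"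
  proof (rule mult_right_mono)
    have "0 \<le> \<tau> * (1 - \<tau>)"
      using \<tau>0 \<tau>1 by simp
    then have "1 \<le> (1 - \<tau> / 3) * (1 + \<tau> / 2)"
      by (simp add: algebra_simps)
    then show "1 / (1 + \<tau> / 2) \<le> 1 - \<tau> / 3"
      using \<tau>0 by (subst pos_divide_le_eq) auto
    show "0 \<le> B"
      using wB w0 by simp
  qed
  also have "\<dots> \<le> B - \<tau> / 6 * w"
    using mult_left_mono[OF wB \<tau>0] by (simp add: algebra_simps)
  finally have X_drop: "qform (matrix_inv X) f \<le> B - \<tau> / 6 * w" .
  have "B \<le> (qform (matrix_inv X1) f1 + qform (matrix_inv X2) f2) / 2"
    unfolding B_def ff using qXb by (intro qform_inv_midpoint_convex pXb pX) (simp add: field_simps)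
  with X_drop have le: "2 * qform (matrix_inv X) f + \<tau> / 3 * w \<le> qform (matrix_inv X1) f1 + qform (matrix_inv X2) f2"
    by (simp add: field_simps)
  have K: "bell_K TYPE('n) Q = 96 * n * Q"
    by (simp add: bell_K_def n_def)
  have "bell_K TYPE('n) Q * (\<tau> / 3 * w) = 4 * (lam * w)"
    unfolding K using n Q by (simp add: \<tau>_def)
  moreover have "bell_K TYPE('n) Q * (2 * qform (matrix_inv X) f + \<tau> / 3 * w)
      \<le> bell_K TYPE('n) Q * (qform (matrix_inv X1) f1 + qform (matrix_inv X2) f2)"
    unfolding K using n Q le by (intro mult_left_mono) auto
  ultimately have X_gap: "2 * (bell_K TYPE('n) Q * qform (matrix_inv X) f) + 4 * (lam * w)
      \<le> bell_K TYPE('n) Q * qform (matrix_inv X1) f1 + bell_K TYPE('n) Q * qform (matrix_inv X2) f2"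
    unfolding distrib_left by (simp only: mult.left_commute[of _ 2])
  define u where "u = matrix_inv W *v f"
  have gap: "w + qform (matrix_inv W) (g - D *v u)
      \<le> (qform (matrix_inv W1) f1 + qform (matrix_inv W2) f2) / 2"
    unfolding w_def u_def halves using pW by (intro qform_inv_midpoint_gap) (auto simp: halves)
  have "qform W u = w"
    by (simp add: u_def w_def qform_def mv_matrix_inv[OF posdef_invertible[OF pW(1)]] inner_commute)
  then have "qform (matrix_inv W) (D *v u) \<le> lam * w"
    using lam(2)[of u] by simp
  moreover have "qform (matrix_inv W) ((g - D *v u) + D *v u)
      \<le> 2 * qform (matrix_inv W) (g - D *v u) + 2 * qform (matrix_inv W) (D *v u)"
    by (intro qform_add_le posdef_imp_psd posdef_matrix_inv pW)
  ultimately have "qform (matrix_inv W) g \<le> 2 * qform (matrix_inv W) (g - D *v u) + 2 * (lam * w)"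
    by simp
  then have "2 * w * 2 + 2 * qform (matrix_inv W) g
      \<le> 2 * (qform (matrix_inv W1) f1 + qform (matrix_inv W2) f2) + 4 * (lam * w)"
    using gap by argo
  with X_gap show ?thesis
    unfolding bellman_def X_def[symmetric] X1_def[symmetric] X2_def[symmetric] g_def[symmetric]
      w_def[symmetric] by argo
qed

section \<open>Averages over intervals\<close>

lemma locally_integrable_measurable:
  assumes "locally_integrable f"
  shows "f \<in> borel_measurable lebesgue"
proof (rule borel_measurable_LIMSEQ_metric)
  fix n :: nat
  show "(\<lambda>x. indicat_real {- real n..real n} x *\<^sub>R f x) \<in> borel_measurable lebesgue"
    using assms unfolding locally_integrable_def set_integrable_def
    by (intro borel_measurable_integrable) blast
next
  fix x :: real
  have "\<forall>\<^sub>F n in sequentially. \<bar>x\<bar> \<le> real n"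
    using filterlim_real_sequentially by (simp add: filterlim_at_top)
  then have "\<forall>\<^sub>F n in sequentially. indicat_real {- real n..real n} x *\<^sub>R f x = f x"
    by eventually_elim (auto simp: indicator_def)
  then show "(\<lambda>n. indicat_real {- real n..real n} x *\<^sub>R f x) \<longlonglongrightarrow> f x"
    by (rule tendsto_eventually)
qed

lemma matrix_eq_sum_axis: "A = (\<Sum>i\<in>UNIV. \<Sum>j\<in>UNIV. axis i (axis j (A $ i $ j)))"
  for A :: "complex^'n^'n"
proof -
  have *: "(axis i (axis j c) :: complex^'n^'n) $ k $ l = (if i = k then if j = l then c else 0 else 0)"
    for i j k l c
    by (simp add: axis_def)
  show ?thesis
    by (simp add: vec_eq_iff * sum.delta if_distrib[of "sum _"] cong: if_cong)
      (simp add: sum.If_cases)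
qed

lemma bounded_linear_axis_axis: "bounded_linear (\<lambda>c. axis i (axis j c) :: complex^'n^'n)"
  unfolding linear_conv_bounded_linear[symmetric]
  by (intro linearI) (simp_all add: vec_eq_iff axis_def)

lemma matrix_measurable:
  assumes "\<And>i j. (\<lambda>x. W x $ i $ j) \<in> borel_measurable M"
  shows "(W :: _ \<Rightarrow> complex^'n^'n) \<in> borel_measurable M"
proof -
  have "(\<lambda>c. axis i (axis j c) :: complex^'n^'n) \<in> borel_measurable borel" for i j
    by (intro borel_measurable_continuous_onI linear_continuous_on bounded_linear_axis_axis)
  from measurable_compose[OF assms this]
  have "(\<lambda>x. \<Sum>i\<in>UNIV. \<Sum>j\<in>UNIV. axis i (axis j (W x $ i $ j)) :: complex^'n^'n) \<in> borel_measurable M"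
    by (intro borel_measurable_sum)
  then show ?thesis
    by (simp flip: matrix_eq_sum_axis)
qed

lemma matrix_set_integrable:
  assumes "\<And>i j. set_integrable M S (\<lambda>x. W x $ i $ j)"
  shows "set_integrable M S (W :: _ \<Rightarrow> complex^'n^'n)"
proof -
  have "integrable M (\<lambda>x. \<Sum>i\<in>UNIV. \<Sum>j\<in>UNIV. axis i (axis j (indicator S x *\<^sub>R W x $ i $ j)))"
    using assms unfolding set_integrable_def
    by (intro Bochner_Integration.integrable_sum integrable_bounded_linear[OF bounded_linear_axis_axis])
  moreover have "(\<Sum>i\<in>UNIV. \<Sum>j\<in>UNIV. axis i (axis j (indicator S x *\<^sub>R W x $ i $ j))) = indicator S x *\<^sub>R W x" for x
    by (subst (2) matrix_eq_sum_axis) simp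
  ultimately show ?thesis
    by (simp add: set_integrable_def)
qed

lemma continuous_on_mv: "continuous_on UNIV (\<lambda>z :: (complex^'n^'n) \<times> (complex^'n). fst z *v snd z)"
  unfolding matrix_vector_mult_def by (intro continuous_intros)

lemma mv_measurable:
  fixes W :: "_ \<Rightarrow> complex^'n^'n"
  assumes "W \<in> borel_measurable M" "f \<in> borel_measurable M"
  shows "(\<lambda>x. W x *v f x) \<in> borel_measurable M"
  by (rule borel_measurable_continuous_Pair[OF assms, of "(*v)"]) (rule continuous_on_mv)

lemma qform_measurable:
  fixes W :: "_ \<Rightarrow> complex^'n^'n"
  assumes "W \<in> borel_measurable M" "f \<in> borel_measurable M"
  shows "(\<lambda>x. qform (W x) (f x)) \<in> borel_measurable M"
  unfolding qform_def using assms by (intro borel_measurable_inner mv_measurable)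

text \<open>\<open>average\<close> is confined to matrices; the vector-valued \<open>f\<close> has
  to be averaged as well.\<close>

definition mean :: "(real \<Rightarrow> 'a::euclidean_space) \<Rightarrow> real set \<Rightarrow> 'a" where
  "mean f I = (1 / measure lebesgue I) *\<^sub>R (LINT x:I|lebesgue. f x)"

lemma average_eq_mean: "average W I = mean W I"
  by (simp add: average_def mean_def)

lemma set_integral_linear:
  fixes f :: "real \<Rightarrow> 'a::euclidean_space" and T :: "'a \<Rightarrow> 'b::euclidean_space"
  assumes "linear T" "set_integrable M S f"
  shows "set_integrable M S (\<lambda>x. T (f x))" "(LINT x:S|M. T (f x)) = T (LINT x:S|M. f x)"
proof -
  have T: "bounded_linear T"
    using assms(1) by (simp add: linear_conv_bounded_linear)
  have *: "T (indicator S x *\<^sub>R f x) = indicator S x *\<^sub>R T (f x)" for x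
    using assms(1) by (simp add: linear_cmul)
  show "set_integrable M S (\<lambda>x. T (f x))" "(LINT x:S|M. T (f x)) = T (LINT x:S|M. f x)"
    using integrable_bounded_linear[OF T assms(2)[unfolded set_integrable_def]]
      integral_bounded_linear[OF T assms(2)[unfolded set_integrable_def]]
    by (simp_all add: set_integrable_def set_lebesgue_integral_def *)
qed

lemma mean_linear:
  fixes f :: "real \<Rightarrow> 'a::euclidean_space" and T :: "'a \<Rightarrow> 'b::euclidean_space"
  assumes "linear T" "set_integrable lebesgue S f"
  shows "T (mean f S) = mean (\<lambda>x. T (f x)) S"
  using set_integral_linear(2)[OF assms] linear_cmul[OF assms(1)] by (simp add: mean_def)

lemma locally_integrable_Ico:
  assumes "locally_integrable f"
  shows "set_integrable lebesgue {a..<b} f"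
proof (rule set_integrable_subset)
  show "set_integrable lebesgue {a..b} f"
    using assms by (simp add: locally_integrable_def)
qed auto

lemma measure_lebesgue_Ico: "a \<le> b \<Longrightarrow> measure lebesgue {a..<b} = b - a" for a b :: real
  by simp

lemma set_integrable_const_Ico: "set_integrable lebesgue {a..<b::real} (\<lambda>_. c :: 'a::euclidean_space)"
  unfolding set_integrable_def
  by (intro integrable_scaleR_left integrable_real_indicator) (cases "a \<le> b"; simp)+

lemma set_integral_const_Ico: "a \<le> b \<Longrightarrow> (LINT x:{a..<b::real}|lebesgue. c :: 'a::euclidean_space) = (b - a) *\<^sub>R c"
  by (simp add: set_lebesgue_integral_def)

lemma set_integral_split:
  fixes f :: "real \<Rightarrow> 'a::euclidean_space"
  assumes "a \<le> m" "m \<le> b" "set_integrable lebesgue {a..<b} f"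
  shows "(LINT x:{a..<b}|lebesgue. f x) = (LINT x:{a..<m}|lebesgue. f x) + (LINT x:{m..<b}|lebesgue. f x)"
proof -
  have "{a..<b} = {a..<m} \<union> {m..<b}"
    using assms by auto
  then show ?thesis
    using assms by (simp only:) (intro set_integral_Un set_integrable_subset[OF assms(3)], auto)
qed

lemma mean_split:
  fixes f :: "real \<Rightarrow> 'a::euclidean_space"
  assumes "0 < h" "set_integrable lebesgue {a..<a + 2 * h} f"
  shows "mean f {a..<a + 2 * h} = (1/2) *\<^sub>R (mean f {a..<a + h} + mean f {a + h..<a + 2 * h})"
  using assms set_integral_split[of a "a + h" "a + 2 * h" f]
  by (simp add: mean_def measure_lebesgue_Ico scaleR_right_distrib)

section \<open>Haar functions of an interval with half-length \<open>h\<close>\<close>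

lemma haar_halves:
  fixes a h :: real
  assumes "0 < h"
  shows "left_half {a..<a + 2 * h} = {a..<a + h}" "right_half {a..<a + 2 * h} = {a + h..<a + 2 * h}"
  using assms by (auto simp: left_half_def right_half_def field_simps)

lemma haar_Ico:
  fixes a h :: real
  assumes "0 < h"
  shows "haar {a..<a + 2 * h} x
    = (indicator {a + h..<a + 2 * h} x - indicator {a..<a + h} x) / sqrt (2 * h)"
  using assms by (simp add: haar_def haar_halves measure_lebesgue_Ico)

lemma haar_coeff_Ico:
  fixes f :: "real \<Rightarrow> complex^'n"
  assumes h: "0 < h" and f: "set_integrable lebesgue {a..<a + 2 * h} f"
  shows "haar_coeff f {a..<a + 2 * h}
    = (sqrt (2 * h) / 2) *\<^sub>R (mean f {a + h..<a + 2 * h} - mean f {a..<a + h})"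
proof -
  have int: "set_integrable lebesgue {a..<a + h} f" "set_integrable lebesgue {a + h..<a + 2 * h} f"
    using h by (auto intro!: set_integrable_subset[OF f])
  have "haar_coeff f {a..<a + 2 * h}
      = (LINT x|lebesgue. (1 / sqrt (2 * h)) *\<^sub>R
          (indicator {a + h..<a + 2 * h} x *\<^sub>R f x - indicator {a..<a + h} x *\<^sub>R f x))"
    unfolding haar_coeff_def set_lebesgue_integral_def
    using h by (intro Bochner_Integration.integral_cong) (auto simp: haar_Ico indicator_def)
  also have "\<dots> = (1 / sqrt (2 * h)) *\<^sub>R
      ((LINT x:{a + h..<a + 2 * h}|lebesgue. f x) - (LINT x:{a..<a + h}|lebesgue. f x))"
    using int by (simp add: set_integrable_def set_lebesgue_integral_def)
  also have "\<dots> = (sqrt (2 * h) / 2) *\<^sub>R (mean f {a + h..<a + 2 * h} - mean f {a..<a + h})"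
    using h by (simp add: mean_def measure_lebesgue_Ico scaleR_diff_right real_div_sqrt
        divide_simps flip: scaleR_diff_right)
  finally show ?thesis .
qed

text \<open>The inverse weight is a parameter of its own, so that exchanging the two weights is just
  another instance of the locale. The equation between them is required almost everywhere because
  inverting twice returns to \<open>W x\<close> where \<open>W x\<close> is invertible.\<close>

locale a2_pair =
  fixes W V :: "real \<Rightarrow> complex^'n^'n" and Q :: real
  assumes W_int: "\<And>i j. locally_integrable (\<lambda>x. W x $ i $ j)"
    and V_int: "\<And>i j. locally_integrable (\<lambda>x. V x $ i $ j)"
    and inverse: "AE x in lebesgue. posdef (W x) \<and> V x = matrix_inv (W x)"
    and Q: "1 \<le> Q"
    and a2: "\<And>a b x. a < b \<Longrightarrow>
      qform (mean W {a..<b}) x \<le> Q * qform (matrix_inv (mean V {a..<b})) x"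
begin

lemma W_set_integrable: "set_integrable lebesgue {a..<b} W"
  by (intro matrix_set_integrable locally_integrable_Ico W_int)

lemma V_set_integrable: "set_integrable lebesgue {a..<b} V"
  by (intro matrix_set_integrable locally_integrable_Ico V_int)

lemma W_measurable: "W \<in> borel_measurable lebesgue"
  by (intro matrix_measurable locally_integrable_measurable W_int)

lemma V_measurable: "V \<in> borel_measurable lebesgue"
  by (intro matrix_measurable locally_integrable_measurable V_int)

lemma AE_posdef: "AE x in lebesgue. posdef (W x) \<and> posdef (V x) \<and> V x = matrix_inv (W x)"
  using inverse by eventually_elim (auto simp: posdef_matrix_inv)

lemma AE_posdef_W: "AE x in lebesgue. posdef (W x)" and AE_posdef_V: "AE x in lebesgue. posdef (V x)"
  using AE_posdef by (eventually_elim, blast)+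

end

lemma mean_posdef:
  fixes W :: "real \<Rightarrow> complex^'n^'n"
  assumes int: "set_integrable lebesgue {a..<b} W" and pos: "AE x in lebesgue. posdef (W x)" and "a < b"
  shows "posdef (mean W {a..<b})"
  unfolding posdef_def
proof (intro conjI allI impI)
  have "mat_adjoint (mean W {a..<b}) = mean (\<lambda>x. mat_adjoint (W x)) {a..<b}"
    by (intro mean_linear linear_mat_adjoint int)
  also have "\<dots> = mean W {a..<b}"
    unfolding mean_def
    unfolding set_lebesgue_integral_def
  proof (intro arg_cong2[where f=scaleR] refl integral_cong_AE)
    show "AE x in lebesgue. indicat_real {a..<b} x *\<^sub>R mat_adjoint (W x) = indicat_real {a..<b} x *\<^sub>R W x"
      using pos by eventually_elim (simp add: posdef_def)
  qed (use int set_integral_linear(1)[OF linear_mat_adjoint int] in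
      \<open>auto simp: set_integrable_def intro: borel_measurable_integrable\<close>)
  finally show "mat_adjoint (mean W {a..<b}) = mean W {a..<b}" .
next
  fix v :: "complex^'n"
  assume v: "v \<noteq> 0"
  have q: "qform (mean W {a..<b}) v = (1 / (b - a)) * (LINT x:{a..<b}|lebesgue. qform (W x) v)"
    using mean_linear[OF linear_qform int, of v] \<open>a < b\<close> by (simp add: mean_def measure_lebesgue_Ico)
  have i: "set_integrable lebesgue {a..<b} (\<lambda>x. qform (W x) v)"
    by (intro set_integral_linear(1)[OF linear_qform int])
  have nn: "AE x in lebesgue. 0 \<le> indicat_real {a..<b} x *\<^sub>R qform (W x) v"
    using pos by eventually_elim (use v in \<open>auto simp: posdef_def indicator_def intro: less_imp_le\<close>)
  \<comment> \<open>Were the integral zero, the form would vanish almost everywhere on the interval;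
    by definiteness the interval would be a null set.\<close>
  have "(LINT x:{a..<b}|lebesgue. qform (W x) v) \<noteq> 0"
  proof
    assume "(LINT x:{a..<b}|lebesgue. qform (W x) v) = 0"
    then have "AE x in lebesgue. indicat_real {a..<b} x *\<^sub>R qform (W x) v = 0"
      using integral_nonneg_eq_0_iff_AE[OF i[unfolded set_integrable_def] nn]
      by (simp add: set_lebesgue_integral_def)
    with pos have "AE x in lebesgue. x \<notin> {a..<b}"
      by eventually_elim (use v in \<open>auto simp: posdef_def indicator_def split: if_splits\<close>)
    then have "{a..<b} \<in> null_sets lebesgue"
      by (simp add: AE_iff_null_sets)
    then have "emeasure lebesgue {a..<b} = 0"
      by auto
    with \<open>a < b\<close> show False
      by simp
  qed
  moreover have "0 \<le> (LINT x:{a..<b}|lebesgue. qform (W x) v)"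
    unfolding set_lebesgue_integral_def using nn by (rule integral_nonneg_AE)
  ultimately show "0 < qform (mean W {a..<b}) v"
    unfolding q using \<open>a < b\<close> by (intro mult_pos_pos) auto
qed

context a2_pair
begin

lemma posdef_mean_W: "a < b \<Longrightarrow> posdef (mean W {a..<b})"
  by (intro mean_posdef W_set_integrable AE_posdef_W)

lemma posdef_mean_V: "a < b \<Longrightarrow> posdef (mean V {a..<b})"
  by (intro mean_posdef V_set_integrable AE_posdef_V)

text \<open>Inversion reverses the order of positive definite matrices, so the A2 bound is symmetric
  in the two weights, with the same constant.\<close>

lemma swap: "a2_pair V W Q"
proof
  show "AE x in lebesgue. posdef (V x) \<and> W x = matrix_inv (V x)"
    using AE_posdef by eventually_elim (auto simp: posdef_invertible matrix_inv_matrix_inv)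
  fix a b :: real and x :: "complex^'n"
  assume ab: "a < b"
  define A where "A = mean W {a..<b}"
  define B where "B = mean V {a..<b}"
  have A: "posdef A" and B: "posdef B"
    using ab by (simp_all add: A_def B_def posdef_mean_W posdef_mean_V)
  have "qform (matrix_inv (Q *\<^sub>R matrix_inv B)) x \<le> qform (matrix_inv A) x"
    using a2[OF ab] Q A B
    by (intro qform_inv_antimono posdef_scaleR posdef_matrix_inv) (auto simp: A_def B_def qform_scaleR)
  moreover have "matrix_inv (Q *\<^sub>R matrix_inv B) = (1 / Q) *\<^sub>R B"
    using Q B by (subst matrix_inv_scaleR) (auto simp: posdef_invertible posdef_matrix_inv matrix_inv_matrix_inv)
  ultimately show "qform (mean V {a..<b}) x \<le> Q * qform (matrix_inv (mean W {a..<b})) x"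
    using Q by (simp add: qform_scaleR A_def B_def field_simps)
qed (use W_int V_int Q in auto)

text \<open>Integrability of \<open>f\<close> comes from \<open>2\<bar>\<langle>f, y\<rangle>\<bar> \<le> \<langle>W f, f\<rangle> + \<langle>V y, y\<rangle>\<close>.\<close>

lemma finite_energy_set_integrable:
  assumes f: "f \<in> borel_measurable lebesgue" and e: "integrable lebesgue (\<lambda>x. qform (W x) (f x))"
  shows "set_integrable lebesgue {a..<b} f"
proof -
  have f_b: "set_integrable lebesgue {a..<b} (\<lambda>x. f x \<bullet> y)" for y
    unfolding set_integrable_def
  proof (rule Bochner_Integration.integrable_bound)
    have "integrable lebesgue (\<lambda>x. indicator {a..<b} x *\<^sub>R qform (V x) y)"
      using set_integral_linear(1)[OF linear_qform V_set_integrable] by (simp add: set_integrable_def)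
    then show "integrable lebesgue (\<lambda>x. qform (W x) (f x) + indicator {a..<b} x *\<^sub>R qform (V x) y)"
      using e by (intro Bochner_Integration.integrable_add)
    show "AE x in lebesgue. norm (indicat_real {a..<b} x *\<^sub>R (f x \<bullet> y))
      \<le> norm (qform (W x) (f x) + indicator {a..<b} x *\<^sub>R qform (V x) y)"
      using AE_posdef
    proof eventually_elim
      case (elim x)
      have "2 * (y \<bullet> f x) - qform (W x) (f x) \<le> qform (V x) y"
        using qform_inv_ge[of "W x" y "f x"] elim by simp
      moreover have "2 * (y \<bullet> - f x) - qform (W x) (f x) \<le> qform (V x) y"
        using qform_inv_ge[of "W x" y "- f x"] elim by (simp add: qform_uminus_right)
      moreover have "psd (W x)" "psd (V x)"
        using elim posdef_imp_psd by blast+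
      then have "0 \<le> qform (W x) (f x)" "0 \<le> qform (V x) y"
        unfolding psd_iff_qform by blast+
      ultimately show ?case
        by (auto simp: indicator_def inner_commute)
    qed
    show "(\<lambda>x. indicat_real {a..<b} x *\<^sub>R (f x \<bullet> y)) \<in> borel_measurable lebesgue"
      using f by (intro borel_measurable_scaleR borel_measurable_indicator borel_measurable_inner
          borel_measurable_const) auto
  qed
  have "set_integrable lebesgue {a..<b} (\<lambda>x. \<Sum>y\<in>Basis. (f x \<bullet> y) *\<^sub>R y)"
    unfolding set_integrable_def scaleR_sum_right
  proof (intro Bochner_Integration.integrable_sum)
    fix y :: "complex^'n"
    show "integrable lebesgue (\<lambda>x. indicat_real {a..<b} x *\<^sub>R (f x \<bullet> y) *\<^sub>R y)"
      using integrable_scaleR_left[of y lebesgue "\<lambda>x. indicat_real {a..<b} x *\<^sub>R (f x \<bullet> y)"] f_b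
      by (simp add: set_integrable_def)
  qed
  then show ?thesis
    by (simp add: euclidean_representation)
qed

text \<open>Jensen's inequality for the jointly convex function \<open>(f, W) \<mapsto> \<langle>W\<^sup>-\<^sup>1 f, f\<rangle>\<close>.\<close>

lemma jensen_inv:
  assumes f: "set_integrable lebesgue {a..<b} f"
    and e: "set_integrable lebesgue {a..<b} (\<lambda>x. qform (V x) (f x))" and ab: "a < b"
  shows "(b - a) * qform (matrix_inv (mean W {a..<b})) (mean f {a..<b})
    \<le> (LINT x:{a..<b}|lebesgue. qform (V x) (f x))"
proof -
  define y where "y = matrix_inv (mean W {a..<b}) *v mean f {a..<b}"
  have i: "set_integrable lebesgue {a..<b} (\<lambda>x. f x \<bullet> y)"
    "(LINT x:{a..<b}|lebesgue. f x \<bullet> y) = (LINT x:{a..<b}|lebesgue. f x) \<bullet> y"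
    by (rule set_integral_linear[OF _ f], simp add: linear_iff inner_add_left)+
  have j: "set_integrable lebesgue {a..<b} (\<lambda>x. qform (W x) y)"
    "(LINT x:{a..<b}|lebesgue. qform (W x) y) = qform (LINT x:{a..<b}|lebesgue. W x) y"
    by (rule set_integral_linear[OF linear_qform W_set_integrable])+
  have i2: "set_integrable lebesgue {a..<b} (\<lambda>x. 2 * (f x \<bullet> y))"
    using i(1) by simp
  have "(b - a) * qform (matrix_inv (mean W {a..<b})) (mean f {a..<b})
      = (b - a) * (2 * (mean f {a..<b} \<bullet> y) - qform (mean W {a..<b}) y)"
    unfolding y_def by (subst qform_inv_eq[OF posdef_mean_W[OF ab]]) simp
  also have "\<dots> = 2 * (LINT x:{a..<b}|lebesgue. f x \<bullet> y) - (LINT x:{a..<b}|lebesgue. qform (W x) y)"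
  proof -
    have "(b - a) * (mean f {a..<b} \<bullet> y) = (LINT x:{a..<b}|lebesgue. f x \<bullet> y)"
      "(b - a) * qform (mean W {a..<b}) y = (LINT x:{a..<b}|lebesgue. qform (W x) y)"
      unfolding i(2) j(2) using ab by (simp_all add: mean_def qform_scaleR)
    then show ?thesis
      by (simp add: right_diff_distrib mult.left_commute[of _ 2])
  qed
  also have "\<dots> = (LINT x:{a..<b}|lebesgue. 2 * (f x \<bullet> y) - qform (W x) y)"
    by (simp add: set_integral_diff(2)[OF i2 j(1)])
  also have "\<dots> \<le> (LINT x:{a..<b}|lebesgue. qform (V x) (f x))"
    unfolding set_lebesgue_integral_def
  proof (rule integral_mono_AE)
    show "AE x in lebesgue. indicat_real {a..<b} x *\<^sub>R (2 * (f x \<bullet> y) - qform (W x) y)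
        \<le> indicat_real {a..<b} x *\<^sub>R qform (V x) (f x)"
      using AE_posdef
    proof eventually_elim
      case (elim x)
      then show ?case
        using qform_inv_ge[of "W x" "f x" y] by (auto simp: indicator_def)
    qed
  qed (use e set_integral_diff(1)[OF i2 j(1)] in \<open>auto simp: set_integrable_def\<close>)
  finally show ?thesis .
qed

text \<open>Jensen's inequality for the constant function \<open>x\<close>. It is the half of
  \<open>a2_cond\<close> that holds for any weight and its inverse.\<close>

lemma qform_inv_mean_le:
  assumes ab: "a < b"
  shows "qform (matrix_inv (mean W {a..<b})) x \<le> qform (mean V {a..<b}) x"
proof -
  have "mean (\<lambda>_. x) {a..<b} = x"
    using ab by (simp add: mean_def set_integral_const_Ico)
  moreover have "set_integrable lebesgue {a..<b} (\<lambda>t. qform (V t) x)"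
    "(LINT t:{a..<b}|lebesgue. qform (V t) x) = (b - a) * qform (mean V {a..<b}) x"
    using set_integral_linear[OF linear_qform V_set_integrable, of a b x] ab
    by (simp_all add: mean_def qform_scaleR)
  ultimately have "(b - a) * qform (matrix_inv (mean W {a..<b})) x \<le> (b - a) * qform (mean V {a..<b}) x"
    using jensen_inv[of a b "\<lambda>_. x"] ab by (simp add: set_integrable_const_Ico)
  then show ?thesis
    using ab by simp
qed

lemma a2_cond_mean: "a < b \<Longrightarrow> a2_cond Q (mean W {a..<b}) (mean V {a..<b})"
  using a2_pair.qform_inv_mean_le[OF swap] a2 by (simp add: a2_cond_def posdef_mean_W posdef_mean_V)

end

section \<open>Dyadic intervals and Haar functions\<close>

definition dyi :: "real \<Rightarrow> real \<Rightarrow> int \<Rightarrow> int \<Rightarrow> real set" where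
  "dyi \<alpha> r j k = {\<alpha> + r * (of_int k * 2 powi j) ..< \<alpha> + r * ((of_int k + 1) * 2 powi j)}"

text \<open>The index of the level-\<open>j\<close> interval that contains \<open>x\<close>.
  Membership becomes an equation of integers, and passing to a coarser level becomes integer
  division by a power of 2, from which the nesting of the grid is read off.\<close>

definition dyn :: "real \<Rightarrow> real \<Rightarrow> int \<Rightarrow> real \<Rightarrow> int" where
  "dyn \<alpha> r j x = \<lfloor>(x - \<alpha>) / (r * 2 powi j)\<rfloor>"

lemma dyadic_grid_eq:
  assumes "0 < r"
  shows "dyadic_grid \<alpha> r = (\<lambda>(j, k). dyi \<alpha> r j k) ` UNIV"
proof -
  have "(\<lambda>x. \<alpha> + r * x) ` {of_int k * 2 powi j ..< (of_int k + 1) * 2 powi j} = dyi \<alpha> r j k" for j k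
  proof -
    have "(\<lambda>x. \<alpha> + r * x) ` {u ..< v} = {\<alpha> + r * u ..< \<alpha> + r * v}" for u v
    proof safe
      fix x
      assume "x \<in> {\<alpha> + r * u..<\<alpha> + r * v}"
      then have "x = \<alpha> + r * ((x - \<alpha>) / r)" "(x - \<alpha>) / r \<in> {u..<v}"
        using assms by (auto simp: field_simps)
      then show "x \<in> (\<lambda>x. \<alpha> + r * x) ` {u..<v}"
        by (rule image_eqI)
    qed (use assms in auto)
    then show ?thesis
      by (simp add: dyi_def)
  qed
  then show ?thesis
    unfolding dyadic_grid_def standard_dyadic_def by (auto simp: image_iff) metis+
qed

lemma dyi_iff:
  assumes "0 < r"
  shows "x \<in> dyi \<alpha> r j k \<longleftrightarrow> dyn \<alpha> r j x = k"
proof -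
  have p: "0 < r * 2 powi j"
    using assms by simp
  have "dyn \<alpha> r j x = k \<longleftrightarrow> of_int k \<le> (x - \<alpha>) / (r * 2 powi j) \<and> (x - \<alpha>) / (r * 2 powi j) < of_int k + 1"
    unfolding dyn_def by (rule floor_eq_iff)
  also have "\<dots> \<longleftrightarrow> x \<in> dyi \<alpha> r j k"
    unfolding pos_le_divide_eq[OF p] pos_divide_less_eq[OF p] dyi_def by (auto simp: algebra_simps)
  finally show ?thesis
    by simp
qed

lemma dyn_coarsen:
  assumes "0 < r" "j \<le> j'"
  shows "dyn \<alpha> r j' x = dyn \<alpha> r j x div 2 ^ nat (j' - j)"
proof -
  have "(2::real) powi j' = 2 powi j * 2 ^ nat (j' - j)"
    using assms(2) by (simp flip: power_int_add power_int_of_nat)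
  then have "(x - \<alpha>) / (r * 2 powi j') = (x - \<alpha>) / (r * 2 powi j) / real_of_int (2 ^ nat (j' - j))"
    by simp
  then show ?thesis
    unfolding dyn_def by (simp only: floor_divide_real_eq_div zero_le_power zero_le_numeral)
qed

lemma dyi_split:
  assumes "0 < r"
  obtains a h where "0 < h" "h = r * 2 powi (j - 1)" "dyi \<alpha> r j k = {a..<a + 2 * h}"
    "dyi \<alpha> r (j - 1) (2 * k) = {a..<a + h}" "dyi \<alpha> r (j - 1) (2 * k + 1) = {a + h..<a + 2 * h}"
proof
  have 2: "(2::real) powi j = 2 * 2 powi (j - 1)"
    using power_int_add_1[of "2::real" "j - 1"] by simp
  let ?h = "r * 2 powi (j - 1)"
  let ?a = "\<alpha> + r * (of_int k * 2 powi j)"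
  show "0 < ?h" "?h = ?h"
    using assms by auto
  show "dyi \<alpha> r j k = {?a..<?a + 2 * ?h}" "dyi \<alpha> r (j - 1) (2 * k) = {?a..<?a + ?h}"
    "dyi \<alpha> r (j - 1) (2 * k + 1) = {?a + ?h..<?a + 2 * ?h}"
    unfolding dyi_def 2 by (simp_all add: algebra_simps)
qed

lemma dyadic_grid_Ico:
  assumes "0 < r" "I \<in> dyadic_grid \<alpha> r"
  obtains a h where "0 < h" "I = {a..<a + 2 * h}"
  using assms(2) dyi_split[OF assms(1)] unfolding dyadic_grid_eq[OF assms(1)]
  by (metis (no_types, lifting) case_prod_conv image_iff old.prod.exhaust)

section \<open>Integrals and orthogonality of Haar functions\<close>

lemma haar_coeff_integrable:
  fixes f :: "real \<Rightarrow> complex^'n"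
  assumes h: "0 < h" and f: "set_integrable lebesgue {a..<a + 2 * h} f"
  shows "integrable lebesgue (\<lambda>x. haar {a..<a + 2 * h} x *\<^sub>R f x)"
proof -
  have int: "set_integrable lebesgue {a..<a + h} f" "set_integrable lebesgue {a + h..<a + 2 * h} f"
    using h by (auto intro!: set_integrable_subset[OF f])
  have "integrable lebesgue (\<lambda>x. (1 / sqrt (2 * h)) *\<^sub>R
          (indicator {a + h..<a + 2 * h} x *\<^sub>R f x - indicator {a..<a + h} x *\<^sub>R f x))"
    using int unfolding set_integrable_def by (intro integrable_scaleR_right Bochner_Integration.integrable_diff)
  also have "(\<lambda>x. (1 / sqrt (2 * h)) *\<^sub>R
          (indicator {a + h..<a + 2 * h} x *\<^sub>R f x - indicator {a..<a + h} x *\<^sub>R f x))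
      = (\<lambda>x. haar {a..<a + 2 * h} x *\<^sub>R f x)"
    using h by (auto simp: haar_Ico indicator_def)
  finally show ?thesis .
qed

lemma haar_coeff_eq:
  fixes f :: "real \<Rightarrow> complex^'n"
  assumes h: "0 < h"
  shows "haar_coeff f {a..<a + 2 * h} = (LINT x|lebesgue. haar {a..<a + 2 * h} x *\<^sub>R f x)"
  unfolding haar_coeff_def set_lebesgue_integral_def
  using h by (intro Bochner_Integration.integral_cong) (auto simp: haar_Ico indicator_def)

lemma haar_outside: "x \<notin> I \<Longrightarrow> haar I x = 0"
  by (simp add: haar_def left_half_def right_half_def)

lemma haar_sq:
  assumes "0 < h"
  shows "(haar {a..<a + 2 * h} x)\<^sup>2 = indicator {a..<a + 2 * h} x / (2 * h)"
  using assms by (auto simp: haar_Ico indicator_def power_divide)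

lemma haar_measurable:
  assumes "0 < h"
  shows "haar {a..<a + 2 * h} \<in> borel_measurable lebesgue"
proof -
  have "(\<lambda>x. (indicator {a + h..<a + 2 * h} x - indicator {a..<a + h} x) / sqrt (2 * h)) \<in> borel_measurable lebesgue"
    by (intro borel_measurable_divide borel_measurable_diff borel_measurable_indicator borel_measurable_const) auto
  moreover have "haar {a..<a + 2 * h}
      = (\<lambda>x. (indicator {a + h..<a + 2 * h} x - indicator {a..<a + h} x) / sqrt (2 * h))"
    using haar_Ico[OF assms] by (intro ext)
  ultimately show ?thesis
    by simp
qed

lemma mean_eqI:
  fixes c :: "'a::euclidean_space"
  assumes "a < b" "\<And>x. x \<in> {a..<b} \<Longrightarrow> f x = c"
  shows "mean f {a..<b} = c"
proof -
  have "(LINT x:{a..<b}|lebesgue. f x) = (LINT x:{a..<b}|lebesgue. c)"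
    unfolding set_lebesgue_integral_def using assms by (intro Bochner_Integration.integral_cong) (auto simp: indicator_def)
  then show ?thesis
    using assms by (simp add: mean_def set_integral_const_Ico)
qed

lemma haar_set_integrable:
  fixes e :: "complex^'n"
  assumes "0 < h"
  shows "set_integrable lebesgue {c..<d} (\<lambda>x. haar {a..<a + 2 * h} x *\<^sub>R e)"
proof -
  have "integrable lebesgue (\<lambda>x. haar {a..<a + 2 * h} x *\<^sub>R e)"
    by (intro haar_coeff_integrable[OF assms] set_integrable_const_Ico)
  from integrable_mult_indicator[OF _ this, of "{c..<d}"] show ?thesis
    by (simp add: set_integrable_def)
qed

lemma mean_haar_0:
  fixes e :: "complex^'n"
  assumes "0 < h" "{a..<a + 2 * h} \<subseteq> S \<or> {a..<a + 2 * h} \<inter> S = {}"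
  shows "mean (\<lambda>x. haar {a..<a + 2 * h} x *\<^sub>R e) S = 0"
proof -
  have "(LINT x:S|lebesgue. haar {a..<a + 2 * h} x *\<^sub>R e) = 0"
    using assms(2)
  proof
    assume sub: "{a..<a + 2 * h} \<subseteq> S"
    have "(LINT x:S|lebesgue. haar {a..<a + 2 * h} x *\<^sub>R e) = (LINT x|lebesgue. haar {a..<a + 2 * h} x *\<^sub>R e)"
      unfolding set_lebesgue_integral_def
      using sub assms(1) by (intro Bochner_Integration.integral_cong) (auto simp: haar_Ico indicator_def)
    also have "\<dots> = haar_coeff (\<lambda>_. e) {a..<a + 2 * h}"
      by (simp add: haar_coeff_eq[OF assms(1)])
    also have "\<dots> = 0"
      using assms(1) mean_eqI[of a "a + h" "\<lambda>_. e" e] mean_eqI[of "a + h" "a + 2 * h" "\<lambda>_. e" e]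
      by (simp add: haar_coeff_Ico set_integrable_const_Ico)
    finally show ?thesis .
  next
    assume dis: "{a..<a + 2 * h} \<inter> S = {}"
    have "indicat_real S x *\<^sub>R haar {a..<a + 2 * h} x *\<^sub>R e = 0" for x
    proof (cases "x \<in> S")
      case True
      with dis have "x \<notin> {a..<a + 2 * h}"
        by blast
      then show ?thesis
        by (subst haar_outside) simp_all
    qed simp
    then show ?thesis
      unfolding set_lebesgue_integral_def by (simp only: Bochner_Integration.integral_zero)
  qed
  then show ?thesis
    by (simp add: mean_def)
qed

lemma haar_dyi:
  assumes "0 < r"
  shows "haar (dyi \<alpha> r j k) x
    = (if dyn \<alpha> r (j - 1) x = 2 * k + 1 then 1 else if dyn \<alpha> r (j - 1) x = 2 * k then - 1 else 0)
      / sqrt (2 * (r * 2 powi (j - 1)))"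
proof -
  obtain a h where *: "0 < h" "h = r * 2 powi (j - 1)" "dyi \<alpha> r j k = {a..<a + 2 * h}"
    "dyi \<alpha> r (j - 1) (2 * k) = {a..<a + h}" "dyi \<alpha> r (j - 1) (2 * k + 1) = {a + h..<a + 2 * h}"
    by (rule dyi_split[OF assms])
  show ?thesis
    unfolding *(3) haar_Ico[OF *(1)] *(4,5)[symmetric] dyi_iff[OF assms] indicator_def
    unfolding *(2) by auto
qed

text \<open>The Haar function of a larger interval is constant on \<open>I\<close>. That of a
  smaller one has mean zero on each half of \<open>I\<close>, since its interval lies in the half or
  misses it. Distinct intervals of one level are disjoint.\<close>

lemma haar_orthonormal:
  fixes e :: "complex^'n"
  assumes r: "0 < r" and I: "I \<in> dyadic_grid \<alpha> r" and J: "J \<in> dyadic_grid \<alpha> r"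
  shows "haar_coeff (\<lambda>x. haar J x *\<^sub>R e) I = (if I = J then e else 0)"
proof -
  obtain i k where Ik: "I = dyi \<alpha> r i k"
    using I by (auto simp: dyadic_grid_eq[OF r])
  obtain j l where Jl: "J = dyi \<alpha> r j l"
    using J by (auto simp: dyadic_grid_eq[OF r])
  obtain a h where I': "0 < h" "h = r * 2 powi (i - 1)" "I = {a..<a + 2 * h}"
    "dyi \<alpha> r (i - 1) (2 * k) = {a..<a + h}" "dyi \<alpha> r (i - 1) (2 * k + 1) = {a + h..<a + 2 * h}"
    using dyi_split[OF r, of i \<alpha> k] unfolding Ik by metis
  obtain b g where J': "0 < g" "J = {b..<b + 2 * g}"
    using dyi_split[OF r, of j \<alpha> l] unfolding Jl by metis
  define f where "f x = haar J x *\<^sub>R e" for x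
  have c: "haar_coeff f I = (sqrt (2 * h) / 2) *\<^sub>R (mean f {a + h..<a + 2 * h} - mean f {a..<a + h})"
    unfolding I'(3) f_def J'(2) by (intro haar_coeff_Ico I' haar_set_integrable J')
  have halves: "x \<in> {a..<a + h} \<longleftrightarrow> dyn \<alpha> r (i - 1) x = 2 * k"
    "x \<in> {a + h..<a + 2 * h} \<longleftrightarrow> dyn \<alpha> r (i - 1) x = 2 * k + 1" for x
    unfolding I'(4,5)[symmetric] dyi_iff[OF r] by auto
  have eq: "\<lbrakk>\<And>x. x \<in> {a..<a + h} \<Longrightarrow> f x = u; \<And>x. x \<in> {a + h..<a + 2 * h} \<Longrightarrow> f x = v\<rbrakk>
    \<Longrightarrow> haar_coeff f I = (sqrt (2 * h) / 2) *\<^sub>R (v - u)" for u v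
    unfolding c using mean_eqI[of a "a + h" f u] mean_eqI[of "a + h" "a + 2 * h" f v] I'(1) by simp
  consider "i < j" | "j < i" | "i = j" "k \<noteq> l" | "i = j" "k = l"
    by linarith
  then have "haar_coeff f I = (if I = J then e else 0)"
  proof cases
    case 1
    have dj: "dyn \<alpha> r (j - 1) x = dyn \<alpha> r i x div 2 ^ nat (j - 1 - i)" for x
      using 1 by (intro dyn_coarsen r) auto
    have di: "x \<in> I \<longleftrightarrow> dyn \<alpha> r i x = k" for x
      unfolding Ik by (rule dyi_iff[OF r])
    define u where "u = f a"
    have "f x = u" if "x \<in> I" for x
      using that di[of x] di[of a] I'(1,3) unfolding u_def f_def Jl haar_dyi[OF r] dj by simp
    then have "haar_coeff f I = (sqrt (2 * h) / 2) *\<^sub>R (u - u)"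
      using I'(1,3) by (intro eq) auto
    moreover have "I \<noteq> J"
    proof
      assume "I = J"
      moreover have "measure lebesgue I = r * 2 powi i" "measure lebesgue J = r * 2 powi j"
        using r unfolding Ik Jl dyi_def by (auto simp: algebra_simps mult_left_mono)
      ultimately show False
        using r 1 power_int_strict_increasing[of i j "2::real"] by simp
    qed
    ultimately show ?thesis
      by simp
  next
    case 2
    have "dyn \<alpha> r (i - 1) x = dyn \<alpha> r j x div 2 ^ nat (i - 1 - j)" for x
      using 2 by (intro dyn_coarsen r) auto
    then have "J \<subseteq> {a..<a + h} \<or> J \<inter> {a..<a + h} = {}" "J \<subseteq> {a + h..<a + 2 * h} \<or> J \<inter> {a + h..<a + 2 * h} = {}"
      using halves unfolding Jl by (auto simp: dyi_iff[OF r])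
    then have "mean f {a..<a + h} = 0" "mean f {a + h..<a + 2 * h} = 0"
      unfolding f_def J'(2) by (intro mean_haar_0 J', simp)+
    moreover have "I \<noteq> J"
    proof
      assume "I = J"
      moreover have "measure lebesgue I = r * 2 powi i" "measure lebesgue J = r * 2 powi j"
        using r unfolding Ik Jl dyi_def by (auto simp: algebra_simps mult_left_mono)
      ultimately show False
        using r 2 power_int_strict_increasing[of j i "2::real"] by simp
    qed
    ultimately show ?thesis
      by (simp add: c)
  next
    case 3
    then have "haar_coeff f I = (sqrt (2 * h) / 2) *\<^sub>R (0 - 0)"
      using halves by (intro eq) (auto simp: f_def Jl haar_dyi[OF r])
    moreover have "I \<noteq> J"
    proof -
      have "a \<in> I"
        using I' by simp
      then have "a \<in> I - J"
        using 3 unfolding Ik Jl by (simp add: dyi_iff[OF r])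
      then show ?thesis
        by blast
    qed
    ultimately show ?thesis
      by simp
  next
    case 4
    then have "haar_coeff f I = (sqrt (2 * h) / 2) *\<^sub>R ((1 / sqrt (2 * h)) *\<^sub>R e - (- 1 / sqrt (2 * h)) *\<^sub>R e)"
      using halves by (intro eq) (auto simp: f_def Jl haar_dyi[OF r] I'(2))
    also have "\<dots> = e"
      using I'(1) by (simp flip: scaleR_2)
    finally show ?thesis
      using 4 by (simp add: Ik Jl)
  qed
  then show ?thesis
    by (simp add: f_def[abs_def])
qed

section \<open>Square function estimates\<close>

lemma sum_int_halves:
  fixes g :: "int \<Rightarrow> real"
  shows "(\<Sum>k\<in>{2 * a..<2 * b}. g k) = (\<Sum>k\<in>{a..<b}. g (2 * k) + g (2 * k + 1))"
proof -
  have "{2 * a..<2 * b} = (\<lambda>k. 2 * k) ` {a..<b} \<union> (\<lambda>k. 2 * k + 1) ` {a..<b}"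
  proof safe
    fix x
    assume *: "x \<in> {2 * a..<2 * b}" "x \<notin> (\<lambda>k. 2 * k + 1) ` {a..<b}"
    have "x = 2 * (x div 2) \<or> x = 2 * (x div 2) + 1" "x div 2 \<in> {a..<b}"
      using *(1) by auto
    with *(2) show "x \<in> (\<lambda>k. 2 * k) ` {a..<b}"
      by blast
  qed auto
  moreover have "(\<lambda>k. 2 * k) ` {a..<b} \<inter> (\<lambda>k. 2 * k + 1) ` {a..<b} = {}"
    by auto presburger
  ultimately have "(\<Sum>k\<in>{2 * a..<2 * b}. g k) = (\<Sum>k\<in>(\<lambda>k. 2 * k) ` {a..<b}. g k) + (\<Sum>k\<in>(\<lambda>k. 2 * k + 1) ` {a..<b}. g k)"
    by (simp add: sum.union_disjoint)
  then show ?thesis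
    by (simp add: sum.reindex inj_on_def sum.distrib)
qed

text \<open>The step inequality telescopes over generations. The roots are the
  level-\<open>N\<close> intervals with indices -1 and 0, which meet at the origin of the grid;
  their descendants \<open>n\<close> generations below have exactly the indices from -2^n to 2^n -
  1.\<close>

lemma dyadic_tree_sum:
  fixes G s :: "int \<Rightarrow> int \<Rightarrow> real"
  assumes step: "\<And>j k. G j k + s j k \<le> G (j - 1) (2 * k) + G (j - 1) (2 * k + 1)"
  shows "(\<Sum>l<n. \<Sum>k\<in>{-(2^l)..<2^l}. s (N - int l) k) + (\<Sum>k\<in>{-1..<1}. G N k)
    \<le> (\<Sum>k\<in>{-(2^n)..<2^n}. G (N - int n) k)"
proof (induction n)
  case (Suc n)
  have "(\<Sum>k\<in>{-(2^n)..<2^n}. s (N - int n) k) + (\<Sum>k\<in>{-(2^n)..<2^n}. G (N - int n) k)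
      \<le> (\<Sum>k\<in>{-(2^n)..<2^n}. G (N - int n - 1) (2 * k) + G (N - int n - 1) (2 * k + 1))"
    unfolding sum.distrib[symmetric] using step by (intro sum_mono) (simp add: add.commute)
  also have "\<dots> = (\<Sum>k\<in>{-(2^Suc n)..<2^Suc n}. G (N - int (Suc n)) k)"
    using sum_int_halves[of "G (N - int n - 1)" "-(2^n)" "2^n"] by (simp add: algebra_simps)
  finally show ?case
    using Suc.IH by simp
qed simp

text \<open>Intervals on different sides of the origin of the grid have no common ancestor, but
  finitely many of them always lie below two roots of sufficiently high level, one on each
  side.\<close>

lemma dyadic_family_sum:
  fixes G s :: "int \<Rightarrow> int \<Rightarrow> real"
  assumes step: "\<And>j k. G j k + s j k \<le> G (j - 1) (2 * k) + G (j - 1) (2 * k + 1)"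
    and nonneg: "\<And>j k. 0 \<le> s j k" "\<And>j k. 0 \<le> G j k"
    and level: "\<And>j A. finite A \<Longrightarrow> (\<Sum>k\<in>A. G j k) \<le> C"
    and P: "finite P"
  shows "(\<Sum>(j, k)\<in>P. s j k) \<le> C"
proof -
  define B where "B = nat (\<Sum>(j, k)\<in>P. \<bar>j\<bar> + \<bar>k\<bar>)"
  have B: "\<bar>j\<bar> \<le> int B" "\<bar>k\<bar> \<le> int B" if "(j, k) \<in> P" for j k
  proof -
    have "\<bar>j\<bar> + \<bar>k\<bar> \<le> (\<Sum>(j, k)\<in>P. \<bar>j\<bar> + \<bar>k\<bar>)"
      using member_le_sum[of "(j, k)" P "\<lambda>(j, k). \<bar>j\<bar> + \<bar>k\<bar>"] that P by auto
    then show "\<bar>j\<bar> \<le> int B" "\<bar>k\<bar> \<le> int B"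
      by (auto simp: B_def)
  qed
  \<comment> \<open>With all indices bounded by \<open>B\<close>, every pair of \<open>P\<close>
    sits at depth \<open>l = N - j\<close> between \<open>B\<close> and \<open>3 * B\<close>, and a
    depth of at least \<open>B\<close> leaves room for the index because B < 2^B.\<close>
  define N where "N = 2 * int B"
  define n where "n = 3 * B + 1"
  define S where "S = Sigma {..<n} (\<lambda>l. {-(2^l)..<(2::int)^l})"
  have fS: "finite S"
    by (simp add: S_def)
  have sub: "P \<subseteq> (\<lambda>(l, k). (N - int l, k)) ` S"
  proof
    fix p
    assume p: "p \<in> P"
    obtain j k where jk: "p = (j, k)"
      by fastforce
    define l where "l = nat (N - j)"
    have l: "int l = N - j" "B \<le> l" "l < n"
      using B(1)[of j k] p by (auto simp: jk l_def N_def n_def)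
    have "\<bar>k\<bar> \<le> int l"
      using B(2)[of j k] p l by (simp add: jk)
    also have "int l < 2 ^ l"
      using of_nat_less_two_power[of l, where 'a=int] by simp
    finally have "(l, k) \<in> S"
      using l(3) by (auto simp: S_def)
    moreover have "p = (N - int l, k)"
      using l(1) jk by simp
    ultimately show "p \<in> (\<lambda>(l, k). (N - int l, k)) ` S"
      by (intro image_eqI[where x="(l, k)"]) auto
  qed
  have "(\<Sum>(j, k)\<in>P. s j k) \<le> (\<Sum>(j, k)\<in>(\<lambda>(l, k). (N - int l, k)) ` S. s j k)"
    using nonneg(1) fS sub by (intro sum_mono2) auto
  also have "\<dots> = (\<Sum>(l, k)\<in>S. s (N - int l) k)"
    by (subst sum.reindex) (auto simp: inj_on_def intro!: sum.cong)
  also have "\<dots> = (\<Sum>l<n. \<Sum>k\<in>{-(2^l)..<2^l}. s (N - int l) k)"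
    unfolding S_def by (subst sum.Sigma) auto
  also have "\<dots> \<le> (\<Sum>k\<in>{-(2^n)..<2^n}. G (N - int n) k)"
    using dyadic_tree_sum[of G s, OF step, where n=n and N=N] sum_nonneg[of "{-1..<1}" "G N"] nonneg(2) by auto
  also have "\<dots> \<le> C"
    by (intro level) auto
  finally show ?thesis .
qed

definition sqK :: "'n itself \<Rightarrow> real \<Rightarrow> real" where
  "sqK t Q = 2 + bell_K t Q"

context a2_pair
begin

abbreviation energy :: "(real \<Rightarrow> complex^'n) \<Rightarrow> real" where
  "energy f \<equiv> LINT x|lebesgue. qform (W x) (f x)"

lemma sqK_pos: "0 < sqK TYPE('n) Q"
  using Q by (simp add: sqK_def bell_K_def add_pos_nonneg)

text \<open>The estimate of \<open>f\<close> in \<open>L\<^sup>2(W\<^sup>-\<^sup>1)\<close>; the other two square function estimates follow by exchanging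
  \<open>W\<close> and \<open>W\<^sup>-\<^sup>1\<close> and by duality.\<close>

lemma square_function_inv:
  fixes f :: "real \<Rightarrow> complex^'n"
  assumes r: "0 < r" and F: "finite F" "F \<subseteq> dyadic_grid \<alpha> r"
    and f: "f \<in> borel_measurable lebesgue" and e: "integrable lebesgue (\<lambda>x. qform (V x) (f x))"
  shows "(\<Sum>I\<in>F. qform (matrix_inv (mean W I)) (haar_coeff f I))
    \<le> sqK TYPE('n) Q * (LINT x|lebesgue. qform (V x) (f x))"
proof -
  interpret sw: a2_pair V W Q
    by (rule swap)
  have f_int: "set_integrable lebesgue {a..<b} f" for a b
    by (rule sw.finite_energy_set_integrable[OF f e])
  have e_int: "set_integrable lebesgue S (\<lambda>x. qform (V x) (f x))" if "S \<in> sets lebesgue" for S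
    using integrable_mult_indicator[OF that e] by (simp add: set_integrable_def)
  have e_nn: "AE x in lebesgue. 0 \<le> qform (V x) (f x)"
    using AE_posdef_V by eventually_elim (use posdef_imp_psd psd_iff_qform in blast)
  define E where "E = (LINT x|lebesgue. qform (V x) (f x))"
  define g where "g I = bellman Q (mean f I) (mean W I) (mean V I)" for I
  \<comment> \<open>The factor of the length turns the midpoint inequality for averages into an
    inequality between an interval and its two children, as \<open>dyadic_family_sum\<close>
    requires.\<close>
  define G where "G j k = measure lebesgue (dyi \<alpha> r j k) * g (dyi \<alpha> r j k)" for j k
  define s where "s j k = qform (matrix_inv (mean W (dyi \<alpha> r j k))) (haar_coeff f (dyi \<alpha> r j k))" for j k
  have G: "0 \<le> G j k" "G j k \<le> sqK TYPE('n) Q * (LINT x:dyi \<alpha> r j k|lebesgue. qform (V x) (f x))"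
    and s: "0 \<le> s j k" for j k
  proof -
    obtain a h where ah: "0 < h" "dyi \<alpha> r j k = {a..<a + 2 * h}"
      using dyi_split[OF r] by metis
    have ab: "a < a + 2 * h"
      using ah by simp
    show "0 \<le> G j k"
      unfolding G_def ah g_def by (intro mult_nonneg_nonneg bellman_nonneg a2_cond_mean ab Q) simp
    have "G j k \<le> measure lebesgue {a..<a + 2 * h} *
        (sqK TYPE('n) Q * qform (matrix_inv (mean W {a..<a + 2 * h})) (mean f {a..<a + 2 * h}))"
      unfolding G_def ah g_def sqK_def by (intro mult_left_mono bellman_le a2_cond_mean ab Q) simp
    also have "\<dots> = sqK TYPE('n) Q * ((a + 2 * h - a) * qform (matrix_inv (mean W {a..<a + 2 * h})) (mean f {a..<a + 2 * h}))"
      using ah by simp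
    also have "\<dots> \<le> sqK TYPE('n) Q * (LINT x:{a..<a + 2 * h}|lebesgue. qform (V x) (f x))"
      using sqK_pos by (intro mult_left_mono jensen_inv f_int e_int ab) auto
    finally show "G j k \<le> sqK TYPE('n) Q * (LINT x:dyi \<alpha> r j k|lebesgue. qform (V x) (f x))"
      unfolding ah .
    show "0 \<le> s j k"
      unfolding s_def ah using posdef_imp_psd[OF posdef_matrix_inv[OF posdef_mean_W[OF ab]]]
      by (simp add: psd_iff_qform)
  qed
  have step: "G j k + s j k \<le> G (j - 1) (2 * k) + G (j - 1) (2 * k + 1)" for j k
  proof -
    obtain a h where ah: "0 < h" "dyi \<alpha> r j k = {a..<a + 2 * h}"
      "dyi \<alpha> r (j - 1) (2 * k) = {a..<a + h}" "dyi \<alpha> r (j - 1) (2 * k + 1) = {a + h..<a + 2 * h}"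
      using dyi_split[OF r, of j \<alpha> k] by metis
    have m: "mean f {a..<a + 2 * h} = (1/2) *\<^sub>R (mean f {a + h..<a + 2 * h} + mean f {a..<a + h})"
      "mean W {a..<a + 2 * h} = (1/2) *\<^sub>R (mean W {a + h..<a + 2 * h} + mean W {a..<a + h})"
      "mean V {a..<a + 2 * h} = (1/2) *\<^sub>R (mean V {a + h..<a + 2 * h} + mean V {a..<a + h})"
      using mean_split[OF ah(1) f_int] mean_split[OF ah(1) W_set_integrable] mean_split[OF ah(1) V_set_integrable]
      by (simp_all add: add.commute)
    define d where "d = (1/2) *\<^sub>R (mean f {a + h..<a + 2 * h} - mean f {a..<a + h})"
    have "2 * g {a..<a + 2 * h} + 2 * qform (matrix_inv (mean W {a..<a + 2 * h})) d
        \<le> g {a + h..<a + 2 * h} + g {a..<a + h}"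
      unfolding g_def d_def using ah(1) by (intro bellman_step a2_cond_mean Q m) auto
    \<comment> \<open>Multiplication by the half-length gives the three values of \<open>g\<close>
      the lengths \<open>2 * h\<close>, \<open>h\<close> and \<open>h\<close> as weights; the gain
      becomes the form of the Haar coefficient, which is
      \<open>sqrt (2 * h) *\<^sub>R d\<close>.\<close>
    then have "h * (2 * g {a..<a + 2 * h} + 2 * qform (matrix_inv (mean W {a..<a + 2 * h})) d)
        \<le> h * (g {a + h..<a + 2 * h} + g {a..<a + h})"
      using ah(1) by (intro mult_left_mono) auto
    moreover have "haar_coeff f {a..<a + 2 * h} = sqrt (2 * h) *\<^sub>R d"
      by (simp add: d_def haar_coeff_Ico[OF ah(1) f_int])
    then have "s j k = 2 * h * qform (matrix_inv (mean W {a..<a + 2 * h})) d"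
      using ah(1) by (simp add: s_def ah(2) qform_scaleR_right)
    moreover have "G j k = 2 * h * g {a..<a + 2 * h}" "G (j - 1) (2 * k) = h * g {a..<a + h}"
      "G (j - 1) (2 * k + 1) = h * g {a + h..<a + 2 * h}"
      unfolding G_def ah using ah(1) by simp_all
    ultimately show ?thesis
      by (simp add: algebra_simps)
  qed
  \<comment> \<open>Each point lies in exactly one interval of a level, so Jensen's bounds for the
    single intervals add up to at most the full energy, uniformly in the level.\<close>
  have level: "(\<Sum>k\<in>A. G j k) \<le> sqK TYPE('n) Q * E" if A: "finite A" for j A
  proof -
    have "(\<Sum>k\<in>A. G j k) \<le> sqK TYPE('n) Q * (\<Sum>k\<in>A. LINT x:dyi \<alpha> r j k|lebesgue. qform (V x) (f x))"
      unfolding sum_distrib_left by (intro sum_mono G)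
    also have "(\<Sum>k\<in>A. LINT x:dyi \<alpha> r j k|lebesgue. qform (V x) (f x))
        = (LINT x|lebesgue. (\<Sum>k\<in>A. indicat_real (dyi \<alpha> r j k) x *\<^sub>R qform (V x) (f x)))"
      unfolding set_lebesgue_integral_def
      by (intro Bochner_Integration.integral_sum[symmetric])
        (use e_int in \<open>auto simp: set_integrable_def dyi_def\<close>)
    also have "\<dots> \<le> E"
      unfolding E_def
    proof (intro integral_mono_AE e)
      show "integrable lebesgue (\<lambda>x. \<Sum>k\<in>A. indicat_real (dyi \<alpha> r j k) x *\<^sub>R qform (V x) (f x))"
        by (intro Bochner_Integration.integrable_sum) (use e_int in \<open>auto simp: set_integrable_def dyi_def\<close>)
      show "AE x in lebesgue. (\<Sum>k\<in>A. indicat_real (dyi \<alpha> r j k) x *\<^sub>R qform (V x) (f x)) \<le> qform (V x) (f x)"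
        using e_nn
      proof eventually_elim
        case (elim x)
        have "(\<Sum>k\<in>A. indicat_real (dyi \<alpha> r j k) x *\<^sub>R qform (V x) (f x))
            = (\<Sum>k\<in>A. if dyn \<alpha> r j x = k then qform (V x) (f x) else 0)"
          by (intro sum.cong refl) (simp add: indicator_def dyi_iff[OF r])
        then show ?case
          using elim A by (simp add: sum.delta')
      qed
    qed
    finally show ?thesis
      using sqK_pos by simp
  qed
  obtain P where P: "finite P" "F = (\<lambda>(j, k). dyi \<alpha> r j k) ` P"
    using finite_subset_image[OF F(1), of "\<lambda>(j, k). dyi \<alpha> r j k" UNIV] F(2)
    by (auto simp: dyadic_grid_eq[OF r])
  have "(\<Sum>I\<in>F. qform (matrix_inv (mean W I)) (haar_coeff f I)) \<le> (\<Sum>(j, k)\<in>P. s j k)"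
    unfolding P(2) by (rule order_trans[OF sum_image_le]) (use P(1) s in \<open>auto simp: s_def case_prod_beta intro!: sum_mono\<close>)
  also have "\<dots> \<le> sqK TYPE('n) Q * E"
    by (rule dyadic_family_sum[of G s, OF step s G(1) level P(1)])
  finally show ?thesis
    by (simp add: E_def)
qed

lemma square_function_upper:
  fixes f :: "real \<Rightarrow> complex^'n"
  assumes r: "0 < r" and F: "finite F" "F \<subseteq> dyadic_grid \<alpha> r"
    and f: "f \<in> borel_measurable lebesgue" and e: "integrable lebesgue (\<lambda>x. qform (W x) (f x))"
  shows "(\<Sum>I\<in>F. qform (mean W I) (haar_coeff f I))
    \<le> Q * sqK TYPE('n) Q * energy f"
proof -
  interpret sw: a2_pair V W Q
    by (rule swap)
  have "(\<Sum>I\<in>F. qform (mean W I) (haar_coeff f I)) \<le> (\<Sum>I\<in>F. Q * qform (matrix_inv (mean V I)) (haar_coeff f I))"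
  proof (intro sum_mono)
    fix I
    assume "I \<in> F"
    then obtain a h where "0 < h" "I = {a..<a + 2 * h}"
      using F dyadic_grid_Ico[OF r] by blast
    then show "qform (mean W I) (haar_coeff f I) \<le> Q * qform (matrix_inv (mean V I)) (haar_coeff f I)"
      by (simp add: a2)
  qed
  also have "\<dots> \<le> Q * (sqK TYPE('n) Q * energy f)"
    unfolding sum_distrib_left[symmetric]
    using Q by (intro mult_left_mono sw.square_function_inv[OF r F f e]) auto
  finally show ?thesis
    by simp
qed

section \<open>The weighted space and its energy\<close>

lemma energy_nonneg: "0 \<le> energy f"
proof (rule integral_nonneg_AE)
  show "AE x in lebesgue. 0 \<le> qform (W x) (f x)"
    using AE_posdef_W by eventually_elim (use posdef_imp_psd psd_iff_qform in blast)
qed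

lemma L2W_iff:
  "f \<in> L2W W \<longleftrightarrow> f \<in> borel_measurable lebesgue \<and> integrable lebesgue (\<lambda>x. qform (W x) (f x))"
  by (simp add: L2W_def Re_cinner qform_def)

lemma L2W_norm_eq: "(L2W_norm W f)\<^sup>2 = energy f"
  using energy_nonneg[of f] by (simp add: L2W_norm_def Re_cinner flip: qform_def)

text \<open>The factor 2 stands in for the triangle inequality. Working with squared norms this way
  costs only a numerical constant in the final estimate.\<close>

lemma L2W_add:
  assumes "f \<in> L2W W" "g \<in> L2W W"
  shows "(\<lambda>x. f x + g x) \<in> L2W W"
    "energy (\<lambda>x. f x + g x)
      \<le> 2 * energy f + 2 * energy g"
proof -
  have i: "integrable lebesgue (\<lambda>x. 2 * qform (W x) (f x) + 2 * qform (W x) (g x))"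
    using assms by (simp add: L2W_iff)
  have m: "(\<lambda>x. f x + g x) \<in> borel_measurable lebesgue"
    using assms by (intro borel_measurable_add) (auto simp: L2W_iff)
  have j: "integrable lebesgue (\<lambda>x. qform (W x) (f x + g x))"
  proof (rule Bochner_Integration.integrable_bound[OF i])
    show "AE x in lebesgue. norm (qform (W x) (f x + g x)) \<le> norm (2 * qform (W x) (f x) + 2 * qform (W x) (g x))"
      using AE_posdef_W
    proof eventually_elim
      case (elim x)
      then have "psd (W x)"
        by (rule posdef_imp_psd)
      then show ?case
        using qform_add_le[of "W x" "f x" "g x"] by (auto simp: psd_iff_qform)
    qed
  qed (intro qform_measurable W_measurable m)
  with m show "(\<lambda>x. f x + g x) \<in> L2W W"
    by (simp add: L2W_iff)
  have "energy (\<lambda>x. f x + g x) \<le> (LINT x|lebesgue. 2 * qform (W x) (f x) + 2 * qform (W x) (g x))"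
    using AE_posdef_W by (intro integral_mono_AE i j) (auto elim!: eventually_mono intro!: qform_add_le posdef_imp_psd)
  also have "\<dots> = 2 * energy f + 2 * energy g"
    using assms by (subst Bochner_Integration.integral_add) (auto simp: L2W_iff)
  finally show "energy (\<lambda>x. f x + g x)
      \<le> 2 * energy f + 2 * energy g" .
qed

lemma L2W_smult:
  assumes "f \<in> L2W W"
  shows "(\<lambda>x. c *s f x) \<in> L2W W"
    "energy (\<lambda>x. c *s f x) = (cmod c)\<^sup>2 * energy f"
proof -
  have "(\<lambda>x. c *s f x) = (\<lambda>x. mat c *v f x)"
    by (auto simp: vec_eq_iff mat_def matrix_vector_mult_def if_distrib[of "\<lambda>c. c * _"] cong: if_cong)
  then have "(\<lambda>x. c *s f x) \<in> borel_measurable lebesgue"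
    using assms by (simp add: L2W_iff mv_measurable)
  then show "(\<lambda>x. c *s f x) \<in> L2W W"
    using assms by (simp add: L2W_iff qform_smult_right)
qed (simp add: qform_smult_right)

lemma L2W_diff:
  assumes "f \<in> L2W W" "g \<in> L2W W"
  shows "(\<lambda>x. f x - g x) \<in> L2W W"
    "energy (\<lambda>x. f x - g x)
      \<le> 2 * energy f + 2 * energy g"
  using L2W_add[OF assms(1) L2W_smult(1)[OF assms(2), of "-1"]] L2W_smult(2)[OF assms(2), of "-1"]
  by simp_all

lemma L2W_0: "(\<lambda>_. 0) \<in> L2W W"
  by (simp add: L2W_iff)

lemma L2W_sum: "finite F \<Longrightarrow> (\<And>I. I \<in> F \<Longrightarrow> f I \<in> L2W W) \<Longrightarrow> (\<lambda>x. \<Sum>I\<in>F. f I x) \<in> L2W W"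
  by (induction F rule: finite_induct) (auto intro: L2W_0 L2W_add)

text \<open>The square of a Haar function is the normalized indicator of its interval, so its energy
  is a form of the averaged weight.\<close>

lemma haar_L2W:
  assumes h: "0 < h"
  shows "(\<lambda>x. haar {a..<a + 2 * h} x *\<^sub>R c) \<in> L2W W"
    "energy (\<lambda>x. haar {a..<a + 2 * h} x *\<^sub>R c) = qform (mean W {a..<a + 2 * h}) c"
proof -
  have eq: "qform (W x) (haar {a..<a + 2 * h} x *\<^sub>R c)
      = (1 / (2 * h)) *\<^sub>R (indicat_real {a..<a + 2 * h} x *\<^sub>R qform (W x) c)" for x
    by (simp add: qform_scaleR_right haar_sq[OF h])
  have i: "set_integrable lebesgue {a..<a + 2 * h} (\<lambda>x. qform (W x) c)"
    "(LINT x:{a..<a + 2 * h}|lebesgue. qform (W x) c) = qform (LINT x:{a..<a + 2 * h}|lebesgue. W x) c"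
    by (rule set_integral_linear[OF linear_qform W_set_integrable])+
  have "(\<lambda>x. haar {a..<a + 2 * h} x *\<^sub>R c) \<in> borel_measurable lebesgue"
    by (intro borel_measurable_scaleR haar_measurable h borel_measurable_const)
  then show "(\<lambda>x. haar {a..<a + 2 * h} x *\<^sub>R c) \<in> L2W W"
    unfolding L2W_iff eq using i(1) by (simp add: set_integrable_def)
  show "energy (\<lambda>x. haar {a..<a + 2 * h} x *\<^sub>R c) = qform (mean W {a..<a + 2 * h}) c"
    unfolding eq using i(2) h by (simp add: mean_def qform_scaleR set_lebesgue_integral_def)
qed

lemma haar_sum_L2W:
  assumes r: "0 < r" and F: "finite F" "F \<subseteq> dyadic_grid \<alpha> r"
  shows "(\<lambda>x. \<Sum>I\<in>F. haar I x *\<^sub>R c I) \<in> L2W W"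
proof (intro L2W_sum F)
  fix I
  assume "I \<in> F"
  then obtain a h where "0 < h" "I = {a..<a + 2 * h}"
    using F dyadic_grid_Ico[OF r] by blast
  then show "(\<lambda>x. haar I x *\<^sub>R c I) \<in> L2W W"
    by (simp add: haar_L2W)
qed

text \<open>Duality: the energy of \<open>g\<close> is the pairing of \<open>g\<close> with W g,
  hence a sum over coefficients. The Legendre-type inequality splits it into the square function of
  W g, which is bounded by the energy itself and can be absorbed, and the sum on the right.\<close>

lemma square_function_lower:
  fixes c :: "real set \<Rightarrow> complex^'n"
  assumes r: "0 < r" and F: "finite F" "F \<subseteq> dyadic_grid \<alpha> r"
  defines "g \<equiv> \<lambda>x. \<Sum>I\<in>F. haar I x *\<^sub>R c I"
  shows "energy g \<le> sqK TYPE('n) Q * (\<Sum>I\<in>F. qform (mean W I) (c I))"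
proof -
  interpret sw: a2_pair V W Q
    by (rule swap)
  define K where "K = sqK TYPE('n) Q"
  have K: "0 < K"
    by (simp add: K_def sqK_pos)
  have g: "g \<in> borel_measurable lebesgue" "integrable lebesgue (\<lambda>x. qform (W x) (g x))"
    using haar_sum_L2W[OF r F] by (auto simp: g_def L2W_iff)
  \<comment> \<open>The dual function of \<open>g\<close>: its energy with respect to
    \<open>V\<close> equals the energy of \<open>g\<close> with respect to \<open>W\<close>.\<close>
  define u where "u x = W x *v g x" for x
  have u: "u \<in> borel_measurable lebesgue"
    unfolding u_def[abs_def] by (intro mv_measurable W_measurable g)
  have ae: "AE x in lebesgue. qform (V x) (u x) = qform (W x) (g x)"
    using AE_posdef
    by eventually_elim (simp add: u_def qform_def mv_matrix_inv posdef_invertible inner_commute)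
  have m: "(\<lambda>x. qform (V x) (u x)) \<in> borel_measurable lebesgue" "(\<lambda>x. qform (W x) (g x)) \<in> borel_measurable lebesgue"
    by (intro qform_measurable V_measurable W_measurable u g)+
  have ue: "integrable lebesgue (\<lambda>x. qform (V x) (u x))"
    using integrable_cong_AE[OF m ae] g by simp
  have uE: "(LINT x|lebesgue. qform (V x) (u x)) = energy g"
    by (rule integral_cong_AE[OF m ae])
  define E where "E = energy g"
  have F_Ico: "\<exists>a h. 0 < h \<and> I = {a..<a + 2 * h}" if "I \<in> F" for I
    using that F dyadic_grid_Ico[OF r] by (metis subsetD)
  have hc: "integrable lebesgue (\<lambda>x. (haar I x *\<^sub>R u x) \<bullet> c I)"
    "(LINT x|lebesgue. (haar I x *\<^sub>R u x) \<bullet> c I) = haar_coeff u I \<bullet> c I" if "I \<in> F" for I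
  proof -
    from F_Ico[OF that] obtain a h where ah: "0 < h" "I = {a..<a + 2 * h}"
      by blast
    have *: "integrable lebesgue (\<lambda>x. haar I x *\<^sub>R u x)"
      unfolding ah by (intro haar_coeff_integrable ah sw.finite_energy_set_integrable u ue)
    show "integrable lebesgue (\<lambda>x. (haar I x *\<^sub>R u x) \<bullet> c I)"
      using * by (rule integrable_inner_left)
    show "(LINT x|lebesgue. (haar I x *\<^sub>R u x) \<bullet> c I) = haar_coeff u I \<bullet> c I"
      using integral_inner_left[OF *, of "c I"] haar_coeff_eq[OF ah(1), of u a] by (simp add: ah(2))
  qed
  have "E = (LINT x|lebesgue. (\<Sum>I\<in>F. (haar I x *\<^sub>R u x) \<bullet> c I))"
    unfolding E_def
    by (intro Bochner_Integration.integral_cong refl)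
      (simp add: qform_def u_def[symmetric], simp add: g_def inner_sum_right)
  also have "\<dots> = (\<Sum>I\<in>F. LINT x|lebesgue. (haar I x *\<^sub>R u x) \<bullet> c I)"
    by (intro Bochner_Integration.integral_sum hc)
  also have "\<dots> = (\<Sum>I\<in>F. haar_coeff u I \<bullet> c I)"
    by (intro sum.cong refl hc)
  finally have E: "E = (\<Sum>I\<in>F. haar_coeff u I \<bullet> c I)" .
  \<comment> \<open>The test vector is scaled by \<open>K\<close> so that the square function of
    \<open>u\<close>, at most \<open>K * E\<close>, takes up exactly half of the left side.\<close>
  have "2 * K * E \<le> (\<Sum>I\<in>F. qform (matrix_inv (mean W I)) (haar_coeff u I) + K\<^sup>2 * qform (mean W I) (c I))"
    unfolding E sum_distrib_left
  proof (intro sum_mono)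
    fix I
    assume "I \<in> F"
    then obtain a h where ah: "0 < h" "I = {a..<a + 2 * h}"
      using F_Ico by blast
    have "posdef (mean W I)"
      unfolding ah using ah by (intro posdef_mean_W) simp
    from qform_inv_ge[OF this, of "haar_coeff u I" "K *\<^sub>R c I"]
    show "2 * K * (haar_coeff u I \<bullet> c I)
        \<le> qform (matrix_inv (mean W I)) (haar_coeff u I) + K\<^sup>2 * qform (mean W I) (c I)"
      by (simp add: qform_scaleR_right)
  qed
  also have "\<dots> = (\<Sum>I\<in>F. qform (matrix_inv (mean W I)) (haar_coeff u I)) + K\<^sup>2 * (\<Sum>I\<in>F. qform (mean W I) (c I))"
    by (simp add: sum.distrib sum_distrib_left)
  also have "\<dots> \<le> K * E + K\<^sup>2 * (\<Sum>I\<in>F. qform (mean W I) (c I))"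
    using square_function_inv[OF r F u ue] by (simp add: uE E_def K_def)
  finally have "K * E \<le> K * (K * (\<Sum>I\<in>F. qform (mean W I) (c I)))"
    by (simp add: power2_eq_square mult_ac)
  then show ?thesis
    using K by (simp add: E_def K_def)
qed

end

section \<open>Completeness and density\<close>

lemma dyi_subset_or_disjoint:
  assumes "0 < r" "j \<le> j'"
  shows "dyi \<alpha> r j k \<subseteq> dyi \<alpha> r j' k' \<or> dyi \<alpha> r j k \<inter> dyi \<alpha> r j' k' = {}"
  using dyn_coarsen[OF assms] by (auto simp: dyi_iff[OF assms(1)])

lemma dyi_Int:
  assumes "0 < r"
  shows "dyi \<alpha> r j k \<inter> dyi \<alpha> r j' k' \<in> insert {} (range (\<lambda>(j, k). dyi \<alpha> r j k))"
proof -
  have "dyi \<alpha> r j k \<inter> dyi \<alpha> r j' k' = {} \<or> dyi \<alpha> r j k \<inter> dyi \<alpha> r j' k' = dyi \<alpha> r j k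
    \<or> dyi \<alpha> r j k \<inter> dyi \<alpha> r j' k' = dyi \<alpha> r j' k'"
    using dyi_subset_or_disjoint[OF assms, of j j' \<alpha> k k'] dyi_subset_or_disjoint[OF assms, of j' j \<alpha> k' k]
    by (cases "j \<le> j'") (auto simp: Int_absorb1 Int_absorb2 Int_commute)
  then show ?thesis
    by (elim disjE) (simp_all, (blast intro: rangeI[of "\<lambda>(j, k). dyi \<alpha> r j k" "(j, k)" for j k, simplified])+)
qed

text \<open>Around each point of an open set a sufficiently short interval of the grid stays inside,
  and the grid is countable.\<close>

lemma open_sigma_dyadic:
  assumes r: "0 < r" and S: "open S"
  shows "S \<in> sigma_sets UNIV (insert {} (range (\<lambda>(j, k). dyi \<alpha> r j k)))"
proof -
  define G where "G = insert {} (range (\<lambda>(j, k). dyi \<alpha> r j k))"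
  have "S = \<Union>{I \<in> G. I \<subseteq> S}"
  proof (intro equalityI subsetI)
    fix x
    assume x: "x \<in> S"
    obtain e where e: "0 < e" "ball x e \<subseteq> S"
      using S x openE by blast
    obtain n where n: "r * (1 / 2) ^ n < e"
    proof -
      obtain n where "(1 / 2) ^ n < e / r"
        using real_arch_pow_inv[of "e / r" "1 / 2"] e r by auto
      then show ?thesis
        using that[of n] r by (simp add: field_simps)
    qed
    define I where "I = dyi \<alpha> r (- int n) (dyn \<alpha> r (- int n) x)"
    have xI: "x \<in> I"
      by (simp add: I_def dyi_iff[OF r])
    define a where "a = \<alpha> + r * (of_int (dyn \<alpha> r (- int n) x) * 2 powi (- int n))"
    have a: "I = {a..<a + r * (1 / 2) ^ n}"
      by (simp add: a_def I_def dyi_def algebra_simps power_int_minus power_one_over inverse_eq_divide)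
    have "I \<subseteq> ball x e"
      using xI n unfolding a by (auto simp: dist_real_def)
    then have "I \<in> {I \<in> G. I \<subseteq> S}"
      using e by (auto simp: G_def I_def)
    with xI show "x \<in> \<Union>{I \<in> G. I \<subseteq> S}"
      by blast
  qed auto
  moreover have "\<Union>{I \<in> G. I \<subseteq> S} \<in> sigma_sets UNIV G"
    by (intro sigma_sets_UNION countable_subset[of "{I \<in> G. I \<subseteq> S}" G]) (auto simp: G_def)
  ultimately show ?thesis
    by (simp add: G_def)
qed

lemma sigma_finite_lebesgue: "sigma_finite_measure (lebesgue :: real measure)"
proof
  have "(\<Union>n. {- real n..real n}) = (UNIV :: real set)"
  proof (intro equalityI subsetI)
    fix x :: real
    obtain n where "\<bar>x\<bar> \<le> real n"
      using real_arch_simple by blast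
    then have "x \<in> {- real n..real n}"
      by auto
    then show "x \<in> (\<Union>n. {- real n..real n})"
      by blast
  qed auto
  then show "\<exists>A::real set set. countable A \<and> A \<subseteq> sets lebesgue \<and> \<Union>A = space lebesgue \<and> (\<forall>a\<in>A. emeasure lebesgue a \<noteq> \<infinity>)"
    by (intro exI[of _ "range (\<lambda>n. {- real n..real n})"]) auto
qed

text \<open>The intervals of the grid, with the empty set, are stable under intersection and
  generate the Borel sets. As \<open>h\<close> is only locally integrable, Dynkin's argument is run
  inside one interval \<open>T\<close> of level 0 at a time; countably many of these cover the
  line.\<close>

lemma AE_zero_of_dyadic:
  fixes h :: "real \<Rightarrow> 'a::euclidean_space"
  assumes r: "0 < r" and int: "\<And>j k. set_integrable lebesgue (dyi \<alpha> r j k) h"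
    and zero: "\<And>j k. (LINT x:dyi \<alpha> r j k|lebesgue. h x) = 0"
  shows "AE x in lebesgue. h x = 0"
proof -
  define G where "G = insert {} (range (\<lambda>(j, k). dyi \<alpha> r j k))"
  have G_int: "(LINT x:I|lebesgue. h x) = 0" if "I \<in> G" for I
    using that zero by (auto simp: G_def set_lebesgue_integral_def)
  have borel: "sets borel \<subseteq> sigma_sets UNIV G"
    unfolding sets_borel using open_sigma_dyadic[OF r] by (intro sigma_sets_mono) (auto simp: G_def)
  have G_borel: "sigma_sets UNIV G \<subseteq> sets borel"
  proof -
    have "G \<subseteq> sets borel"
      by (auto simp: G_def dyi_def)
    from sets.sigma_sets_subset[OF this] show ?thesis
      by simp
  qed
  have G_Pow: "G \<subseteq> Pow UNIV"
    by simp
  have stable: "Int_stable G"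
    using dyi_Int[OF r] by (auto simp: Int_stable_def G_def)
  have T_zero: "AE x in lebesgue. indicat_real (dyi \<alpha> r 0 k) x *\<^sub>R h x = 0" for k
  proof -
    define T where "T = dyi \<alpha> r 0 k"
    have T: "T \<in> G" "T \<in> sets lebesgue" "set_integrable lebesgue T h"
      unfolding T_def by (auto simp: G_def, simp add: dyi_def, rule int)
    have sub: "set_integrable lebesgue (A \<inter> T) h" if "A \<in> sets lebesgue" for A
      using T that by (intro set_integrable_subset[OF T(3)]) auto
    have "(LINT x:A \<inter> T|lebesgue. h x) = 0" if "A \<in> sigma_sets UNIV G" for A
      using stable G_Pow that
    proof (induction A rule: sigma_sets_induct_disjoint)
      case (basic A)
      then have "A \<inter> T \<in> G"
        using stable T by (auto simp: Int_stable_def)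
      then show ?case
        by (rule G_int)
    next
      case empty
      show ?case
        by (simp add: set_lebesgue_integral_def)
    next
      case (compl A)
      have A: "A \<in> sets lebesgue"
        using compl G_borel by auto
      have "(LINT x:T|lebesgue. h x) = (LINT x:(A \<inter> T) \<union> ((UNIV - A) \<inter> T)|lebesgue. h x)"
        by (rule arg_cong[where f="\<lambda>S. LINT x:S|lebesgue. h x"]) auto
      also have "\<dots> = (LINT x:A \<inter> T|lebesgue. h x) + (LINT x:(UNIV - A) \<inter> T|lebesgue. h x)"
        using A by (intro set_integral_Un sub) auto
      finally show ?case
        using G_int[OF T(1)] compl by simp
    next
      case (union A)
      have A: "A i \<in> sets lebesgue" for i
      proof -
        have "A i \<in> sets borel"
          using union(2) G_borel by blast
        then show ?thesis
          by simp
      qed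
      have UT: "(\<Union>i. A i \<inter> T) = (\<Union>i. A i) \<inter> T"
        by blast
      have "(LINT x:(\<Union>i. A i \<inter> T)|lebesgue. h x) = (\<Sum>i. LINT x:A i \<inter> T|lebesgue. h x)"
      proof (rule lebesgue_integral_countable_add)
        show "set_integrable lebesgue (\<Union>i. A i \<inter> T) h"
          unfolding UT using A by (intro sub sets.countable_UN) auto
        show "A i \<inter> T \<in> sets lebesgue" for i
          using A T by (intro sets.Int)
        show "A i \<inter> T \<inter> (A j \<inter> T) = {}" if "i \<noteq> j" for i j
          using union(1) that unfolding disjoint_family_on_def by blast
      qed
      then show ?case
        by (simp add: union(3) UT)
    qed
    then have borel_zero: "(LINT x:A \<inter> T|lebesgue. h x) = 0" if "A \<in> sets borel" for A
      using that borel by blast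
    have "AE x in lebesgue. indicat_real T x *\<^sub>R h x = 0"
    proof (rule sigma_finite_measure.density_unique_banach[OF sigma_finite_lebesgue])
      show "integrable lebesgue (\<lambda>x. indicat_real T x *\<^sub>R h x)"
        using T by (simp add: set_integrable_def)
      fix A :: "real set"
      assume "A \<in> sets lebesgue"
      \<comment> \<open>A Lebesgue set is a Borel set up to a null set, so the Borel case
        suffices.\<close>
      then obtain S N N' where A: "A = S \<union> N" "N \<subseteq> N'" "N' \<in> null_sets lborel" "S \<in> sets lborel"
        by (rule sets_completionE)
      have "(LINT x:A|lebesgue. indicat_real T x *\<^sub>R h x) = (LINT x:S \<inter> T|lebesgue. h x)"
        unfolding set_lebesgue_integral_def
      proof (rule integral_cong_AE)
        have "N' \<in> null_sets lebesgue"
          using A(3) by (simp add: null_sets_completionI)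
        then have "AE x in lebesgue. x \<notin> N'"
          by (rule AE_not_in)
        then show "AE x in lebesgue. indicat_real A x *\<^sub>R indicat_real T x *\<^sub>R h x = indicat_real (S \<inter> T) x *\<^sub>R h x"
          by eventually_elim (use A(1,2) in \<open>auto simp: indicator_def\<close>)
        show "(\<lambda>x. indicat_real A x *\<^sub>R indicat_real T x *\<^sub>R h x) \<in> borel_measurable lebesgue"
          using integrable_mult_indicator[OF \<open>A \<in> sets lebesgue\<close> T(3)[unfolded set_integrable_def]]
          by (rule borel_measurable_integrable)
        show "(\<lambda>x. indicat_real (S \<inter> T) x *\<^sub>R h x) \<in> borel_measurable lebesgue"
          using sub[of S] A(4) unfolding set_integrable_def by (intro borel_measurable_integrable) auto
      qed
      then show "(LINT x:A|lebesgue. indicat_real T x *\<^sub>R h x) = (LINT x:A|lebesgue. 0)"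
        using borel_zero[of S] A(4) by (simp add: set_lebesgue_integral_def)
    qed simp
    then show ?thesis
      by (simp add: T_def)
  qed
  then have "AE x in lebesgue. \<forall>k. indicat_real (dyi \<alpha> r 0 k) x *\<^sub>R h x = 0"
    unfolding AE_all_countable by blast
  then show ?thesis
  proof eventually_elim
    case (elim x)
    from elim[rule_format, of "dyn \<alpha> r 0 x"] show ?case
      by (simp add: indicator_def dyi_iff[OF r])
  qed
qed

section \<open>Completeness of the weighted space\<close>

lemma posdef_coercive:
  assumes "posdef A"
  shows "\<exists>c>0. \<forall>v. (norm v)\<^sup>2 \<le> c * qform A v"
proof -
  define S where "S = mat_sqrt A"
  define R where "R = matrix_inv S"
  obtain M where M: "M > 0" "\<And>x. norm (R *v x) \<le> norm x * M"
    using bounded_linear.pos_bounded[OF linear_conv_bounded_linear[THEN iffD1, OF linear_mv_right[of R]]]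
    by auto
  have "(norm v)\<^sup>2 \<le> M\<^sup>2 * qform A v" for v
  proof -
    have "norm v \<le> norm (S *v v) * M"
      using M(2)[of "S *v v"] assms by (simp add: R_def S_def mv_matrix_inv invertible_mat_sqrt)
    then have "(norm v)\<^sup>2 \<le> (norm (S *v v) * M)\<^sup>2"
      by (intro power_mono) auto
    then show ?thesis
      using assms by (simp add: S_def qform_mat_sqrt posdef_imp_psd power_mult_distrib mult.commute)
  qed
  then show ?thesis
    using M(1) by (intro exI[of _ "M\<^sup>2"]) auto
qed

lemma continuous_on_qform: "continuous_on UNIV (qform A)"
  unfolding qform_def[abs_def]
  by (intro continuous_on_inner linear_continuous_on_euclidean linear_mv_right continuous_on_id)

lemma convergent_of_weighted_increments:
  fixes v :: "nat \<Rightarrow> 'a::banach"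
  assumes "\<And>k. (norm (v (Suc k) - v k))\<^sup>2 \<le> c / 2 ^ k"
  shows "convergent v"
proof -
  have c: "0 \<le> c"
    using order_trans[OF zero_le_power2 assms[of 0]] by simp
  have "norm (v (Suc k) - v k) \<le> sqrt c * (1 / sqrt 2) ^ k" for k
  proof -
    have "norm (v (Suc k) - v k) \<le> sqrt (c / 2 ^ k)"
      using assms by (rule real_le_rsqrt)
    then show ?thesis
      by (simp add: real_sqrt_divide real_sqrt_power power_one_over)
  qed
  moreover have "summable (\<lambda>k. sqrt c * (1 / sqrt 2) ^ k)"
    by (intro summable_mult summable_geometric) simp
  ultimately have "summable (\<lambda>k. v (Suc k) - v k)"
    by (rule summable_comparison_test'[rotated])
  then have "convergent (\<lambda>n. \<Sum>k<n. v (Suc k) - v k)"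
    by (simp add: summable_iff_convergent)
  then have "convergent (\<lambda>n. v n - v 0)"
    by (simp add: sum_lessThan_telescope)
  then show ?thesis
    using convergent_add[OF _ convergent_const[of "v 0"], of "\<lambda>n. v n - v 0"] by simp
qed

context a2_pair
begin

lemma AE_qform_nonneg: "AE x in lebesgue. \<forall>v. 0 \<le> qform (W x) v"
  using AE_posdef_W by eventually_elim (use posdef_imp_psd psd_iff_qform in blast)

lemma nn_energy:
  assumes "f \<in> L2W W"
  shows "(\<integral>\<^sup>+x. ennreal (qform (W x) (f x)) \<partial>lebesgue) = ennreal (energy f)"
  using assms by (intro nn_integral_eq_integral) (auto simp: L2W_iff intro: AE_mp[OF AE_qform_nonneg])

text \<open>Riesz-Fischer without a uniform lower bound on the weight: at almost every point
  \<open>W x\<close> is coercive with a constant of its own, which is enough for pointwise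
  convergence.\<close>

lemma L2W_complete_fast:
  assumes v: "\<And>k. v k \<in> L2W W" and fast: "\<And>k. energy (\<lambda>x. v (Suc k) x - v k x) \<le> (1/4) ^ k"
  shows "\<exists>g. g \<in> borel_measurable lebesgue \<and> (AE x in lebesgue. (\<lambda>k. v k x) \<longlonglongrightarrow> g x)"
proof (intro exI conjI)
  define d where "d k x = v (Suc k) x - v k x" for k x
  have d: "d k \<in> L2W W" for k
    unfolding d_def[abs_def] by (intro L2W_diff v)
  show "(\<lambda>x. lim (\<lambda>k. v k x)) \<in> borel_measurable lebesgue"
    using v by (intro borel_measurable_lim_metric) (auto simp: L2W_iff)
  \<comment> \<open>The weight 2^k leaves energies (1/2)^k, which are still summable, and makes the
    pointwise increments decay geometrically.\<close>
  define q where "q k x = 2 ^ k * qform (W x) (d k x)" for k x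
  have q_meas: "q k \<in> borel_measurable lebesgue" for k
    unfolding q_def using d[of k] by (intro borel_measurable_times borel_measurable_const qform_measurable W_measurable)
      (auto simp: L2W_iff)
  have "(\<integral>\<^sup>+x. (\<Sum>k. ennreal (q k x)) \<partial>lebesgue) = (\<Sum>k. \<integral>\<^sup>+x. ennreal (q k x) \<partial>lebesgue)"
    using q_meas by (intro nn_integral_suminf) auto
  also have "\<dots> \<le> (\<Sum>k. ennreal ((1/2) ^ k))"
  proof (intro suminf_le summableI)
    fix k
    have "(\<integral>\<^sup>+x. ennreal (q k x) \<partial>lebesgue) = ennreal (LINT x|lebesgue. q k x)"
      using d[of k] unfolding q_def
      by (intro nn_integral_eq_integral) (auto simp: L2W_iff intro: AE_mp[OF AE_qform_nonneg])
    also have "(LINT x|lebesgue. q k x) = 2 ^ k * energy (d k)"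
      by (simp add: q_def)
    also have "\<dots> \<le> 2 ^ k * (1/4) ^ k"
      using fast[of k] by (intro mult_left_mono) (auto simp: d_def)
    also have "2 ^ k * (1/4) ^ k = (1/2 :: real) ^ k"
      by (simp flip: power_mult_distrib)
    finally show "(\<integral>\<^sup>+x. ennreal (q k x) \<partial>lebesgue) \<le> ennreal ((1/2) ^ k)"
      by (simp add: ennreal_leI)
  qed
  also have "\<dots> = ennreal (\<Sum>k. (1/2) ^ k)"
    by (intro suminf_ennreal2 summable_geometric) auto
  also have "\<dots> < \<infinity>"
    by simp
  finally have "AE x in lebesgue. (\<Sum>k. ennreal (q k x)) \<noteq> \<infinity>"
    using q_meas by (intro nn_integral_noteq_infinite) auto
  then show "AE x in lebesgue. (\<lambda>k. v k x) \<longlonglongrightarrow> lim (\<lambda>k. v k x)"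
    using AE_posdef_W AE_qform_nonneg
  proof eventually_elim
    case (elim x)
    obtain m where m: "0 \<le> m" "(\<Sum>k. ennreal (q k x)) = ennreal m"
      using elim(1) by (metis ennreal_cases infinity_ennreal_def)
    have qm: "q k x \<le> m" for k
    proof -
      have "ennreal (q k x) \<le> ennreal m"
        unfolding m(2)[symmetric] using sum_le_suminf[OF summableI, of "{k}" "\<lambda>k. ennreal (q k x)"] by simp
      then show ?thesis
        using m(1) by (simp add: ennreal_le_iff)
    qed
    obtain c where c: "0 < c" "\<And>v. (norm v)\<^sup>2 \<le> c * qform (W x) v"
      using posdef_coercive elim(2) by blast
    have "(norm (v (Suc k) x - v k x))\<^sup>2 \<le> (c * m) / 2 ^ k" for k
    proof -
      have "(norm (d k x))\<^sup>2 \<le> c * qform (W x) (d k x)"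
        by (rule c)
      also have "\<dots> = c * q k x / 2 ^ k"
        by (simp add: q_def)
      also have "\<dots> \<le> (c * m) / 2 ^ k"
        using c(1) qm by (intro divide_right_mono mult_left_mono) auto
      finally show ?thesis
        by (simp add: d_def)
    qed
    from convergent_of_weighted_increments[of "\<lambda>k. v k x", OF this] show ?case
      unfolding convergent_LIMSEQ_iff .
  qed
qed

text \<open>A rapidly convergent subsequence provides the pointwise limit; Fatou's lemma along it
  controls the distance of the whole sequence from that limit.\<close>

lemma L2W_complete:
  assumes u: "\<And>n. u n \<in> L2W W"
    and cauchy: "\<And>e. 0 < e \<Longrightarrow> \<exists>M. \<forall>m\<ge>M. \<forall>n\<ge>M. energy (\<lambda>x. u m x - u n x) \<le> e"
  obtains g where "g \<in> L2W W" "(\<lambda>n. energy (\<lambda>x. u n x - g x)) \<longlonglongrightarrow> 0"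
proof -
  have "\<forall>k. \<exists>M. \<forall>m\<ge>M. \<forall>n\<ge>M. energy (\<lambda>x. u m x - u n x) \<le> (1/4) ^ k"
    using cauchy by simp
  then obtain M where M: "\<And>k m n. M k \<le> m \<Longrightarrow> M k \<le> n \<Longrightarrow> energy (\<lambda>x. u m x - u n x) \<le> (1/4) ^ k"
    by metis
  \<comment> \<open>The sum keeps \<open>s k\<close> and \<open>s (Suc k)\<close> beyond the
    threshold \<open>M k\<close>, and the summand \<open>k\<close> makes \<open>s\<close>
    unbounded.\<close>
  define s where "s k = k + (\<Sum>i\<le>k. M i)" for k
  have sM: "M k \<le> s k" "M k \<le> s (Suc k)" "k \<le> s k" for k
    using member_le_sum[of k "{..k}" M] by (auto simp: s_def)
  have "energy (\<lambda>x. u (s (Suc k)) x - u (s k) x) \<le> (1/4) ^ k" for k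
    by (rule M[OF sM(2) sM(1)])
  from L2W_complete_fast[of "\<lambda>k. u (s k)", OF u this]
  obtain g where g: "g \<in> borel_measurable lebesgue" "AE x in lebesgue. (\<lambda>k. u (s k) x) \<longlonglongrightarrow> g x"
    by blast
  have fatou: "(\<integral>\<^sup>+x. ennreal (qform (W x) (u n x - g x)) \<partial>lebesgue) \<le> ennreal e"
    if e: "0 < e" and N: "\<And>m n. N \<le> m \<Longrightarrow> N \<le> n \<Longrightarrow> energy (\<lambda>x. u m x - u n x) \<le> e" and n: "N \<le> n"
    for N n e
  proof -
    have "(\<integral>\<^sup>+x. ennreal (qform (W x) (u n x - g x)) \<partial>lebesgue)
        = (\<integral>\<^sup>+x. liminf (\<lambda>k. ennreal (qform (W x) (u n x - u (s k) x))) \<partial>lebesgue)"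
    proof (rule nn_integral_cong_AE)
      show "AE x in lebesgue. ennreal (qform (W x) (u n x - g x))
          = liminf (\<lambda>k. ennreal (qform (W x) (u n x - u (s k) x)))"
        using g(2)
      proof eventually_elim
        case (elim x)
        have "continuous_on UNIV (\<lambda>v. qform (W x) (u n x - v))"
          by (rule continuous_on_compose2[OF continuous_on_qform]) (auto intro!: continuous_on_diff continuous_on_const continuous_on_id)
        then have "isCont (\<lambda>v. qform (W x) (u n x - v)) (g x)"
          by (simp add: continuous_on_eq_continuous_at)
        from isCont_tendsto_compose[OF this elim]
        have "(\<lambda>k. qform (W x) (u n x - u (s k) x)) \<longlonglongrightarrow> qform (W x) (u n x - g x)" .
        then have "(\<lambda>k. ennreal (qform (W x) (u n x - u (s k) x))) \<longlonglongrightarrow> ennreal (qform (W x) (u n x - g x))"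
          by (rule tendsto_ennrealI)
        then show ?case
          using lim_imp_Liminf[OF sequentially_bot] by metis
      qed
    qed
    also have "\<dots> \<le> liminf (\<lambda>k. \<integral>\<^sup>+x. ennreal (qform (W x) (u n x - u (s k) x)) \<partial>lebesgue)"
    proof (rule nn_integral_liminf)
      fix k
      have "(\<lambda>x. u n x - u (s k) x) \<in> L2W W"
        by (intro L2W_diff u)
      then show "(\<lambda>x. ennreal (qform (W x) (u n x - u (s k) x))) \<in> borel_measurable lebesgue"
        by (auto simp: L2W_iff)
    qed
    also have "\<dots> \<le> ennreal e"
    proof (rule Liminf_le)
      have "(\<integral>\<^sup>+x. ennreal (qform (W x) (u n x - u (s k) x)) \<partial>lebesgue) \<le> ennreal e" if "N \<le> k" for k
        using N[OF n, of "s k"] sM(3)[of k] that nn_energy[OF L2W_diff(1)[OF u u], of n "s k"] by (simp add: ennreal_leI)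
      then show "\<forall>\<^sub>F k in sequentially. (\<integral>\<^sup>+x. ennreal (qform (W x) (u n x - u (s k) x)) \<partial>lebesgue) \<le> ennreal e"
        by (auto simp: eventually_sequentially)
    qed simp
    finally show ?thesis .
  qed
  have un_meas: "u n \<in> borel_measurable lebesgue" for n
    using u by (auto simp: L2W_iff)
  have diff_L2W: "(\<lambda>x. u n x - g x) \<in> L2W W \<and> energy (\<lambda>x. u n x - g x) \<le> e"
    if e: "0 < e" and N: "\<And>m n. N \<le> m \<Longrightarrow> N \<le> n \<Longrightarrow> energy (\<lambda>x. u m x - u n x) \<le> e" and n: "N \<le> n"
    for N n e
  proof -
    have m: "(\<lambda>x. u n x - g x) \<in> borel_measurable lebesgue"
      by (intro borel_measurable_diff un_meas g)
    have nn: "AE x in lebesgue. 0 \<le> qform (W x) (u n x - g x)"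
      using AE_qform_nonneg by eventually_elim simp
    have mq: "(\<lambda>x. qform (W x) (u n x - g x)) \<in> borel_measurable lebesgue"
      by (intro qform_measurable W_measurable m)
    have "(\<integral>\<^sup>+x. ennreal (qform (W x) (u n x - g x)) \<partial>lebesgue) < \<infinity>"
      by (rule le_less_trans[OF fatou[OF e N n]]) auto
    from integrableI_nonneg[OF mq nn this]
    have "integrable lebesgue (\<lambda>x. qform (W x) (u n x - g x))" .
    then have L: "(\<lambda>x. u n x - g x) \<in> L2W W"
      using m by (simp add: L2W_iff)
    then show ?thesis
      using fatou[OF e N n] nn_energy[OF L] e by (simp add: ennreal_le_iff)
  qed
  show ?thesis
  proof
    obtain N where N: "\<And>m n. N \<le> m \<Longrightarrow> N \<le> n \<Longrightarrow> energy (\<lambda>x. u m x - u n x) \<le> 1"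
      using cauchy[of 1] by auto
    have "(\<lambda>x. u N x - g x) \<in> L2W W \<and> energy (\<lambda>x. u N x - g x) \<le> 1"
      by (rule diff_L2W[of 1 N N]) (use N in auto)
    from L2W_diff(1)[OF u[of N] conjunct1[OF this]] show "g \<in> L2W W"
      by simp
    show "(\<lambda>n. energy (\<lambda>x. u n x - g x)) \<longlonglongrightarrow> 0"
    proof (rule LIMSEQ_I)
      fix e :: real
      assume e: "0 < e"
      then obtain N where N: "\<And>m n. N \<le> m \<Longrightarrow> N \<le> n \<Longrightarrow> energy (\<lambda>x. u m x - u n x) \<le> e / 2"
        using cauchy[of "e / 2"] by auto
      have "norm (energy (\<lambda>x. u n x - g x) - 0) < e" if "N \<le> n" for n
        using conjunct2[OF diff_L2W[OF _ N that]] energy_nonneg[of "\<lambda>x. u n x - g x"] e by simp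
      then show "\<exists>no. \<forall>n\<ge>no. norm (energy (\<lambda>x. u n x - g x) - 0) < e"
        by blast
    qed
  qed
qed

section \<open>Functions with vanishing Haar coefficients\<close>

lemma energy_eq_0:
  assumes "f \<in> L2W W" "energy f = 0"
  shows "AE x in lebesgue. f x = 0"
proof -
  have "AE x in lebesgue. qform (W x) (f x) = 0"
    using assms AE_qform_nonneg
    by (subst integral_nonneg_eq_0_iff_AE[symmetric]) (auto simp: L2W_iff elim: eventually_mono)
  then show ?thesis
    using AE_posdef_W by eventually_elim (auto simp: posdef_def)
qed

lemma L2W_set_integrable: "f \<in> L2W W \<Longrightarrow> set_integrable lebesgue {a..<b} f"
  by (intro finite_energy_set_integrable) (simp_all add: L2W_iff)

text \<open>The average of \<open>V\<close> over the whole interval is at least half of its average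
  over \<open>E\<close>; inverting costs a factor 2 and the A2 bound a factor \<open>Q\<close>.
  Through Jensen's inequality the right side bounds from below the energy on \<open>E\<close> of a
  function with mean \<open>c\<close> there.\<close>

lemma doubling:
  assumes h: "0 < h" and E: "E = {a..<a + h} \<or> E = {a + h..<a + 2 * h}"
  shows "2 * h * qform (mean W {a..<a + 2 * h}) c \<le> 4 * Q * (h * qform (matrix_inv (mean V E)) c)"
proof -
  define J where "J = {a..<a + 2 * h}"
  have pos: "posdef (mean V J)" "posdef (mean V {a..<a + h})" "posdef (mean V {a + h..<a + 2 * h})"
    using h by (auto simp: J_def intro!: posdef_mean_V)
  then have pE: "posdef (mean V E)"
    using E by auto
  have "qform (mean V J) x = (qform (mean V {a..<a + h}) x + qform (mean V {a + h..<a + 2 * h}) x) / 2" for x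
    unfolding J_def mean_split[OF h V_set_integrable] by (simp add: qform_scaleR qform_plus)
  moreover have "0 \<le> qform (mean V {a..<a + h}) x" "0 \<le> qform (mean V {a + h..<a + 2 * h}) x" for x
    using pos posdef_imp_psd by (auto simp: psd_iff_qform)
  ultimately have "qform ((1/2) *\<^sub>R mean V E) x \<le> qform (mean V J) x" for x
    using E by (auto simp: qform_scaleR)
  then have "qform (matrix_inv (mean V J)) c \<le> qform (matrix_inv ((1/2) *\<^sub>R mean V E)) c"
    by (intro qform_inv_antimono pos posdef_scaleR pE) auto
  also have "\<dots> = 2 * qform (matrix_inv (mean V E)) c"
    by (simp add: matrix_inv_scaleR posdef_invertible[OF pE] qform_scaleR)
  finally have "Q * qform (matrix_inv (mean V J)) c \<le> Q * (2 * qform (matrix_inv (mean V E)) c)"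
    using Q by (intro mult_left_mono) auto
  moreover have "qform (mean W J) c \<le> Q * qform (matrix_inv (mean V J)) c"
    unfolding J_def using h by (intro a2) simp
  ultimately have "qform (mean W J) c \<le> Q * (2 * qform (matrix_inv (mean V E)) c)"
    by linarith
  then have "2 * h * qform (mean W J) c \<le> 2 * h * (Q * (2 * qform (matrix_inv (mean V E)) c))"
    using h by (intro mult_left_mono) auto
  then show ?thesis
    by (simp add: J_def mult_ac)
qed

text \<open>A function all of whose Haar coefficients vanish is constant on each of the two half-lines
  separated by \<open>\<alpha>\<close>. By the doubling property \<open>W\<close> has infinite mass there, so the constants are zero.\<close>

lemma zero_haar_coeffs_imp_zero:
  fixes h :: "real \<Rightarrow> complex^'n"
  assumes r: "0 < r" and h: "h \<in> L2W W" and coeff: "\<And>I. I \<in> dyadic_grid \<alpha> r \<Longrightarrow> haar_coeff h I = 0"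
  shows "AE x in lebesgue. h x = 0"
proof -
  interpret sw: a2_pair V W Q
    by (rule swap)
  have int: "set_integrable lebesgue {a..<b} h" for a b
    by (rule L2W_set_integrable[OF h])
  have e_int: "set_integrable lebesgue {a..<b} (\<lambda>x. qform (W x) (h x))" for a b
    using h integrable_mult_indicator[of "{a..<b}" lebesgue "\<lambda>x. qform (W x) (h x)"]
    by (simp add: set_integrable_def L2W_iff)
  define m where "m j k = mean h (dyi \<alpha> r j k)" for j k
  have children: "m (j - 1) (2 * k) = m j k" "m (j - 1) (2 * k + 1) = m j k" for j k
  proof -
    obtain a l where al: "0 < l" "dyi \<alpha> r j k = {a..<a + 2 * l}"
      "dyi \<alpha> r (j - 1) (2 * k) = {a..<a + l}" "dyi \<alpha> r (j - 1) (2 * k + 1) = {a + l..<a + 2 * l}"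
      using dyi_split[OF r, of j \<alpha> k] by metis
    have "{a..<a + 2 * l} \<in> dyadic_grid \<alpha> r"
      using al(2)[symmetric] by (auto simp: dyadic_grid_eq[OF r])
    from coeff[OF this] have "mean h {a + l..<a + 2 * l} = mean h {a..<a + l}"
      using al(1) by (simp add: haar_coeff_Ico[OF al(1) int])
    then show "m (j - 1) (2 * k) = m j k" "m (j - 1) (2 * k + 1) = m j k"
      unfolding m_def al(2-4) mean_split[OF al(1) int] by (simp_all flip: scaleR_2)
  qed
  have parent: "m j k = m (j + 1) (k div 2)" for j k
  proof -
    have "k = 2 * (k div 2) \<or> k = 2 * (k div 2) + 1"
      by auto
    then show ?thesis
      using children[of "j + 1" "k div 2"] by (metis add_diff_cancel_right')
  qed
  have ancestor: "m j k = m (j + int n) (k div 2 ^ n)" for j k n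
  proof (induction n)
    case (Suc n)
    have "k div 2 ^ n div 2 = k div 2 ^ Suc n"
      by (simp add: zdiv_zmult2_eq[symmetric] mult.commute)
    then show ?case
      using Suc parent[of "j + int n" "k div 2 ^ n"] by (simp add: add_ac)
  qed simp
  \<comment> \<open>The indices 0 and -1 are the fixed points of \<open>k div 2\<close>. The
    ancestors of such an interval keep its index and grow from \<alpha> to the right or to the left
    half-line.\<close>
  have top: "m j k = 0" if k: "k = 0 \<or> k = -1" for j k
  proof (rule ccontr)
    define c where "c = m j k"
    assume "m j k \<noteq> 0"
    then have c: "c \<noteq> 0"
      by (simp add: c_def)
    define J where "J n = dyi \<alpha> r (j + int n) k" for n
    have k2: "k div 2 = k"
      using k by auto
    have mJ: "m (j + int n) k = c" for n
    proof (induction n)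
      case (Suc n)
      then show ?case
        using parent[of "j + int n" k] by (simp add: k2 add_ac)
    qed (simp add: c_def)
    \<comment> \<open>\<open>A n\<close> is the energy of \<open>h\<close> on the growing interval,
      \<open>B n\<close> the energy of the constant \<open>c\<close> there. Each enlargement adds to
      \<open>A\<close> at least a fixed multiple of \<open>B 0\<close>, which contradicts the finite
      energy of \<open>h\<close>.\<close>
    define A where "A n = (LINT x:J n|lebesgue. qform (W x) (h x))" for n
    define B where "B n = measure lebesgue (J n) * qform (mean W (J n)) c" for n
    have step: "B n \<le> B (Suc n) \<and> A n + B (Suc n) / (4 * Q) \<le> A (Suc n)" for n
    proof -
      obtain a l where al: "0 < l" "dyi \<alpha> r (j + int n + 1) k = {a..<a + 2 * l}"
        "dyi \<alpha> r (j + int n) (2 * k) = {a..<a + l}" "dyi \<alpha> r (j + int n) (2 * k + 1) = {a + l..<a + 2 * l}"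
        using dyi_split[OF r, of "j + int n + 1" \<alpha> k] by (metis add_diff_cancel_right')
      have JS: "J (Suc n) = {a..<a + 2 * l}"
        using al(2) by (simp add: J_def add_ac)
      have means: "mean h {a..<a + l} = c" "mean h {a + l..<a + 2 * l} = c"
      proof -
        have "m (j + int n) (2 * k) = c" "m (j + int n) (2 * k + 1) = c"
          using children[of "j + int n + 1" k] mJ[of "Suc n"] by (simp_all add: add_ac)
        then show "mean h {a..<a + l} = c" "mean h {a + l..<a + 2 * l} = c"
          by (simp_all only: m_def al(3,4))
      qed
      \<comment> \<open>\<open>E\<close> is the sibling of \<open>J n\<close>: index 0 is the left
        child 2 * 0 of the parent with index 0, whereas -1 is the right child 2 * (-1) + 1 of the
        parent with index -1.\<close>
      define E where "E = (if k = 0 then {a + l..<a + 2 * l} else {a..<a + l})"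
      have JE: "(J n = {a..<a + l} \<and> E = {a + l..<a + 2 * l}) \<or> (J n = {a + l..<a + 2 * l} \<and> E = {a..<a + l})"
        using k al(3,4) by (auto simp: J_def E_def)
      have iW: "set_integrable lebesgue {u..<v} (\<lambda>x. qform (W x) c)"
        and mW: "u \<le> v \<Longrightarrow> measure lebesgue {u..<v} * qform (mean W {u..<v}) c = (LINT x:{u..<v}|lebesgue. qform (W x) c)"
        for u v
        using set_integral_linear[OF linear_qform W_set_integrable, of u v c]
        by (auto simp: mean_def qform_scaleR set_lebesgue_integral_def)
      have "B (Suc n) = B n + measure lebesgue E * qform (mean W E) c"
        using JE set_integral_split[of a "a + l" "a + 2 * l" "\<lambda>x. qform (W x) c"] al(1) iW mW[of a "a + l"]
          mW[of "a + l" "a + 2 * l"] mW[of a "a + 2 * l"]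
        by (auto simp: B_def JS)
      moreover have "0 \<le> qform (mean W E) c"
        using posdef_mean_W[of a "a + l"] posdef_mean_W[of "a + l" "a + 2 * l"] al(1) posdef_imp_psd
        by (auto simp: E_def psd_iff_qform)
      ultimately have 1: "B n \<le> B (Suc n)"
        by simp
      have "A (Suc n) = A n + (LINT x:E|lebesgue. qform (W x) (h x))"
        using JE set_integral_split[of a "a + l" "a + 2 * l" "\<lambda>x. qform (W x) (h x)"] al(1) e_int
        by (auto simp: A_def JS)
      moreover have "l * qform (matrix_inv (mean V E)) c \<le> (LINT x:E|lebesgue. qform (W x) (h x))"
        using sw.jensen_inv[OF int e_int, of a "a + l"] sw.jensen_inv[OF int e_int, of "a + l" "a + 2 * l"] al(1)
        by (auto simp: E_def means)
      moreover have "B (Suc n) \<le> 4 * Q * (l * qform (matrix_inv (mean V E)) c)"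
        using doubling[OF al(1), of E a c] JE al(1) by (auto simp: B_def JS)
      then have "B (Suc n) / (4 * Q) \<le> l * qform (matrix_inv (mean V E)) c"
        using Q by (simp add: divide_le_eq mult_ac)
      ultimately show ?thesis
        using 1 by simp
    qed
    have Bmono: "B 0 \<le> B n" for n
      by (induction n) (use step order_trans in blast)+
    have Agrow: "A 0 + real n * (B 0 / (4 * Q)) \<le> A n" for n
    proof (induction n)
      case (Suc n)
      have "B 0 / (4 * Q) \<le> B (Suc n) / (4 * Q)"
        using Bmono[of "Suc n"] Q by (intro divide_right_mono) auto
      then show ?case
        using Suc conjunct2[OF step[of n]] unfolding of_nat_Suc distrib_right mult_1 by linarith
    qed simp
    have Abound: "0 \<le> A n" "A n \<le> energy h" for n
    proof -
      obtain a b where ab: "J n = {a..<b}"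
        by (auto simp: J_def dyi_def)
      have "AE x in lebesgue. 0 \<le> indicat_real (J n) x *\<^sub>R qform (W x) (h x)
          \<and> indicat_real (J n) x *\<^sub>R qform (W x) (h x) \<le> qform (W x) (h x)"
        using AE_qform_nonneg by eventually_elim (auto simp: indicator_def)
      then have *: "AE x in lebesgue. 0 \<le> indicat_real (J n) x *\<^sub>R qform (W x) (h x)"
        "AE x in lebesgue. indicat_real (J n) x *\<^sub>R qform (W x) (h x) \<le> qform (W x) (h x)"
        by (auto elim: eventually_mono)
      show "0 \<le> A n"
        unfolding A_def set_lebesgue_integral_def by (rule integral_nonneg_AE[OF *(1)])
      show "A n \<le> energy h"
        unfolding A_def set_lebesgue_integral_def
        by (rule integral_mono_AE[OF _ _ *(2)]) (use e_int[of a b] h in \<open>auto simp: ab set_integrable_def L2W_iff\<close>)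
    qed
    have "0 < B 0"
    proof -
      obtain a l where al: "0 < l" "dyi \<alpha> r j k = {a..<a + 2 * l}"
        using dyi_split[OF r, of j \<alpha> k] by metis
      have "0 < qform (mean W {a..<a + 2 * l}) c"
        using posdef_mean_W[of a "a + 2 * l"] al(1) c by (simp add: posdef_def)
      then show ?thesis
        using al by (simp add: B_def J_def)
    qed
    then have "0 < B 0 / (4 * Q)"
      using Q by simp
    then obtain n where "energy h < real n * (B 0 / (4 * Q))"
      using reals_Archimedean3 by blast
    then show False
      using Agrow[of n] Abound(2)[of n] Abound(1)[of 0] by linarith
  qed
  have m0: "m j k = 0" for j k
  proof -
    obtain n where n: "\<bar>k\<bar> < 2 ^ n"
      using of_nat_less_two_power[of "nat \<bar>k\<bar>", where 'a=int] by auto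
    \<comment> \<open>Division rounds down, so repeated halving ends at 0 for nonnegative indices
      and at -1 for negative ones.\<close>
    have "k div 2 ^ n = 0 \<or> k div 2 ^ n = -1"
    proof (cases "0 \<le> k")
      case True
      then show ?thesis
        using n by (simp add: div_pos_pos_trivial)
    next
      case False
      then show ?thesis
        using n int_div_pos_eq[of k "2 ^ n" "-1" "k + 2 ^ n"] by auto
    qed
    then show ?thesis
      using ancestor[of j k n] top by simp
  qed
  show ?thesis
  proof (rule AE_zero_of_dyadic[OF r])
    fix j k
    obtain a l where al: "0 < l" "dyi \<alpha> r j k = {a..<a + 2 * l}"
      using dyi_split[OF r, of j \<alpha> k] by metis
    show "set_integrable lebesgue (dyi \<alpha> r j k) h"
      unfolding al(2) by (rule int)
    show "(LINT x:dyi \<alpha> r j k|lebesgue. h x) = 0"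
      using m0[of j k] al(1) by (simp add: m_def mean_def al(2))
  qed
qed

section \<open>Haar coefficients as linear functionals on the weighted space\<close>

lemma haar_integrable:
  assumes r: "0 < r" and I: "I \<in> dyadic_grid \<alpha> r" and f: "f \<in> L2W W"
  shows "integrable lebesgue (\<lambda>x. haar I x *\<^sub>R f x)"
    "haar_coeff f I = (LINT x|lebesgue. haar I x *\<^sub>R f x)"
proof -
  obtain a h where ah: "0 < h" "I = {a..<a + 2 * h}"
    using dyadic_grid_Ico[OF r I] by blast
  show "integrable lebesgue (\<lambda>x. haar I x *\<^sub>R f x)"
    unfolding ah by (intro haar_coeff_integrable ah L2W_set_integrable f)
  show "haar_coeff f I = (LINT x|lebesgue. haar I x *\<^sub>R f x)"
    unfolding ah by (intro haar_coeff_eq ah)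
qed

lemma haar_coeff_add:
  assumes r: "0 < r" and I: "I \<in> dyadic_grid \<alpha> r" and f: "f \<in> L2W W" and g: "g \<in> L2W W"
  shows "haar_coeff (\<lambda>x. f x + g x) I = haar_coeff f I + haar_coeff g I"
  unfolding haar_integrable(2)[OF r I f] haar_integrable(2)[OF r I g] haar_integrable(2)[OF r I L2W_add(1)[OF f g]]
  by (simp add: scaleR_right_distrib haar_integrable(1)[OF r I f] haar_integrable(1)[OF r I g])

lemma haar_coeff_smult:
  assumes r: "0 < r" and I: "I \<in> dyadic_grid \<alpha> r" and f: "f \<in> L2W W"
  shows "haar_coeff (\<lambda>x. c *s f x) I = c *s haar_coeff f I"
proof -
  have "linear (\<lambda>v :: complex^'n. c *s v)"
    by (intro linearI) (simp_all add: vector_add_ldistrib vec_eq_iff)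
  then have T: "bounded_linear (\<lambda>v :: complex^'n. c *s v)"
    by (simp add: linear_conv_bounded_linear)
  have "(LINT x|lebesgue. haar I x *\<^sub>R (c *s f x)) = (LINT x|lebesgue. c *s (haar I x *\<^sub>R f x))"
    by (intro Bochner_Integration.integral_cong refl) (simp add: vec_eq_iff)
  also have "\<dots> = c *s (LINT x|lebesgue. haar I x *\<^sub>R f x)"
    by (rule integral_bounded_linear[OF T haar_integrable(1)[OF r I f]])
  finally show ?thesis
    by (simp add: haar_integrable(2)[OF r I f] haar_integrable(2)[OF r I L2W_smult(1)[OF f]])
qed

lemma haar_coeff_diff:
  assumes r: "0 < r" and I: "I \<in> dyadic_grid \<alpha> r" and f: "f \<in> L2W W" and g: "g \<in> L2W W"
  shows "haar_coeff (\<lambda>x. f x - g x) I = haar_coeff f I - haar_coeff g I"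
  unfolding haar_integrable(2)[OF r I f] haar_integrable(2)[OF r I g] haar_integrable(2)[OF r I L2W_diff(1)[OF f g]]
  by (simp add: scaleR_right_diff_distrib haar_integrable(1)[OF r I f] haar_integrable(1)[OF r I g])

lemma haar_coeff_haar_sum:
  fixes c :: "real set \<Rightarrow> complex^'n"
  assumes r: "0 < r" and I: "I \<in> dyadic_grid \<alpha> r" and F: "finite F" "F \<subseteq> dyadic_grid \<alpha> r"
  shows "haar_coeff (\<lambda>x. \<Sum>J\<in>F. haar J x *\<^sub>R c J) I = (if I \<in> F then c I else 0)"
proof -
  have L: "(\<lambda>x. haar J x *\<^sub>R c J) \<in> L2W W" if "J \<in> F" for J
    using haar_sum_L2W[OF r, of "{J}" \<alpha> c] F that by auto
  have "haar_coeff (\<lambda>x. \<Sum>J\<in>F. haar J x *\<^sub>R c J) I = (LINT x|lebesgue. (\<Sum>J\<in>F. haar I x *\<^sub>R (haar J x *\<^sub>R c J)))"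
    unfolding haar_integrable(2)[OF r I haar_sum_L2W[OF r F]] by (simp only: scaleR_sum_right)
  also have "\<dots> = (\<Sum>J\<in>F. LINT x|lebesgue. haar I x *\<^sub>R (haar J x *\<^sub>R c J))"
    by (intro Bochner_Integration.integral_sum haar_integrable(1)[OF r I] L)
  also have "\<dots> = (\<Sum>J\<in>F. if I = J then c J else 0)"
  proof (intro sum.cong refl)
    fix J
    assume J: "J \<in> F"
    then have "J \<in> dyadic_grid \<alpha> r"
      using F by blast
    from haar_orthonormal[OF r I this, of "c J"] haar_integrable(2)[OF r I L[OF J]]
    show "(LINT x|lebesgue. haar I x *\<^sub>R (haar J x *\<^sub>R c J)) = (if I = J then c J else 0)"
      by simp
  qed
  also have "\<dots> = (if I \<in> F then c I else 0)"
    using F by (simp add: sum.delta')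
  finally show ?thesis .
qed

end

section \<open>Haar multipliers\<close>

text \<open>An increasing exhaustion of the grid by finite families, along which all Haar series are
  summed.\<close>

definition dyfin :: "real \<Rightarrow> real \<Rightarrow> nat \<Rightarrow> real set set" where
  "dyfin \<alpha> r n = (\<lambda>(j, k). dyi \<alpha> r j k) ` ({- int n..int n} \<times> {- int n..int n})"

lemma dyfin: "finite (dyfin \<alpha> r n)" "0 < r \<Longrightarrow> dyfin \<alpha> r n \<subseteq> dyadic_grid \<alpha> r"
  by (auto simp: dyfin_def dyadic_grid_eq)

lemma dyfin_mono: "m \<le> n \<Longrightarrow> dyfin \<alpha> r m \<subseteq> dyfin \<alpha> r n"
  unfolding dyfin_def by (intro image_mono) auto

lemma dyfin_exhausts:
  assumes r: "0 < r" and F: "finite F" "F \<subseteq> dyadic_grid \<alpha> r"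
  shows "\<exists>N. \<forall>n\<ge>N. F \<subseteq> dyfin \<alpha> r n"
  using F
proof (induction F rule: finite_induct)
  case (insert I F)
  then obtain N where N: "\<forall>n\<ge>N. F \<subseteq> dyfin \<alpha> r n"
    by auto
  obtain j k where I: "I = dyi \<alpha> r j k"
    using insert.prems by (auto simp: dyadic_grid_eq[OF r])
  have "I \<in> dyfin \<alpha> r n" if "nat \<bar>j\<bar> + nat \<bar>k\<bar> \<le> n" for n
    unfolding I dyfin_def using that by (intro image_eqI[of _ _ "(j, k)"]) auto
  then show ?case
    using N by (intro exI[of _ "N + (nat \<bar>j\<bar> + nat \<bar>k\<bar>)"]) auto
qed simp

text \<open>Unlike \<open>haar_multiplier\<close> this makes sense for every \<open>f\<close> with
  Haar coefficients. With the identity in place of \<open>\<sigma>\<close> it is a partial sum of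
  the Haar series.\<close>

definition partial_multiplier ::
  "(real set \<Rightarrow> complex^'n^'n) \<Rightarrow> real set set \<Rightarrow> (real \<Rightarrow> complex^'n) \<Rightarrow> real \<Rightarrow> complex^'n" where
  "partial_multiplier \<sigma> F f = (\<lambda>x. \<Sum>I\<in>F. haar I x *\<^sub>R (\<sigma> I *v haar_coeff f I))"

context a2_pair
begin

text \<open>The matrix inequality inside \<open>sigma_norm\<close>, freed from inverse square roots
  by the substitution in \<open>loewner_le_conjugate_iff\<close>.\<close>

definition sigma_bound :: "real set set \<Rightarrow> (real set \<Rightarrow> complex^'n^'n) \<Rightarrow> real \<Rightarrow> bool" where
  "sigma_bound D \<sigma> C \<longleftrightarrow> (\<forall>I\<in>D. \<forall>v. qform (mean W I) (\<sigma> I *v v) \<le> C\<^sup>2 * qform (mean W I) v)"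

lemma qform_mean_nonneg:
  assumes "0 < r" "I \<in> dyadic_grid \<alpha> r"
  shows "0 \<le> qform (mean W I) v"
proof -
  obtain a h where ah: "0 < h" "I = {a..<a + 2 * h}"
    using dyadic_grid_Ico[OF assms] by blast
  then have "psd (mean W I)"
    by (auto intro!: posdef_imp_psd posdef_mean_W)
  then show ?thesis
    by (simp add: psd_iff_qform)
qed

lemma partial_multiplier_L2W:
  assumes "0 < r" "finite F" "F \<subseteq> dyadic_grid \<alpha> r"
  shows "partial_multiplier \<sigma> F f \<in> L2W W"
  unfolding partial_multiplier_def by (rule haar_sum_L2W[OF assms])

lemma partial_multiplier_energy:
  assumes r: "0 < r" and F: "finite F" "F \<subseteq> dyadic_grid \<alpha> r" and \<sigma>: "sigma_bound (dyadic_grid \<alpha> r) \<sigma> C"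
  shows "energy (partial_multiplier \<sigma> F f)
    \<le> sqK TYPE('n) Q * C\<^sup>2 * (\<Sum>I\<in>F. qform (mean W I) (haar_coeff f I))"
proof -
  have "energy (partial_multiplier \<sigma> F f)
      \<le> sqK TYPE('n) Q * (\<Sum>I\<in>F. qform (mean W I) (\<sigma> I *v haar_coeff f I))"
    unfolding partial_multiplier_def by (rule square_function_lower[OF r F])
  also have "\<dots> \<le> sqK TYPE('n) Q * (\<Sum>I\<in>F. C\<^sup>2 * qform (mean W I) (haar_coeff f I))"
    using \<sigma> F sqK_pos by (intro mult_left_mono sum_mono) (auto simp: sigma_bound_def)
  finally show ?thesis
    by (simp add: sum_distrib_left mult_ac)
qed

text \<open>A bound for squared norms: one factor \<open>sqK\<close> stems from the lower square
  function estimate, the other one together with \<open>Q\<close> from the upper estimate.\<close>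

definition mult_const :: "real \<Rightarrow> real" where
  "mult_const C = (sqK TYPE('n) Q)\<^sup>2 * Q * C\<^sup>2"

lemma partial_multiplier_bound:
  assumes r: "0 < r" and F: "finite F" "F \<subseteq> dyadic_grid \<alpha> r" and \<sigma>: "sigma_bound (dyadic_grid \<alpha> r) \<sigma> C"
    and f: "f \<in> L2W W"
  shows "energy (partial_multiplier \<sigma> F f) \<le> mult_const C * energy f"
proof -
  have "energy (partial_multiplier \<sigma> F f)
      \<le> sqK TYPE('n) Q * C\<^sup>2 * (\<Sum>I\<in>F. qform (mean W I) (haar_coeff f I))"
    by (rule partial_multiplier_energy[OF r F \<sigma>])
  also have "\<dots> \<le> sqK TYPE('n) Q * C\<^sup>2 * (Q * sqK TYPE('n) Q * energy f)"
    using sqK_pos f by (intro mult_left_mono square_function_upper[OF r F]) (auto simp: L2W_iff)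
  finally show ?thesis
    by (simp add: mult_const_def power2_eq_square mult_ac)
qed

lemma energy_cong:
  assumes "f \<in> borel_measurable lebesgue" "g \<in> borel_measurable lebesgue" "AE x in lebesgue. f x = g x"
  shows "energy f = energy g"
proof (rule integral_cong_AE)
  show "AE x in lebesgue. qform (W x) (f x) = qform (W x) (g x)"
    using assms(3) by eventually_elim simp
qed (intro qform_measurable W_measurable assms)+

lemma limit_unique:
  assumes u: "\<And>n. u n \<in> L2W W" and g: "g \<in> L2W W" "g' \<in> L2W W"
    and lim: "(\<lambda>n. energy (\<lambda>x. u n x - g x)) \<longlonglongrightarrow> 0" "(\<lambda>n. energy (\<lambda>x. u n x - g' x)) \<longlonglongrightarrow> 0"
  shows "AE x in lebesgue. g x = g' x"
proof -
  have le: "energy (\<lambda>x. g x - g' x) \<le> 2 * energy (\<lambda>x. u n x - g' x) + 2 * energy (\<lambda>x. u n x - g x)" for n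
    using L2W_diff(2)[OF L2W_diff(1)[OF u[of n] g(2)] L2W_diff(1)[OF u[of n] g(1)]] by simp
  have "(\<lambda>n. 2 * energy (\<lambda>x. u n x - g' x) + 2 * energy (\<lambda>x. u n x - g x)) \<longlonglongrightarrow> 2 * 0 + 2 * 0"
    by (intro tendsto_intros lim)
  then have "energy (\<lambda>x. g x - g' x) \<le> 2 * 0 + 2 * 0"
    using le by (intro LIMSEQ_le_const) auto
  then have "energy (\<lambda>x. g x - g' x) = 0"
    using energy_nonneg[of "\<lambda>x. g x - g' x"] by simp
  from energy_eq_0[OF L2W_diff(1)[OF g] this] show ?thesis
    by eventually_elim simp
qed

lemma limit_energy_le:
  assumes u: "\<And>n. u n \<in> L2W W" and g: "g \<in> L2W W" and lim: "(\<lambda>n. energy (\<lambda>x. u n x - g x)) \<longlonglongrightarrow> 0"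
    and b: "\<And>n. energy (u n) \<le> B"
  shows "energy g \<le> 2 * B"
proof -
  have le: "energy g \<le> 2 * B + 2 * energy (\<lambda>x. u n x - g x)" for n
    using L2W_diff(2)[OF u[of n] L2W_diff(1)[OF u[of n] g]] b[of n] by simp
  have "(\<lambda>n. 2 * B + 2 * energy (\<lambda>x. u n x - g x)) \<longlonglongrightarrow> 2 * B + 2 * 0"
    by (intro tendsto_intros lim)
  then have "energy g \<le> 2 * B + 2 * 0"
    using le by (intro LIMSEQ_le_const) auto
  then show ?thesis
    by simp
qed

lemma energy_diff_commute: "energy (\<lambda>x. f x - g x) = energy (\<lambda>x. g x - f x)"
  by (rule Bochner_Integration.integral_cong) (simp_all add: qform_uminus_right[of _ "f x - g x" for x, symmetric])

text \<open>The energy between two partial sums is controlled by an increment of the square function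
  sums \<open>S\<close>. These increase and are bounded, so the partial sums form a Cauchy
  sequence.\<close>

lemma multiplier_limit:
  assumes r: "0 < r" and \<sigma>: "sigma_bound (dyadic_grid \<alpha> r) \<sigma> C" and f: "f \<in> L2W W"
  shows "\<exists>g. g \<in> L2W W \<and> (\<lambda>n. energy (\<lambda>x. partial_multiplier \<sigma> (dyfin \<alpha> r n) f x - g x)) \<longlonglongrightarrow> 0"
proof -
  define K where "K = sqK TYPE('n) Q * C\<^sup>2"
  have K: "0 \<le> K"
    using sqK_pos by (simp add: K_def)
  define S where "S F = (\<Sum>I\<in>F. qform (mean W I) (haar_coeff f I))" for F
  define u where "u n = partial_multiplier \<sigma> (dyfin \<alpha> r n) f" for n
  have u: "u n \<in> L2W W" for n
    unfolding u_def by (rule partial_multiplier_L2W[OF r dyfin(1) dyfin(2)[OF r]])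
  have nn: "0 \<le> qform (mean W I) (haar_coeff f I)" if "I \<in> dyfin \<alpha> r n" for I n
    using that dyfin(2)[OF r] by (intro qform_mean_nonneg[OF r]) auto
  have "incseq (\<lambda>n. S (dyfin \<alpha> r n))"
    unfolding S_def by (intro monoI sum_mono2 dyfin_mono dyfin nn) auto
  moreover have "S (dyfin \<alpha> r n) \<le> Q * sqK TYPE('n) Q * energy f" for n
    unfolding S_def using f by (intro square_function_upper[OF r dyfin(1) dyfin(2)[OF r]]) (auto simp: L2W_iff)
  ultimately have "convergent (\<lambda>n. S (dyfin \<alpha> r n))"
    by (metis incseq_convergent convergentI)
  then have Cauchy: "Cauchy (\<lambda>n. S (dyfin \<alpha> r n))"
    by (rule convergent_Cauchy)
  have diff: "energy (\<lambda>x. u n x - u m x) \<le> K * (S (dyfin \<alpha> r n) - S (dyfin \<alpha> r m))" if "m \<le> n" for m n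
  proof -
    have sub: "dyfin \<alpha> r m \<subseteq> dyfin \<alpha> r n"
      using that by (rule dyfin_mono)
    have "u n x - u m x = partial_multiplier \<sigma> (dyfin \<alpha> r n - dyfin \<alpha> r m) f x" for x
      unfolding u_def partial_multiplier_def by (rule sum_diff[symmetric, OF dyfin(1) sub])
    then have "energy (\<lambda>x. u n x - u m x) = energy (partial_multiplier \<sigma> (dyfin \<alpha> r n - dyfin \<alpha> r m) f)"
      by simp
    also have "\<dots> \<le> K * S (dyfin \<alpha> r n - dyfin \<alpha> r m)"
      unfolding K_def S_def using dyfin(1)[of \<alpha> r n] dyfin(2)[OF r, of \<alpha> n] by (intro partial_multiplier_energy[OF r _ _ \<sigma>]) auto
    also have "S (dyfin \<alpha> r n - dyfin \<alpha> r m) = S (dyfin \<alpha> r n) - S (dyfin \<alpha> r m)"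
      unfolding S_def by (rule sum_diff[OF dyfin(1) sub])
    finally show ?thesis .
  qed
  have "\<exists>M. \<forall>m\<ge>M. \<forall>n\<ge>M. energy (\<lambda>x. u m x - u n x) \<le> e" if e: "0 < e" for e
  proof -
    obtain M where M: "\<And>m n. M \<le> m \<Longrightarrow> M \<le> n \<Longrightarrow> \<bar>S (dyfin \<alpha> r m) - S (dyfin \<alpha> r n)\<bar> < e / (K + 1)"
      using CauchyD[OF Cauchy, of "e / (K + 1)"] e K by auto
    have bd: "energy (\<lambda>x. u n x - u m x) \<le> e" if "m \<le> n" "M \<le> m" for m n
    proof -
      have "K * (S (dyfin \<alpha> r n) - S (dyfin \<alpha> r m)) \<le> K * (e / (K + 1))"
        using M[of n m] that K by (intro mult_left_mono) auto
      also have "\<dots> \<le> (K + 1) * (e / (K + 1))"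
        using e K by (intro mult_right_mono) auto
      also have "\<dots> = e"
        using K by simp
      finally show ?thesis
        using diff[OF that(1)] by linarith
    qed
    have "energy (\<lambda>x. u m x - u n x) \<le> e" if "M \<le> m" "M \<le> n" for m n
      using bd[of m n] bd[of n m] that energy_diff_commute[of "u m" "u n"] by (cases "m \<le> n") auto
    then show ?thesis
      by blast
  qed
  then obtain g where "g \<in> L2W W" "(\<lambda>n. energy (\<lambda>x. u n x - g x)) \<longlonglongrightarrow> 0"
    by (rule L2W_complete[OF u])
  then show ?thesis
    unfolding u_def by blast
qed

section \<open>Density of the Haar sums\<close>

lemma sigma_bound_1: "sigma_bound D (\<lambda>_. mat 1) 1"
  by (simp add: sigma_bound_def)

lemma haar_coeff_bound:
  assumes r: "0 < r" and I: "I \<in> dyadic_grid \<alpha> r" and f: "f \<in> L2W W"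
  shows "qform (mean W I) (haar_coeff f I) \<le> Q * sqK TYPE('n) Q * energy f"
  using square_function_upper[OF r, of "{I}" \<alpha> f] I f by (simp add: L2W_iff)

text \<open>The partial sums have some limit \<open>g\<close> by completeness. Haar coefficients are
  continuous in the energy, so \<open>f - g\<close> has only zero coefficients and vanishes almost
  everywhere.\<close>

lemma haar_partial_sums_converge:
  assumes r: "0 < r" and f: "f \<in> L2W W"
  shows "(\<lambda>n. energy (\<lambda>x. partial_multiplier (\<lambda>_. mat 1) (dyfin \<alpha> r n) f x - f x)) \<longlonglongrightarrow> 0"
proof -
  define u where "u n = partial_multiplier (\<lambda>_. mat 1) (dyfin \<alpha> r n) f" for n
  have u: "u n \<in> L2W W" for n
    unfolding u_def by (rule partial_multiplier_L2W[OF r dyfin(1) dyfin(2)[OF r]])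
  obtain g where g: "g \<in> L2W W" "(\<lambda>n. energy (\<lambda>x. u n x - g x)) \<longlonglongrightarrow> 0"
    using multiplier_limit[OF r sigma_bound_1 f] unfolding u_def by blast
  have "AE x in lebesgue. f x - g x = 0"
  proof (rule zero_haar_coeffs_imp_zero[OF r L2W_diff(1)[OF f g(1)]])
    fix I
    assume I: "I \<in> dyadic_grid \<alpha> r"
    obtain N where N: "\<forall>n\<ge>N. {I} \<subseteq> dyfin \<alpha> r n"
      using dyfin_exhausts[OF r, of "{I}" \<alpha>] I by auto
    have "haar_coeff (u n) I = haar_coeff f I" if "N \<le> n" for n
    proof -
      have "haar_coeff (u n) I = (if I \<in> dyfin \<alpha> r n then mat 1 *v haar_coeff f I else 0)"
        unfolding u_def partial_multiplier_def by (rule haar_coeff_haar_sum[OF r I dyfin(1) dyfin(2)[OF r]])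
      then show ?thesis
        using N that by simp
    qed
    then have "haar_coeff (\<lambda>x. f x - g x) I = haar_coeff (\<lambda>x. u n x - g x) I" if "N \<le> n" for n
      using that by (simp add: haar_coeff_diff[OF r I] f g u)
    then have le: "qform (mean W I) (haar_coeff (\<lambda>x. f x - g x) I) \<le> Q * sqK TYPE('n) Q * energy (\<lambda>x. u n x - g x)"
      if "N \<le> n" for n
      using haar_coeff_bound[OF r I L2W_diff(1)[OF u[of n] g(1)]] that by simp
    have "(\<lambda>n. Q * sqK TYPE('n) Q * energy (\<lambda>x. u n x - g x)) \<longlonglongrightarrow> Q * sqK TYPE('n) Q * 0"
      by (intro tendsto_intros g)
    then have "qform (mean W I) (haar_coeff (\<lambda>x. f x - g x) I) \<le> Q * sqK TYPE('n) Q * 0"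
      by (rule LIMSEQ_le_const) (use le in blast)
    moreover obtain a h where ah: "0 < h" "I = {a..<a + 2 * h}"
      using dyadic_grid_Ico[OF r I] by blast
    then have "posdef (mean W I)"
      by (auto intro!: posdef_mean_W)
    ultimately show "haar_coeff (\<lambda>x. f x - g x) I = 0"
      unfolding posdef_def by (metis mult_zero_right not_le)
  qed
  then have "AE x in lebesgue. u n x - f x = u n x - g x" for n
    by eventually_elim simp
  then have "energy (\<lambda>x. u n x - f x) = energy (\<lambda>x. u n x - g x)" for n
    using L2W_diff(1)[OF u[of n] f] L2W_diff(1)[OF u[of n] g(1)] by (intro energy_cong) (auto simp: L2W_iff)
  then show ?thesis
    using g(2) by (simp add: u_def)
qed

lemma haar_span_L2W:
  assumes "0 < r" "f \<in> haar_span (dyadic_grid \<alpha> r)"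
  shows "f \<in> L2W W"
  using assms haar_sum_L2W unfolding haar_span_def by blast

lemma partial_multiplier_in_haar_span:
  assumes "finite F" "F \<subseteq> D"
  shows "partial_multiplier \<sigma> F f \<in> haar_span D"
  unfolding haar_span_def partial_multiplier_def
  by (intro CollectI exI[of _ F] exI[of _ "\<lambda>I. \<sigma> I *v haar_coeff f I"] conjI assms refl)

text \<open>Orthonormality leaves only the intervals of the given Haar sum in the index set of
  \<open>haar_multiplier\<close>; adding further intervals adds zeros. Estimates for partial
  multipliers therefore apply on the span.\<close>

lemma haar_multiplier_eq_partial:
  fixes f :: "real \<Rightarrow> complex^'n"
  assumes r: "0 < r" and f: "f \<in> haar_span (dyadic_grid \<alpha> r)"
  shows "\<exists>F. finite F \<and> F \<subseteq> dyadic_grid \<alpha> r \<and>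
    (\<forall>G. F \<subseteq> G \<longrightarrow> finite G \<longrightarrow> G \<subseteq> dyadic_grid \<alpha> r \<longrightarrow>
      partial_multiplier \<sigma> G f = haar_multiplier (dyadic_grid \<alpha> r) \<sigma> f)"
proof -
  obtain F e where F: "finite F" "F \<subseteq> dyadic_grid \<alpha> r" "f = (\<lambda>x. \<Sum>I\<in>F. haar I x *\<^sub>R e I)"
    using f by (auto simp: haar_span_def)
  have coeff: "haar_coeff f I = (if I \<in> F then e I else 0)" if "I \<in> dyadic_grid \<alpha> r" for I
    unfolding F(3) by (rule haar_coeff_haar_sum[OF r that F(1,2)])
  have "partial_multiplier \<sigma> G f = haar_multiplier (dyadic_grid \<alpha> r) \<sigma> f"
    if G: "F \<subseteq> G" "finite G" "G \<subseteq> dyadic_grid \<alpha> r" for G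
  proof
    fix x
    have "{I \<in> dyadic_grid \<alpha> r. haar_coeff f I \<noteq> 0} \<subseteq> G"
      using coeff G(1) by (auto split: if_splits)
    then show "partial_multiplier \<sigma> G f x = haar_multiplier (dyadic_grid \<alpha> r) \<sigma> f x"
      unfolding partial_multiplier_def haar_multiplier_def
      using G by (intro sum.mono_neutral_right) auto
  qed
  then show ?thesis
    using F(1,2) by (intro exI[of _ F] conjI allI impI)
qed

lemma haar_multiplier_bound:
  assumes r: "0 < r" and f: "f \<in> haar_span (dyadic_grid \<alpha> r)" and \<sigma>: "sigma_bound (dyadic_grid \<alpha> r) \<sigma> C"
  shows "haar_multiplier (dyadic_grid \<alpha> r) \<sigma> f \<in> L2W W"
    "energy (haar_multiplier (dyadic_grid \<alpha> r) \<sigma> f) \<le> mult_const C * energy f"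
proof -
  obtain F where F: "finite F" "F \<subseteq> dyadic_grid \<alpha> r" and
    eq: "\<forall>G. F \<subseteq> G \<longrightarrow> finite G \<longrightarrow> G \<subseteq> dyadic_grid \<alpha> r \<longrightarrow>
      partial_multiplier \<sigma> G f = haar_multiplier (dyadic_grid \<alpha> r) \<sigma> f"
    using haar_multiplier_eq_partial[OF r f, of \<sigma>] by (elim exE conjE)
  note eq = eq[rule_format, OF subset_refl F]
  show "haar_multiplier (dyadic_grid \<alpha> r) \<sigma> f \<in> L2W W"
    "energy (haar_multiplier (dyadic_grid \<alpha> r) \<sigma> f) \<le> mult_const C * energy f"
    unfolding eq[symmetric]
    by (rule partial_multiplier_L2W[OF r F(1,2)], rule partial_multiplier_bound[OF r F(1,2) \<sigma> haar_span_L2W[OF r f]])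
qed

section \<open>Bounded extensions of the multiplier and their norms\<close>

lemma partial_multiplier_add:
  assumes r: "0 < r" and F: "F \<subseteq> dyadic_grid \<alpha> r" and f: "f \<in> L2W W" and g: "g \<in> L2W W"
  shows "partial_multiplier \<sigma> F (\<lambda>y. f y + g y) x = partial_multiplier \<sigma> F f x + partial_multiplier \<sigma> F g x"
  unfolding partial_multiplier_def sum.distrib[symmetric]
  using F by (intro sum.cong refl)
    (auto simp: haar_coeff_add[OF r _ f g] matrix_vector_right_distrib scaleR_right_distrib)

lemma partial_multiplier_smult:
  assumes r: "0 < r" and F: "F \<subseteq> dyadic_grid \<alpha> r" and f: "f \<in> L2W W"
  shows "partial_multiplier \<sigma> F (\<lambda>y. c *s f y) x = c *s partial_multiplier \<sigma> F f x"
proof -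
  have "partial_multiplier \<sigma> F (\<lambda>y. c *s f y) x = (\<Sum>I\<in>F. c *s (haar I x *\<^sub>R (\<sigma> I *v haar_coeff f I)))"
    unfolding partial_multiplier_def
    using F by (intro sum.cong refl)
      (auto simp: haar_coeff_smult[OF r _ f] vector_scalar_commute vec_eq_iff)
  also have "\<dots> = c *s partial_multiplier \<sigma> F f x"
    by (simp add: partial_multiplier_def vec_eq_iff sum_distrib_left)
  finally show ?thesis .
qed

lemma sigma_bound_imp_bounded:
  assumes r: "0 < r" and \<sigma>: "sigma_bound (dyadic_grid \<alpha> r) \<sigma> C"
  shows "bounded_on_L2W W (dyadic_grid \<alpha> r) \<sigma>"
proof -
  define u where "u f n = partial_multiplier \<sigma> (dyfin \<alpha> r n) f" for f n
  have u: "u f n \<in> L2W W" for f n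
    unfolding u_def by (rule partial_multiplier_L2W[OF r dyfin(1) dyfin(2)[OF r]])
  \<comment> \<open>The limit is determined only up to null sets, so the choice is not linear
    pointwise; \<open>limit_unique\<close> yields the equations almost everywhere that
    \<open>bounded_extension\<close> asks for.\<close>
  define T where "T f = (SOME g. g \<in> L2W W \<and> (\<lambda>n. energy (\<lambda>x. u f n x - g x)) \<longlonglongrightarrow> 0)" for f
  have T: "T f \<in> L2W W" "(\<lambda>n. energy (\<lambda>x. u f n x - T f x)) \<longlonglongrightarrow> 0" if "f \<in> L2W W" for f
    using someI_ex[OF multiplier_limit[OF r \<sigma> that]] unfolding T_def u_def by blast+
  have T_unique: "AE x in lebesgue. T f x = g x"
    if "f \<in> L2W W" "g \<in> L2W W" "(\<lambda>n. energy (\<lambda>x. u f n x - g x)) \<longlonglongrightarrow> 0" for f g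
    by (rule limit_unique[OF u T(1)[OF that(1)] that(2) T(2)[OF that(1)] that(3)])
  have "bounded_extension W (dyadic_grid \<alpha> r) \<sigma> T"
    unfolding bounded_extension_def
  proof (intro conjI ballI allI)
    fix f
    assume "f \<in> L2W W"
    then show "T f \<in> L2W W"
      by (rule T)
  next
    fix f g
    assume fg: "f \<in> L2W W" "g \<in> L2W W"
    show "AE x in lebesgue. T (\<lambda>y. f y + g y) x = T f x + T g x"
    proof (rule T_unique[OF L2W_add(1)[OF fg] L2W_add(1)[OF T(1)[OF fg(1)] T(1)[OF fg(2)]]])
      define w where "w n = 2 * energy (\<lambda>x. u f n x - T f x) + 2 * energy (\<lambda>x. u g n x - T g x)" for n
      have "w \<longlonglongrightarrow> 2 * 0 + 2 * 0"
        unfolding w_def[abs_def] by (intro tendsto_intros T fg)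
      then have "w \<longlonglongrightarrow> 0"
        by simp
      moreover have "norm (energy (\<lambda>x. u (\<lambda>y. f y + g y) n x - (T f x + T g x))) \<le> w n" for n
      proof -
        have eq: "u (\<lambda>y. f y + g y) n x - (T f x + T g x) = (u f n x - T f x) + (u g n x - T g x)" for x
          unfolding u_def partial_multiplier_add[OF r dyfin(2)[OF r] fg] by simp
        show ?thesis
          unfolding eq w_def real_norm_def abs_of_nonneg[OF energy_nonneg]
          by (rule L2W_add(2)[OF L2W_diff(1)[OF u T(1)[OF fg(1)]] L2W_diff(1)[OF u T(1)[OF fg(2)]]])
      qed
      ultimately show "(\<lambda>n. energy (\<lambda>x. u (\<lambda>y. f y + g y) n x - (T f x + T g x))) \<longlonglongrightarrow> 0"
        by (rule Lim_null_comparison[rotated, OF _ always_eventually, OF _ allI])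
    qed
  next
    fix c f
    assume f: "f \<in> L2W W"
    show "AE x in lebesgue. T (\<lambda>y. c *s f y) x = c *s T f x"
    proof (rule T_unique[OF L2W_smult(1)[OF f] L2W_smult(1)[OF T(1)[OF f]]])
      have "energy (\<lambda>x. u (\<lambda>y. c *s f y) n x - c *s T f x) = (cmod c)\<^sup>2 * energy (\<lambda>x. u f n x - T f x)" for n
      proof -
        have "u (\<lambda>y. c *s f y) n x - c *s T f x = c *s (u f n x - T f x)" for x
          unfolding u_def partial_multiplier_smult[OF r dyfin(2)[OF r] f]
          by (simp add: vec_eq_iff right_diff_distrib)
        then show ?thesis
          using L2W_smult(2)[OF L2W_diff(1)[OF u[of f n] T(1)[OF f]], of c] by simp
      qed
      moreover have "(\<lambda>n. (cmod c)\<^sup>2 * energy (\<lambda>x. u f n x - T f x)) \<longlonglongrightarrow> (cmod c)\<^sup>2 * 0"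
        by (intro tendsto_intros T f)
      ultimately show "(\<lambda>n. energy (\<lambda>x. u (\<lambda>y. c *s f y) n x - c *s T f x)) \<longlonglongrightarrow> 0"
        by simp
    qed
  next
    have "L2W_norm W (T f) \<le> sqrt (2 * mult_const C) * L2W_norm W f" if f: "f \<in> L2W W" for f
    proof -
      have "energy (T f) \<le> 2 * (mult_const C * energy f)"
        by (rule limit_energy_le[OF u T[OF f]]) (unfold u_def, rule partial_multiplier_bound[OF r dyfin(1) dyfin(2)[OF r] \<sigma> f])
      then have "sqrt (energy (T f)) \<le> sqrt (2 * mult_const C * energy f)"
        by (simp add: mult.assoc)
      then show ?thesis
        by (simp add: L2W_norm_def Re_cinner real_sqrt_mult flip: qform_def)
    qed
    then show "\<exists>K. \<forall>f\<in>L2W W. L2W_norm W (T f) \<le> K * L2W_norm W f"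
      by blast
  next
    fix f :: "real \<Rightarrow> complex^'n"
    assume f: "f \<in> haar_span (dyadic_grid \<alpha> r)"
    show "AE x in lebesgue. T f x = haar_multiplier (dyadic_grid \<alpha> r) \<sigma> f x"
    proof (rule T_unique[OF haar_span_L2W[OF r f] haar_multiplier_bound(1)[OF r f \<sigma>]])
      obtain F where F: "finite F" "F \<subseteq> dyadic_grid \<alpha> r" and
        eq: "\<forall>G. F \<subseteq> G \<longrightarrow> finite G \<longrightarrow> G \<subseteq> dyadic_grid \<alpha> r \<longrightarrow>
          partial_multiplier \<sigma> G f = haar_multiplier (dyadic_grid \<alpha> r) \<sigma> f"
        using haar_multiplier_eq_partial[OF r f, of \<sigma>] by (elim exE conjE)
      obtain N where N: "\<forall>n\<ge>N. F \<subseteq> dyfin \<alpha> r n"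
        using dyfin_exhausts[OF r F(1,2)] by blast
      have "energy (\<lambda>x. u f n x - haar_multiplier (dyadic_grid \<alpha> r) \<sigma> f x) = 0" if "N \<le> n" for n
      proof -
        have "u f n = haar_multiplier (dyadic_grid \<alpha> r) \<sigma> f"
          unfolding u_def using N that by (intro eq[rule_format] dyfin(1) dyfin(2)[OF r]) simp
        then show ?thesis
          by simp
      qed
      then show "(\<lambda>n. energy (\<lambda>x. u f n x - haar_multiplier (dyadic_grid \<alpha> r) \<sigma> f x)) \<longlonglongrightarrow> 0"
        by (intro tendsto_eventually) (auto simp: eventually_sequentially)
    qed
  qed
  then show ?thesis
    by (auto simp: bounded_on_L2W_def)
qed

text \<open>Testing on a single Haar function with vector \<open>v\<close> suffices: its energy and
  that of its image are the forms of the averaged weight at \<open>v\<close> and at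
  \<open>\<sigma> I *v v\<close>.\<close>

lemma bounded_extension_imp_sigma_bound:
  assumes r: "0 < r" and T: "bounded_extension W (dyadic_grid \<alpha> r) \<sigma> T"
  shows "\<exists>C\<ge>0. sigma_bound (dyadic_grid \<alpha> r) \<sigma> C"
proof -
  obtain K where K: "\<And>f. f \<in> L2W W \<Longrightarrow> L2W_norm W (T f) \<le> K * L2W_norm W f"
    using T unfolding bounded_extension_def by blast
  \<comment> \<open>\<open>K\<close> comes without a sign, whereas a nonnegative constant is sought;
    only the square of \<open>K\<close> enters the inequality.\<close>
  have "sigma_bound (dyadic_grid \<alpha> r) \<sigma> \<bar>K\<bar>"
    unfolding sigma_bound_def
  proof (intro ballI allI)
    fix I and v :: "complex^'n"
    assume I: "I \<in> dyadic_grid \<alpha> r"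
    obtain a h where ah: "0 < h" "I = {a..<a + 2 * h}"
      using dyadic_grid_Ico[OF r I] by blast
    define f where "f = (\<lambda>x. haar I x *\<^sub>R v)"
    have f: "f \<in> L2W W" "energy f = qform (mean W I) v"
      using haar_L2W[OF ah(1), of a v] by (simp_all add: f_def ah(2))
    have span: "f \<in> haar_span (dyadic_grid \<alpha> r)"
      unfolding haar_span_def f_def using I by (intro CollectI exI[of _ "{I}"] exI[of _ "\<lambda>_. v"]) auto
    have coeff: "haar_coeff f J = (if J = I then v else 0)" if "J \<in> dyadic_grid \<alpha> r" for J
      unfolding f_def by (rule haar_orthonormal[OF r that I])
    have "haar_multiplier (dyadic_grid \<alpha> r) \<sigma> f x = haar I x *\<^sub>R (\<sigma> I *v v)" for x
    proof (cases "v = 0")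
      case True
      then have "{J \<in> dyadic_grid \<alpha> r. haar_coeff f J \<noteq> 0} = {}"
        using coeff by auto
      then show ?thesis
        by (simp add: haar_multiplier_def True)
    next
      case False
      then have "{J \<in> dyadic_grid \<alpha> r. haar_coeff f J \<noteq> 0} = {I}"
        using coeff I by (auto split: if_splits)
      then show ?thesis
        by (simp add: haar_multiplier_def coeff[OF I])
    qed
    then have "AE x in lebesgue. T f x = haar I x *\<^sub>R (\<sigma> I *v v)"
      using T span by (auto simp: bounded_extension_def)
    moreover have "T f \<in> L2W W"
      using T f by (auto simp: bounded_extension_def)
    ultimately have "energy (T f) = qform (mean W I) (\<sigma> I *v v)"
      using haar_L2W[OF ah(1), of a "\<sigma> I *v v"] energy_cong[of "T f" "\<lambda>x. haar I x *\<^sub>R (\<sigma> I *v v)"]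
      by (simp add: ah(2) L2W_iff)
    moreover have "(L2W_norm W (T f))\<^sup>2 \<le> (K * L2W_norm W f)\<^sup>2"
      using K[OF f(1)] energy_nonneg[of "T f"]
      by (intro power_mono) (simp_all add: L2W_norm_def Re_cinner flip: qform_def)
    ultimately show "qform (mean W I) (\<sigma> I *v v) \<le> \<bar>K\<bar>\<^sup>2 * qform (mean W I) v"
      by (simp add: power_mult_distrib L2W_norm_eq f(2))
  qed
  then show ?thesis
    by (intro exI[of _ "\<bar>K\<bar>"]) simp
qed

text \<open>The bound \<open>K\<close> that comes with \<open>T\<close> is uncontrolled, so it is
  applied only to the remainder \<open>f - u n\<close>, whose energy tends to 0. The Haar sum
  \<open>u n\<close> is estimated by \<open>mult_const\<close>. The factor 4 comes from splitting
  once after and once before applying \<open>T\<close>.\<close>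

lemma bounded_extension_energy:
  assumes r: "0 < r" and T: "bounded_extension W (dyadic_grid \<alpha> r) \<sigma> T"
    and \<sigma>: "sigma_bound (dyadic_grid \<alpha> r) \<sigma> C" and f: "f \<in> L2W W"
  shows "energy (T f) \<le> 4 * mult_const C * energy f"
proof -
  obtain K where K: "\<And>f. f \<in> L2W W \<Longrightarrow> L2W_norm W (T f) \<le> K * L2W_norm W f"
    using T unfolding bounded_extension_def by blast
  have TL: "T f \<in> L2W W" if "f \<in> L2W W" for f
    using T that by (auto simp: bounded_extension_def)
  have K2: "energy (T f) \<le> K\<^sup>2 * energy f" if "f \<in> L2W W" for f
  proof -
    have "(L2W_norm W (T f))\<^sup>2 \<le> (K * L2W_norm W f)\<^sup>2"
      using K[OF that] energy_nonneg[of "T f"]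
      by (intro power_mono) (simp_all add: L2W_norm_def Re_cinner flip: qform_def)
    then show ?thesis
      by (simp add: power_mult_distrib L2W_norm_eq)
  qed
  define u where "u n = partial_multiplier (\<lambda>_. mat 1) (dyfin \<alpha> r n) f" for n
  have u: "u n \<in> L2W W" for n
    unfolding u_def by (rule partial_multiplier_L2W[OF r dyfin(1) dyfin(2)[OF r]])
  have span: "u n \<in> haar_span (dyadic_grid \<alpha> r)" for n
    unfolding u_def by (intro partial_multiplier_in_haar_span dyfin r)
  have lim: "(\<lambda>n. energy (\<lambda>x. u n x - f x)) \<longlonglongrightarrow> 0"
    unfolding u_def by (rule haar_partial_sums_converge[OF r f])
  define M where "M = mult_const C"
  have M: "0 \<le> M"
    using Q by (simp add: M_def mult_const_def)
  have Tu: "energy (T (u n)) \<le> M * energy (u n)" for n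
  proof -
    have "AE x in lebesgue. T (u n) x = haar_multiplier (dyadic_grid \<alpha> r) \<sigma> (u n) x"
      using T span by (auto simp: bounded_extension_def)
    then have "energy (T (u n)) = energy (haar_multiplier (dyadic_grid \<alpha> r) \<sigma> (u n))"
      using TL[OF u] haar_multiplier_bound(1)[OF r span \<sigma>] by (intro energy_cong) (auto simp: L2W_iff)
    then show ?thesis
      using haar_multiplier_bound(2)[OF r span \<sigma>] by (simp add: M_def)
  qed
  have le: "energy (T f) \<le> 4 * M * energy f + (4 * M + 2 * K\<^sup>2) * energy (\<lambda>x. u n x - f x)" for n
  proof -
    define d where "d = (\<lambda>x. f x - u n x)"
    have d: "d \<in> L2W W" "energy d = energy (\<lambda>x. u n x - f x)"
      unfolding d_def by (rule L2W_diff(1)[OF f u], rule energy_diff_commute)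
    have fd: "f = (\<lambda>x. u n x + d x)"
      by (simp add: d_def)
    have "AE x in lebesgue. T (\<lambda>x. u n x + d x) x = T (u n) x + T d x"
      using T u d(1) unfolding bounded_extension_def by blast
    then have "energy (T f) = energy (\<lambda>x. T (u n) x + T d x)"
      using TL[OF f] L2W_add(1)[OF TL[OF u[of n]] TL[OF d(1)]]
      by (intro energy_cong) (auto simp: L2W_iff simp flip: fd)
    also have "\<dots> \<le> 2 * energy (T (u n)) + 2 * energy (T d)"
      by (rule L2W_add(2)[OF TL[OF u] TL[OF d(1)]])
    also have "\<dots> \<le> 2 * (M * energy (u n)) + 2 * (K\<^sup>2 * energy d)"
      using Tu[of n] K2[OF d(1)] by simp
    also have "\<dots> \<le> 2 * (M * (2 * energy f + 2 * energy d)) + 2 * (K\<^sup>2 * energy d)"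
      using L2W_diff(2)[OF f d(1)] M by (intro add_mono mult_left_mono) (simp_all add: d_def)
    finally show ?thesis
      by (simp add: d(2) algebra_simps)
  qed
  have "(\<lambda>n. 4 * M * energy f + (4 * M + 2 * K\<^sup>2) * energy (\<lambda>x. u n x - f x)) \<longlonglongrightarrow> 4 * M * energy f + (4 * M + 2 * K\<^sup>2) * 0"
    by (intro tendsto_intros lim)
  then have "energy (T f) \<le> 4 * M * energy f + (4 * M + 2 * K\<^sup>2) * 0"
    by (rule LIMSEQ_le_const) (use le in blast)
  then show ?thesis
    by (simp add: M_def)
qed

end

text \<open>The matrix on the left is the congruence of \<open>A\<close> by \<open>S ** R\<close>.
  Since \<open>R\<close> is invertible and turns the form of \<open>A\<close> into the squared norm,
  the substitution \<open>v = R *v x\<close> identifies the two conditions.\<close>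

lemma loewner_le_conjugate_iff:
  assumes A: "posdef A"
  defines "R \<equiv> matrix_inv (mat_sqrt A)"
  shows "loewner_le (R ** mat_adjoint S ** A ** S ** R) (mat (of_real (C\<^sup>2)))
    \<longleftrightarrow> (\<forall>v. qform A (S *v v) \<le> C\<^sup>2 * qform A v)"
proof -
  have inv: "invertible (mat_sqrt A)"
    by (rule invertible_mat_sqrt[OF A])
  have hR: "mat_adjoint R = R"
    unfolding R_def by (rule mat_adjoint_matrix_inv[OF inv mat_sqrt_herm[OF posdef_imp_psd[OF A]]])
  define M where "M = R ** mat_adjoint S ** A ** S ** R"
  have M: "M = mat_adjoint (S ** R) ** A ** (S ** R)"
    by (simp add: M_def mat_adjoint_mult hR matrix_mul_assoc)
  have qM: "qform M x = qform A (S *v (R *v x))" for x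
    unfolding M qform_congruence by (simp add: matrix_vector_mul_assoc)
  have hM: "mat_adjoint M = M"
    using A unfolding M by (simp add: mat_adjoint_mult matrix_mul_assoc posdef_def)
  have qR: "qform A (R *v x) = (norm x)\<^sup>2" for x
    unfolding R_def by (rule qform_sqrt_inv_mv[OF A])
  have "loewner_le M (mat (of_real (C\<^sup>2))) \<longleftrightarrow> (\<forall>x. qform A (S *v (R *v x)) \<le> C\<^sup>2 * qform A (R *v x))"
    unfolding loewner_le_def psd_iff_qform
    by (simp only: mat_adjoint_diff mat_adjoint_of_real hM qform_minus qform_of_real qM qR) simp
  also have "\<dots> \<longleftrightarrow> (\<forall>v. qform A (S *v v) \<le> C\<^sup>2 * qform A v)"
  proof
    assume *: "\<forall>x. qform A (S *v (R *v x)) \<le> C\<^sup>2 * qform A (R *v x)"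
    show "\<forall>v. qform A (S *v v) \<le> C\<^sup>2 * qform A v"
    proof
      fix v
      show "qform A (S *v v) \<le> C\<^sup>2 * qform A v"
        using *[rule_format, of "mat_sqrt A *v v"] by (simp add: R_def mv_matrix_inv[OF inv])
    qed
  qed simp
  finally show ?thesis
    by (simp add: M_def)
qed

lemma (in a2_pair) sigma_norm_eq:
  assumes r: "0 < r"
  shows "sigma_norm W (dyadic_grid \<alpha> r) \<sigma>
    = Inf {ereal C | C. 0 \<le> C \<and> sigma_bound (dyadic_grid \<alpha> r) \<sigma> C}"
proof -
  have pos: "posdef (average W I)" if I: "I \<in> dyadic_grid \<alpha> r" for I
  proof -
    obtain a h where "0 < h" "I = {a..<a + 2 * h}"
      using dyadic_grid_Ico[OF r I] by blast
    then show ?thesis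
      by (auto simp: average_eq_mean intro!: posdef_mean_W)
  qed
  have "(\<forall>I\<in>dyadic_grid \<alpha> r. loewner_le
        (matrix_inv (mat_sqrt (average W I)) ** mat_adjoint (\<sigma> I) ** average W I
          ** \<sigma> I ** matrix_inv (mat_sqrt (average W I)))
        (mat (of_real (C\<^sup>2)))) \<longleftrightarrow> sigma_bound (dyadic_grid \<alpha> r) \<sigma> C" for C
    unfolding sigma_bound_def average_eq_mean[symmetric]
    by (intro ball_cong refl loewner_le_conjugate_iff pos)
  then show ?thesis
    unfolding sigma_norm_def by simp
qed

section \<open>From the A2 characteristic to form inequalities\<close>

lemma mat_norm_bound: "norm (A *v x) \<le> mat_norm A * norm x"
  unfolding mat_norm_def
  by (intro onorm linear_conv_bounded_linear[THEN iffD1] linear_mv_right)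

text \<open>Writing \<open>x = mat_sqrt B *v y\<close> turns the form of the inverse of
  \<open>B\<close> into the squared norm of \<open>y\<close> and the form of \<open>A\<close> into
  the squared norm of the product applied to \<open>y\<close>.\<close>

lemma qform_le_of_mat_norm:
  assumes A: "psd A" and B: "posdef B" and le: "(mat_norm (mat_sqrt A ** mat_sqrt B))\<^sup>2 \<le> Q"
  shows "qform A x \<le> Q * qform (matrix_inv B) x"
proof -
  define R where "R = matrix_inv (mat_sqrt B)"
  have inv: "invertible (mat_sqrt B)"
    by (rule invertible_mat_sqrt[OF B])
  define y where "y = R *v x"
  have x: "x = mat_sqrt B *v y"
    by (simp add: y_def R_def mv_matrix_inv[OF inv])
  have "B *v (R *v y) = x"
    unfolding mat_sqrt_sqrt_mv[OF posdef_imp_psd[OF B], symmetric]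
    by (simp add: R_def mv_matrix_inv[OF inv] x)
  then have "matrix_inv B *v x = R *v y"
    using mv_matrix_inv(2)[OF posdef_invertible[OF B]] by metis
  then have qB: "qform (matrix_inv B) x = (norm y)\<^sup>2"
    using inner_hermitian[OF mat_sqrt_herm[OF posdef_imp_psd[OF B]], of "R *v y" y]
    by (simp add: qform_def x R_def mv_matrix_inv[OF inv] power2_norm_eq_inner)
  have "norm ((mat_sqrt A ** mat_sqrt B) *v y) \<le> mat_norm (mat_sqrt A ** mat_sqrt B) * norm y"
    by (rule mat_norm_bound)
  then have "(norm (mat_sqrt A *v x))\<^sup>2 \<le> (mat_norm (mat_sqrt A ** mat_sqrt B) * norm y)\<^sup>2"
    unfolding x matrix_vector_mul_assoc by (intro power_mono) auto
  also have "\<dots> \<le> Q * (norm y)\<^sup>2"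
    unfolding power_mult_distrib using le by (intro mult_right_mono) auto
  finally show ?thesis
    by (simp add: qform_mat_sqrt[OF A] qB)
qed

lemma matrix_A2_imp_a2_pair:
  fixes W :: "real \<Rightarrow> complex^'n^'n"
  assumes "matrix_A2 W"
  shows "a2_pair W (\<lambda>x. matrix_inv (W x)) (real_of_ereal (A2_char W))"
proof -
  define V where "V = (\<lambda>x. matrix_inv (W x))"
  define Q where "Q = real_of_ereal (A2_char W)"
  have W_int: "locally_integrable (\<lambda>x. W x $ i $ j)" and V_int: "locally_integrable (\<lambda>x. V x $ i $ j)" for i j
    using assms by (auto simp: matrix_A2_def matrix_weight_def V_def)
  have "AE x in lebesgue. psd (W x)" "AE x in lebesgue. invertible (W x)"
    using assms by (auto simp: matrix_A2_def matrix_weight_def)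
  then have inverse: "AE x in lebesgue. posdef (W x) \<and> V x = matrix_inv (W x)"
    by eventually_elim (simp add: V_def psd_invertible_posdef)
  have "AE x in lebesgue. posdef (W x)" "AE x in lebesgue. posdef (V x)"
    using inverse by (auto elim!: eventually_mono simp: posdef_matrix_inv V_def)
  then have pos: "posdef (mean W {a..<b})" "posdef (mean V {a..<b})" if "a < b" for a b
    using that by (auto intro!: mean_posdef matrix_set_integrable locally_integrable_Ico W_int V_int)
  have char_le: "ereal ((mat_norm (mat_sqrt (mean W {a..<b}) ** mat_sqrt (mean V {a..<b})))\<^sup>2) \<le> A2_char W"
    if "a < b" for a b
    unfolding A2_char_def average_eq_mean V_def[symmetric]
    by (intro SUP_upper) (use that in \<open>auto simp: bounded_interval_def is_interval_1\<close>)
  have "A2_char W \<noteq> \<infinity>" "0 \<le> A2_char W"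
    using assms order_trans[OF _ char_le[of 0 1], of 0] by (auto simp: matrix_A2_def)
  then have char: "A2_char W = ereal Q"
    by (cases "A2_char W") (auto simp: Q_def)
  have a2: "qform (mean W {a..<b}) x \<le> Q * qform (matrix_inv (mean V {a..<b})) x" if "a < b" for a b x
    using char_le[OF that] pos[OF that] unfolding char
    by (intro qform_le_of_mat_norm posdef_imp_psd) auto
  \<comment> \<open>The locale assumes \<open>1 \<le> Q\<close>, but this fact itself rests on
    Jensen's inequality from the locale. A first instance with \<open>max 1 Q\<close> breaks the
    circle: comparing Jensen's lower bound with the A2 upper bound on one interval then gives
    \<open>1 \<le> Q\<close>.\<close>
  have "a2_pair W V (max 1 Q)"
  proof
    fix a b :: real and x :: "complex^'n"
    assume ab: "a < b"
    have "0 \<le> qform (matrix_inv (mean V {a..<b})) x"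
      using posdef_imp_psd[OF posdef_matrix_inv[OF pos(2)[OF ab]]] by (simp add: psd_iff_qform)
    then have "Q * qform (matrix_inv (mean V {a..<b})) x \<le> max 1 Q * qform (matrix_inv (mean V {a..<b})) x"
      by (intro mult_right_mono) auto
    then show "qform (mean W {a..<b}) x \<le> max 1 Q * qform (matrix_inv (mean V {a..<b})) x"
      using a2[OF ab, of x] by linarith
  qed (use W_int V_int inverse in auto)
  then interpret sw: a2_pair V W "max 1 Q"
    by (rule a2_pair.swap)
  have "1 \<le> Q"
  proof -
    define e :: "complex^'n" where "e = axis undefined 1"
    define q where "q = qform (matrix_inv (mean V {0..<1})) e"
    have "0 < q"
      using posdef_matrix_inv[OF pos(2)[of 0 1]] by (simp add: posdef_def q_def e_def axis_eq_0_iff)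
    moreover have "1 * q \<le> Q * q"
      using sw.qform_inv_mean_le[of 0 1 e] a2[of 0 1 e] by (simp add: q_def)
    ultimately show ?thesis
      by (rule mult_right_le_imp_le[rotated])
  qed
  then have "a2_pair W V Q"
    using W_int V_int inverse a2 by unfold_locales
  then show ?thesis
    by (simp add: V_def Q_def)
qed

lemma (in a2_pair) bounded_extension_norm:
  assumes r: "0 < r" and T: "bounded_extension W (dyadic_grid \<alpha> r) \<sigma> T"
    and \<sigma>: "sigma_bound (dyadic_grid \<alpha> r) \<sigma> C" and C: "0 \<le> C" and f: "f \<in> L2W W"
  shows "L2W_norm W (T f)
    \<le> 196 * real CARD('n) * Q powr (3/2) * (1 + ln Q) * C * L2W_norm W f"
proof -
  define n where "n = real CARD('n)"
  define l where "l = 1 + ln Q"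
  have n: "1 \<le> n" and l: "1 \<le> l"
    using Q by (simp_all add: n_def l_def Suc_le_eq)
  \<comment> \<open>The summand 2 of \<open>sqK\<close> is absorbed into the product, which is at
    least 1: 2 + 96 gives 98. The factor 4 under the root doubles it to 196.\<close>
  have "1 * 1 * 1 \<le> n * Q * l"
    using n l Q by (intro mult_mono) auto
  moreover have "sqK TYPE('n) Q = 2 + 96 * (n * Q * l)"
    by (simp add: sqK_def bell_K_def n_def l_def)
  ultimately have K: "sqK TYPE('n) Q \<le> 98 * (n * Q * l)"
    by linarith
  have "L2W_norm W (T f) = sqrt (energy (T f))"
    by (simp add: L2W_norm_def Re_cinner flip: qform_def)
  also have "\<dots> \<le> sqrt (4 * mult_const C * energy f)"
    using bounded_extension_energy[OF r T \<sigma> f] by simp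
  also have "\<dots> = sqrt ((2 * sqK TYPE('n) Q * C)\<^sup>2 * (Q * energy f))"
    by (simp add: mult_const_def power2_eq_square mult_ac)
  also have "\<dots> = 2 * sqK TYPE('n) Q * C * (sqrt Q * sqrt (energy f))"
    using sqK_pos C by (simp add: real_sqrt_mult)
  also have "sqrt (energy f) = L2W_norm W f"
    by (simp add: L2W_norm_def Re_cinner flip: qform_def)
  also have "2 * sqK TYPE('n) Q * C * (sqrt Q * L2W_norm W f)
      \<le> 2 * (98 * (n * Q * l)) * C * (sqrt Q * L2W_norm W f)"
    using K C Q energy_nonneg[of f]
    by (intro mult_right_mono mult_left_mono) (auto simp: L2W_norm_def Re_cinner simp flip: qform_def)
  also have "\<dots> = 196 * n * (Q * sqrt Q) * l * C * L2W_norm W f"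
    by simp
  also have "Q * sqrt Q = Q powr (3/2)"
    using Q powr_add[of Q 1 "1/2"] by (simp add: powr_half_sqrt)
  finally show ?thesis
    by (simp add: n_def l_def)
qed

theorem theorem5p2:
  "\<exists>C::real. \<forall>(W :: real \<Rightarrow> complex^'n^'n) (\<sigma> :: real set \<Rightarrow> complex^'n^'n) (\<alpha>::real) (r::real).
     matrix_A2 W \<and> 0 < r \<longrightarrow>
       (bounded_on_L2W W (dyadic_grid \<alpha> r) \<sigma> \<longleftrightarrow> sigma_norm W (dyadic_grid \<alpha> r) \<sigma> < \<infinity>) \<and>
       (\<forall>T. bounded_extension W (dyadic_grid \<alpha> r) \<sigma> T \<longrightarrow>
         (\<forall>f\<in>L2W W.
            L2W_norm W (T f)
              \<le> C * real_of_ereal (A2_char W) powr (3/2) * (1 + ln (real_of_ereal (A2_char W)))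
                  * real_of_ereal (sigma_norm W (dyadic_grid \<alpha> r) \<sigma>) * L2W_norm W f))"
proof (intro exI[of _ "196 * real CARD('n)"] allI impI)
  fix W :: "real \<Rightarrow> complex^'n^'n" and \<sigma> :: "real set \<Rightarrow> complex^'n^'n" and \<alpha> r :: real
  assume A: "matrix_A2 W \<and> 0 < r"
  then have r: "0 < r"
    by simp
  define Q where "Q = real_of_ereal (A2_char W)"
  interpret a2_pair W "\<lambda>x. matrix_inv (W x)" Q
    unfolding Q_def by (rule matrix_A2_imp_a2_pair) (use A in simp)
  define D where "D = dyadic_grid \<alpha> r"
  define S where "S = {ereal C | C. 0 \<le> C \<and> sigma_bound D \<sigma> C}"
  have norm: "sigma_norm W D \<sigma> = Inf S"
    unfolding D_def S_def by (rule sigma_norm_eq[OF r])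
  have S_nonempty: "Inf S < \<infinity>" if T: "bounded_extension W D \<sigma> T" for T
  proof -
    obtain C where "0 \<le> C" "sigma_bound D \<sigma> C"
      using bounded_extension_imp_sigma_bound[OF r T[unfolded D_def]] by (auto simp: D_def)
    then have "ereal C \<in> S"
      by (auto simp: S_def)
    then have "Inf S \<le> ereal C"
      by (rule Inf_lower)
    then show ?thesis
      by (rule le_less_trans) simp
  qed
  have "bounded_on_L2W W D \<sigma> \<longleftrightarrow> Inf S < \<infinity>"
  proof
    show "Inf S < \<infinity>" if "bounded_on_L2W W D \<sigma>"
      using that S_nonempty by (auto simp: bounded_on_L2W_def)
    assume "Inf S < \<infinity>"
    then obtain C where "sigma_bound D \<sigma> C"
      unfolding Inf_less_iff by (auto simp: S_def)
    then show "bounded_on_L2W W D \<sigma>"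
      unfolding D_def by (rule sigma_bound_imp_bounded[OF r])
  qed
  moreover have "L2W_norm W (T f)
      \<le> 196 * real CARD('n) * Q powr (3/2) * (1 + ln Q) * real_of_ereal (Inf S) * L2W_norm W f"
    if T: "bounded_extension W D \<sigma> T" and f: "f \<in> L2W W" for T f
  proof -
    \<comment> \<open>\<open>real_of_ereal\<close> sends infinity to 0, so the norm has to be known
      to be finite before the estimate can be read as intended; the given extension \<open>T\<close>
      guarantees this.\<close>
    have "0 \<le> Inf S"
      by (intro Inf_greatest) (auto simp: S_def)
    with S_nonempty[OF T] obtain s where s: "Inf S = ereal s" "0 \<le> s"
      by (cases "Inf S") auto
    define y where "y = 196 * real CARD('n) * Q powr (3/2) * (1 + ln Q) * L2W_norm W f"
    have y: "0 \<le> y"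
      using Q energy_nonneg[of f] by (simp add: y_def L2W_norm_def Re_cinner flip: qform_def)
    have le: "L2W_norm W (T f) \<le> C * y" if "ereal C \<in> S" for C
      using bounded_extension_norm[OF r T[unfolded D_def] _ _ f, of C] that
      by (auto simp: S_def D_def y_def mult_ac)
    have "L2W_norm W (T f) \<le> s * y"
    proof (rule ccontr)
      assume gt: "\<not> L2W_norm W (T f) \<le> s * y"
      \<comment> \<open>The estimate is known for admissible constants, not for their infimum, which
        is therefore approached within \<open>e\<close>. The denominator \<open>y + 1\<close> covers
        \<open>y = 0\<close>.\<close>
      define e where "e = (L2W_norm W (T f) - s * y) / (y + 1)"
      have "0 < e"
        using gt y by (simp add: e_def)
      then have "Inf S < ereal (s + e)"
        by (simp add: s)
      then obtain C where C: "ereal C \<in> S" "C < s + e"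
        unfolding Inf_less_iff by (auto simp: S_def)
      have "L2W_norm W (T f) \<le> (s + e) * y"
        using le[OF C(1)] mult_right_mono[OF less_imp_le[OF C(2)] y] by linarith
      moreover have "e * y < e * (y + 1)"
        using \<open>0 < e\<close> by simp
      moreover have "e * (y + 1) = L2W_norm W (T f) - s * y"
        using y by (simp add: e_def)
      ultimately show False
        by (simp add: algebra_simps)
    qed
    then show ?thesis
      by (simp add: s y_def mult_ac)
  qed
  ultimately show "(bounded_on_L2W W (dyadic_grid \<alpha> r) \<sigma> \<longleftrightarrow> sigma_norm W (dyadic_grid \<alpha> r) \<sigma> < \<infinity>) \<and>
       (\<forall>T. bounded_extension W (dyadic_grid \<alpha> r) \<sigma> T \<longrightarrow>
         (\<forall>f\<in>L2W W.
            L2W_norm W (T f)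
              \<le> 196 * real CARD('n) * real_of_ereal (A2_char W) powr (3/2) * (1 + ln (real_of_ereal (A2_char W)))
                  * real_of_ereal (sigma_norm W (dyadic_grid \<alpha> r) \<sigma>) * L2W_norm W f))"
    unfolding D_def[symmetric] norm Q_def[symmetric] by blast
qed

end
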